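(* For any $\texttt{QPTL}_{cf}$ formula $\xi$, it is decidable whether $\xi$ is satisfiable (i.e. whether some trace satisfies $\xi$), provided the similarity relation belongs to the family $\leq^{\texttt{QPTL}}$ and the universe is defined by a $\texttt{QPTL}$ formula.
   Context: Traces are infinite words $t = t[0]t[1]\ldots \in (2^{AP})^\omega$ over a finite set $AP$ of atomic propositions. LTL: $\varphi ::= a \mid \neg\varphi \mid \varphi\wedge\varphi \mid \mathsf{X}\varphi \mid \varphi\,\mathsf{U}\,\varphi$ with the standard semantics ($t,i\models a$ iff $a\in t[i]$; $t,i\models\mathsf{X}\varphi$ iff $t,i+1\models\varphi$; $t,i\models\varphi\mathsf{U}\psi$ iff $\exists j\ge i.\ t,j\models\psi\wedge\forall i\le k<j.\ t,k\models\varphi$), and $t\models\varphi$ iff $t,0\models\varphi$. QPTL formulas are $\psi ::= \exists q.\psi \mid \forall q.\psi \mid \varphi$ ($\varphi$ LTL, $q$ fresh), where $t\models\exists q.\psi$ iff some $t_q\in(2^{\{q\}})^\omega$ gives $t[q\mapsto t_q]\models\psi$ (and $\forall$ dually), with $t[q\mapsto t_q]$ agreeing with $t_q$ on $q$ and with $t$ elsewhere. $\mathcal{L}(\varphi)$ is the set of traces satisfying $\varphi$. $\texttt{QPTL}_{cf}$ formulas: $\xi ::= \psi\rightsquigarrow\psi \mid \psi\rightsquigarrow_{\min}\psi \mid \xi\wedge\xi\mid\neg\xi\mid\psi$, where $\psi$ are QPTL formulas and $\rightsquigarrow\in\{\Box\!\!\to,\Diamond\!\!\to,\Box\!\!\to_\forall,\Diamond\!\!\to_\exists\}$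 (no nesting of counterfactuals). Worlds are traces, the universe is $\mathcal{U}=\mathcal{L}(\varphi_{\mathcal{U}})$ for a QPTL formula $\varphi_\mathcal{U}$, and quantifiers in the counterfactual semantics range over $\mathcal{U}$. For each reference trace $W$ there is a preorder $\leq_W$ on $\mathcal{U}$ with minimum $W$. Semantics: `Would' $W\models\varphi\Box\!\!\to\psi$ iff $\forall W_1.W_1\not\models\varphi$ or $\exists W_1.W_1\models\varphi\wedge\forall W_2.(W_2\leq_W W_1\Rightarrow W_2\models\varphi\to\psi)$; `Might' $W\models\varphi\Diamond\!\!\to\psi$ iff $\exists W_1.W_1\models\varphi$ and $\forall W_1.(W_1\models\varphi\Rightarrow\exists W_2.W_2\leq_W W_1\wedge W_2\models\varphi\wedge\psi)$; `Universal Would' $W\models\varphi\Box\!\!\to_\forall\psi$ iff $\forall W_1.W_1\not\models\varphi$ or $\forall W_1.(W_1\models\varphi\Rightarrow\exists W_2.W_2\leq_W W_1\wedge W_2\models\varphi\wedge\forall W_3.(W_3\leq_W W_2\Rightarrow W_3\models\varphi\to\psi))$; `Existential Might' $W\models\varphi\Diamond\!\!\to_\exists\psi$ iff $\exists W_1.W_1\models\varphi\wedge\forall W_2.(W_2\leq_W W_1\wedge W_2\models\varphi\Rightarrow\exists W_3.W_3\leq_W W_2\wedge W_3\models\varphi\wedge\psi)$; minimal version $W\models\varphi\rightsquigarrow_{\min}\psi$ iff $W\models\varphi\rightsquigarrow\psi$ and there is no property $\varphi'$ with $\varphi\to\varphi'$, $\varphi'\not\to\varphi$ and $W\models\varphi'\rightsquigarrow\psi$.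 Boolean connectives and QPTL subformulas are interpreted on the trace itself. The family $\leq^{\texttt{QPTL}}$: a ternary relation $R\subseteq((2^{AP})^\omega)^3$ (with $R(t_1,t_2,t_3)$ meaning $t_2\leq_{t_1}t_3$) is in the family iff there is a QPTL formula $\varphi_R$ over $AP_{\{\pi_1,\pi_2,\pi_3\}}=\{a_{\pi_j}\mid a\in AP, j\in\{1,2,3\}\}$ such that for all traces $R(t_1,t_2,t_3)$ iff $t_1\dot\cup t_2\dot\cup t_3\models\varphi_R$, where $(t_1\dot\cup t_2\dot\cup t_3)[n]=\{a_{\pi_j}\mid a\in t_j[n], j=1,2,3\}$. *)

theory Defs
  imports Main "HOL-Library.Nat_Bijection"
begin

type_synonym 'p trace = "nat \<Rightarrow> 'p set"

definition traces :: "'p set \<Rightarrow> 'p trace set" where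
  "traces A = {t. \<forall>i. t i \<subseteq> A}"

datatype (props: 'p) ltl =
    Prop 'p
  | Neg "'p ltl"
  | Conj "'p ltl" "'p ltl"
  | Next "'p ltl"
  | Until "'p ltl" "'p ltl"

fun ltl_sat :: "'p trace \<Rightarrow> nat \<Rightarrow> 'p ltl \<Rightarrow> bool" where
  "ltl_sat t i (Prop a) \<longleftrightarrow> a \<in> t i"
| "ltl_sat t i (Neg \<phi>) \<longleftrightarrow> \<not> ltl_sat t i \<phi>"
| "ltl_sat t i (Conj \<phi> \<psi>) \<longleftrightarrow> ltl_sat t i \<phi> \<and> ltl_sat t i \<psi>"
| "ltl_sat t i (Next \<phi>) \<longleftrightarrow> ltl_sat t (Suc i) \<phi>"
| "ltl_sat t i (Until \<phi> \<psi>) \<longleftrightarrow>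
     (\<exists>j\<ge>i. ltl_sat t j \<psi> \<and> (\<forall>k. i \<le> k \<and> k < j \<longrightarrow> ltl_sat t k \<phi>))"

datatype 'p qptl =
    Matrix "'p ltl"
  | Exists 'p "'p qptl"
  | Forall 'p "'p qptl"

text \<open>The quantified proposition is fresh: it differs from the propositions in \<open>A\<close>
  and from those bound by the enclosing quantifiers.\<close>

fun qptl_over :: "'p set \<Rightarrow> 'p qptl \<Rightarrow> bool" where
  "qptl_over A (Matrix \<phi>) \<longleftrightarrow> props \<phi> \<subseteq> A"
| "qptl_over A (Exists q \<psi>) \<longleftrightarrow> q \<notin> A \<and> qptl_over (insert q A) \<psi>"
| "qptl_over A (Forall q \<psi>) \<longleftrightarrow> q \<notin> A \<and> qptl_over (insert q A) \<psi>"

definition trace_update :: "'p trace \<Rightarrow> 'p \<Rightarrow> 'p trace \<Rightarrow> 'p trace" where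
  "trace_update t q tq = (\<lambda>n. (t n - {q}) \<union> (tq n \<inter> {q}))"

fun qptl_sat :: "'p trace \<Rightarrow> 'p qptl \<Rightarrow> bool" where
  "qptl_sat t (Matrix \<phi>) \<longleftrightarrow> ltl_sat t 0 \<phi>"
| "qptl_sat t (Exists q \<psi>) \<longleftrightarrow> (\<exists>tq\<in>traces {q}. qptl_sat (trace_update t q tq) \<psi>)"
| "qptl_sat t (Forall q \<psi>) \<longleftrightarrow> (\<forall>tq\<in>traces {q}. qptl_sat (trace_update t q tq) \<psi>)"

definition qptl_lang :: "'p set \<Rightarrow> 'p qptl \<Rightarrow> 'p trace set" where
  "qptl_lang A \<psi> = {t \<in> traces A. qptl_sat t \<psi>}"

datatype cf_op = Would | Might | UnivWould | ExMight

datatype 'p qptl_cf =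
    CF cf_op "'p qptl" "'p qptl"
  | CFmin cf_op "'p qptl" "'p qptl"
  | CConj "'p qptl_cf" "'p qptl_cf"
  | CNeg "'p qptl_cf"
  | Qptl "'p qptl"

fun qptl_cf_over :: "'p set \<Rightarrow> 'p qptl_cf \<Rightarrow> bool" where
  "qptl_cf_over A (CF c \<phi> \<psi>) \<longleftrightarrow> qptl_over A \<phi> \<and> qptl_over A \<psi>"
| "qptl_cf_over A (CFmin c \<phi> \<psi>) \<longleftrightarrow> qptl_over A \<phi> \<and> qptl_over A \<psi>"
| "qptl_cf_over A (CConj \<xi> \<zeta>) \<longleftrightarrow> qptl_cf_over A \<xi> \<and> qptl_cf_over A \<zeta>"
| "qptl_cf_over A (CNeg \<xi>) \<longleftrightarrow> qptl_cf_over A \<xi>"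
| "qptl_cf_over A (Qptl \<psi>) \<longleftrightarrow> qptl_over A \<psi>"

text \<open>The counterfactual operators, for a universe \<open>U\<close> and the similarity relation \<open>le\<close> of the
  reference world. Antecedent and consequent are given as properties, i.e. sets of worlds, because
  the minimal versions quantify over arbitrary properties.\<close>

fun cf_holds ::
  "'w set \<Rightarrow> ('w \<Rightarrow> 'w \<Rightarrow> bool) \<Rightarrow> cf_op \<Rightarrow> 'w set \<Rightarrow> 'w set \<Rightarrow> bool" where
  "cf_holds U le Would P Q \<longleftrightarrow>
     (\<forall>W1\<in>U. W1 \<notin> P) \<or>
     (\<exists>W1\<in>U. W1 \<in> P \<and> (\<forall>W2\<in>U. le W2 W1 \<longrightarrow> (W2 \<in> P \<longrightarrow> W2 \<in> Q)))"
| "cf_holds U le Might P Q \<longleftrightarrow>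
     (\<exists>W1\<in>U. W1 \<in> P) \<and>
     (\<forall>W1\<in>U. W1 \<in> P \<longrightarrow> (\<exists>W2\<in>U. le W2 W1 \<and> W2 \<in> P \<and> W2 \<in> Q))"
| "cf_holds U le UnivWould P Q \<longleftrightarrow>
     (\<forall>W1\<in>U. W1 \<notin> P) \<or>
     (\<forall>W1\<in>U. W1 \<in> P \<longrightarrow>
        (\<exists>W2\<in>U. le W2 W1 \<and> W2 \<in> P \<and> (\<forall>W3\<in>U. le W3 W2 \<longrightarrow> (W3 \<in> P \<longrightarrow> W3 \<in> Q))))"
| "cf_holds U le ExMight P Q \<longleftrightarrow>
     (\<exists>W1\<in>U. W1 \<in> P \<and>
        (\<forall>W2\<in>U. le W2 W1 \<and> W2 \<in> P \<longrightarrow> (\<exists>W3\<in>U. le W3 W2 \<and> W3 \<in> P \<and> W3 \<in> Q)))"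

definition cf_min_holds ::
  "'w set \<Rightarrow> ('w \<Rightarrow> 'w \<Rightarrow> bool) \<Rightarrow> cf_op \<Rightarrow> 'w set \<Rightarrow> 'w set \<Rightarrow> bool" where
  "cf_min_holds U le c P Q \<longleftrightarrow>
     cf_holds U le c P Q \<and>
     \<not> (\<exists>P'. (\<forall>V\<in>U. V \<in> P \<longrightarrow> V \<in> P') \<and> \<not> (\<forall>V\<in>U. V \<in> P' \<longrightarrow> V \<in> P) \<and> cf_holds U le c P' Q)"

text \<open>A similarity relation is a ternary relation \<open>R\<close>, where \<open>R t1 t2 t3\<close> stands for
  \<open>t2\<close> being at least as close to \<open>t1\<close> as \<open>t3\<close> is.\<close>

fun qptl_cf_sat ::
  "'p trace set \<Rightarrow> ('p trace \<Rightarrow> 'p trace \<Rightarrow> 'p trace \<Rightarrow> bool) \<Rightarrow> 'p trace \<Rightarrow> 'p qptl_cf \<Rightarrow> bool" where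
  "qptl_cf_sat U R W (CF c \<phi> \<psi>) \<longleftrightarrow>
     cf_holds U (R W) c {V. qptl_sat V \<phi>} {V. qptl_sat V \<psi>}"
| "qptl_cf_sat U R W (CFmin c \<phi> \<psi>) \<longleftrightarrow>
     cf_min_holds U (R W) c {V. qptl_sat V \<phi>} {V. qptl_sat V \<psi>}"
| "qptl_cf_sat U R W (CConj \<xi> \<zeta>) \<longleftrightarrow> qptl_cf_sat U R W \<xi> \<and> qptl_cf_sat U R W \<zeta>"
| "qptl_cf_sat U R W (CNeg \<xi>) \<longleftrightarrow> \<not> qptl_cf_sat U R W \<xi>"
| "qptl_cf_sat U R W (Qptl \<psi>) \<longleftrightarrow> qptl_sat W \<psi>"

definition qptl_cf_satisfiable ::
  "'p set \<Rightarrow> 'p trace set \<Rightarrow> ('p trace \<Rightarrow> 'p trace \<Rightarrow> 'p trace \<Rightarrow> bool) \<Rightarrow> 'p qptl_cf \<Rightarrow> bool" where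
  "qptl_cf_satisfiable A U R \<xi> \<longleftrightarrow> (\<exists>W\<in>traces A. qptl_cf_sat U R W \<xi>)"

text \<open>A minimum of \<open>U\<close> is an element of \<open>U\<close>, so \<open>W\<close> is required to be the minimum only
  if it is a world of the universe.\<close>

definition similarity ::
  "'p set \<Rightarrow> 'p trace set \<Rightarrow> ('p trace \<Rightarrow> 'p trace \<Rightarrow> 'p trace \<Rightarrow> bool) \<Rightarrow> bool" where
  "similarity A U R \<longleftrightarrow>
     (\<forall>W\<in>traces A. reflp_on U (R W) \<and> transp_on U (R W) \<and> (W \<in> U \<longrightarrow> (\<forall>V\<in>U. R W W V)))"

text \<open>The indexed proposition \<open>a\<^bsub>\<pi>\<^sub>j\<^esub>\<close> is the pair \<open>(a, j)\<close>.\<close>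

definition trace_merge :: "'p trace \<Rightarrow> 'p trace \<Rightarrow> 'p trace \<Rightarrow> ('p \<times> nat) trace" where
  "trace_merge t1 t2 t3 = (\<lambda>n. t1 n \<times> {1} \<union> t2 n \<times> {2} \<union> t3 n \<times> {3})"

text \<open>The relation \<open>R\<close> belongs to the family of QPTL-definable similarity relations iff
  some formula defines it in this sense.\<close>

definition defines_similarity ::
  "'p set \<Rightarrow> ('p \<times> nat) qptl \<Rightarrow> ('p trace \<Rightarrow> 'p trace \<Rightarrow> 'p trace \<Rightarrow> bool) \<Rightarrow> bool" where
  "defines_similarity A \<phi>R R \<longleftrightarrow>
     qptl_over (A \<times> {1, 2, 3}) \<phi>R \<and>
     (\<forall>t1\<in>traces A. \<forall>t2\<in>traces A. \<forall>t3\<in>traces A.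
        R t1 t2 t3 \<longleftrightarrow> qptl_sat (trace_merge t1 t2 t3) \<phi>R)"

text \<open>\<open>recursive k f\<close>: \<open>f\<close>, restricted to lists of length \<open>k\<close>, is a total recursive function of
  \<open>k\<close> arguments. Minimization is applied to regular functions only, which yields exactly the
  total \<open>\<mu>\<close>-recursive functions. By \<open>ext\<close>, values on lists of other lengths are irrelevant.\<close>

inductive recursive :: "nat \<Rightarrow> (nat list \<Rightarrow> nat) \<Rightarrow> bool" where
  zero: "recursive k (\<lambda>xs. 0)"
| succ: "recursive 1 (\<lambda>xs. Suc (xs ! 0))"
| proj: "i < k \<Longrightarrow> recursive k (\<lambda>xs. xs ! i)"
| comp: "recursive (length gs) f \<Longrightarrow> (\<And>g. g \<in> set gs \<Longrightarrow> recursive k g) \<Longrightarrow>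
    recursive k (\<lambda>xs. f (map (\<lambda>g. g xs) gs))"
| prec: "recursive k f \<Longrightarrow> recursive (Suc (Suc k)) g \<Longrightarrow>
    recursive (Suc k) (\<lambda>xs. rec_nat (f (tl xs)) (\<lambda>n r. g (n # r # tl xs)) (hd xs))"
| mu: "recursive (Suc k) f \<Longrightarrow> (\<And>xs. length xs = k \<Longrightarrow> \<exists>n. f (n # xs) = 0) \<Longrightarrow>
    recursive k (\<lambda>xs. LEAST n. f (n # xs) = 0)"
| ext: "recursive k f \<Longrightarrow> (\<And>xs. length xs = k \<Longrightarrow> f xs = g xs) \<Longrightarrow> recursive k g"

text \<open>Goedel numberings, relative to a numbering \<open>e\<close> of the propositions.\<close>

fun ltl_code :: "('p \<Rightarrow> nat) \<Rightarrow> 'p ltl \<Rightarrow> nat" where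
  "ltl_code e (Prop a) = prod_encode (0, e a)"
| "ltl_code e (Neg \<phi>) = prod_encode (1, ltl_code e \<phi>)"
| "ltl_code e (Conj \<phi> \<psi>) = prod_encode (2, prod_encode (ltl_code e \<phi>, ltl_code e \<psi>))"
| "ltl_code e (Next \<phi>) = prod_encode (3, ltl_code e \<phi>)"
| "ltl_code e (Until \<phi> \<psi>) = prod_encode (4, prod_encode (ltl_code e \<phi>, ltl_code e \<psi>))"

fun qptl_code :: "('p \<Rightarrow> nat) \<Rightarrow> 'p qptl \<Rightarrow> nat" where
  "qptl_code e (Matrix \<phi>) = prod_encode (0, ltl_code e \<phi>)"
| "qptl_code e (Exists q \<psi>) = prod_encode (1, prod_encode (e q, qptl_code e \<psi>))"
| "qptl_code e (Forall q \<psi>) = prod_encode (2, prod_encode (e q, qptl_code e \<psi>))"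

fun cf_op_code :: "cf_op \<Rightarrow> nat" where
  "cf_op_code Would = 0"
| "cf_op_code Might = 1"
| "cf_op_code UnivWould = 2"
| "cf_op_code ExMight = 3"

fun qptl_cf_code :: "('p \<Rightarrow> nat) \<Rightarrow> 'p qptl_cf \<Rightarrow> nat" where
  "qptl_cf_code e (CF c \<phi> \<psi>) =
     prod_encode (0, prod_encode (cf_op_code c, prod_encode (qptl_code e \<phi>, qptl_code e \<psi>)))"
| "qptl_cf_code e (CFmin c \<phi> \<psi>) =
     prod_encode (1, prod_encode (cf_op_code c, prod_encode (qptl_code e \<phi>, qptl_code e \<psi>)))"
| "qptl_cf_code e (CConj \<xi> \<zeta>) =
     prod_encode (2, prod_encode (qptl_cf_code e \<xi>, qptl_cf_code e \<zeta>))"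
| "qptl_cf_code e (CNeg \<xi>) = prod_encode (3, qptl_cf_code e \<xi>)"
| "qptl_cf_code e (Qptl \<psi>) = prod_encode (4, qptl_code e \<psi>)"

end

theory Submission
  imports Defs "HOL-Library.Ramsey" "HOL-Library.FuncSet"
begin

text \<open>Every language of \<open>\<omega>\<close>-words in sight is saturated by a morphism from finite words to a finite
  semigroup whose size is bounded by a tower of exponentials in the formula: for LTL take backward
  transformers of sets of subformulas, for projection the power semigroup. By Ramsey's theorem and pumping,
  if the parameters of an existential statement are ultimately periodic with preperiod and period \<open>L\<close>, a witness can be
  chosen with preperiod and period \<open>L \<cdot> B!\<close>, where \<open>B\<close> bounds the size of the semigroup. So all quantifiers,
  over propositions and over worlds, may be restricted to finitely many lassos of computable size, and truth is
  computed by brute force. The minimal counterfactuals quantify over arbitrary properties, but since the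
  similarity relation is a preorder it is enough to extend the antecedent by one world.\<close>

section \<open>Recursive functions and computability on encoded types\<close>

text \<open>Semigroups take the place of automata because saturation is symmetric in the two words:
  negation costs nothing, and only projection needs an exponentially larger semigroup. The factorial
  appears because a pumped period is \<open>L * b\<close> for some \<open>b\<close> between 1 and
  \<open>B\<close> that depends on the word; \<open>B!\<close> is a common multiple of all
  candidates, so the length of the witness is known before the word is. One bound \<open>B\<close>,
  taken from the whole sentence, serves all its subformulas, and after every quantifier the words
  already chosen are reread with the larger parameter \<open>L * B!\<close>. This makes nested
  quantifiers over worlds a finite search, although the similarity formula again contains
  quantifiers over propositions. The procedure never tests whether the relation is a preorder: it is
  total on all numbers, and its answer is claimed only under the hypotheses. To see that the search
  is recursive, HOL functions on encodable types are realized by unary recursive functions on codes,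
  so that computability proofs follow the syntax of the definitions.\<close>

lemma recursive_Suc: "recursive k f \<Longrightarrow> recursive k (\<lambda>xs. Suc (f xs))"
  using comp[of "[f]" "\<lambda>xs. Suc (xs ! 0)" k] succ by simp

lemma recursive_comp1:
  "recursive 1 (\<lambda>xs. f (xs ! 0)) \<Longrightarrow> recursive k g \<Longrightarrow> recursive k (\<lambda>xs. f (g xs))"
  using comp[of "[g]" "\<lambda>xs. f (xs ! 0)" k] by simp

text \<open>The scheme \<open>prec\<close> recurses on its first argument and hands the others on.
  Feeding it \<open>n\<close> followed by all projections gives a recursion whose bound, start value
  and step may each depend on the complete argument list.\<close>

lemma recursive_rec_nat:
  assumes n: "recursive k n" and a: "recursive k a" and g: "recursive (Suc (Suc k)) g"
  shows "recursive k (\<lambda>xs. rec_nat (a xs) (\<lambda>m r. g (m # r # xs)) (n xs))"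
proof -
  let ?h = "\<lambda>xs. rec_nat (a (tl xs)) (\<lambda>m r. g (m # r # tl xs)) (hd xs)"
  let ?gs = "n # map (\<lambda>i xs. xs ! i) [0..<k]"
  have "recursive (length ?gs) ?h"
    using prec[OF a g] by simp
  then have "recursive k (\<lambda>xs. ?h (map (\<lambda>g. g xs) ?gs))"
    by (rule comp) (auto intro: n proj)
  then show ?thesis
  proof (rule ext)
    fix xs :: "nat list"
    assume "length xs = k"
    then have "map (\<lambda>g. g xs) ?gs = n xs # xs"
      by (auto simp: comp_def map_nth)
    then show "?h (map (\<lambda>g. g xs) ?gs) = rec_nat (a xs) (\<lambda>m r. g (m # r # xs)) (n xs)"
      by simp
  qed
qed

lemma recursive_mu:
  assumes f: "recursive (Suc k) f" and ex: "\<And>xs. \<exists>n. f (n # xs) = 0"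
  shows "recursive k (\<lambda>xs. LEAST n. f (n # xs) = 0)"
  using mu[OF f] ex by blast

text \<open>Weakening by a fresh first argument; it lets a parameter survive under minimization and
  inside the step of a recursion.\<close>

lemma recursive_tail:
  assumes "recursive k f"
  shows "recursive (Suc k) (\<lambda>xs. f (tl xs))"
proof -
  let ?gs = "map (\<lambda>i xs. xs ! Suc i) [0..<k]"
  have "recursive (Suc k) (\<lambda>xs. f (map (\<lambda>g. g xs) ?gs))"
    by (rule comp) (use assms in \<open>auto intro: proj\<close>)
  then show ?thesis
  proof (rule ext)
    fix xs :: "nat list"
    assume "length xs = Suc k"
    then have "map (\<lambda>g. g xs) ?gs = tl xs"
      by (auto simp: comp_def nth_tl intro!: nth_equalityI)
    then show "f (map (\<lambda>g. g xs) ?gs) = f (tl xs)"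
      by simp
  qed
qed

lemma recursive_add:
  assumes "recursive k f" "recursive k g"
  shows "recursive k (\<lambda>xs. f xs + g xs)"
proof -
  \<comment> \<open>In the list \<open>m # r # xs\<close> given to the step function, index 0 is the
    counter and index 1 the previous value.\<close>
  have eq: "rec_nat a (\<lambda>m r. Suc ((m # r # xs) ! 1)) b = a + b" for a b and xs :: "nat list"
    by (induction b) auto
  have "recursive k (\<lambda>xs. rec_nat (f xs) (\<lambda>m r. Suc ((m # r # xs) ! 1)) (g xs))"
    by (rule recursive_rec_nat[OF assms(2,1)]) (intro recursive_Suc proj, simp)
  then show ?thesis
    unfolding eq .
qed

lemma recursive_pred:
  assumes "recursive k f"
  shows "recursive k (\<lambda>xs. f xs - 1)"
proof -
  have eq: "rec_nat 0 (\<lambda>m r. (m # r # xs) ! 0) b = b - 1" for b and xs :: "nat list"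
    by (cases b) auto
  have "recursive k (\<lambda>xs. rec_nat 0 (\<lambda>m r. (m # r # xs) ! 0) (f xs))"
    by (rule recursive_rec_nat[OF assms zero]) (intro proj, simp)
  then show ?thesis
    unfolding eq .
qed

lemma recursive_diff:
  assumes "recursive k f" "recursive k g"
  shows "recursive k (\<lambda>xs. f xs - g xs)"
proof -
  have eq: "rec_nat a (\<lambda>m r. (m # r # xs) ! 1 - 1) b = a - b" for a b and xs :: "nat list"
    by (induction b) auto
  have "recursive k (\<lambda>xs. rec_nat (f xs) (\<lambda>m r. (m # r # xs) ! 1 - 1) (g xs))"
    by (rule recursive_rec_nat[OF assms(2,1)]) (intro recursive_pred proj, simp)
  then show ?thesis
    unfolding eq .
qed

lemma recursive_triangle:
  assumes "recursive k f"
  shows "recursive k (\<lambda>xs. triangle (f xs))"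
proof -
  have eq: "rec_nat 0 (\<lambda>m r. (m # r # xs) ! 1 + Suc ((m # r # xs) ! 0)) b = triangle b"
    for b and xs :: "nat list"
    by (induction b) auto
  have "recursive k (\<lambda>xs. rec_nat 0 (\<lambda>m r. (m # r # xs) ! 1 + Suc ((m # r # xs) ! 0)) (f xs))"
    by (rule recursive_rec_nat[OF assms zero]) (intro recursive_add recursive_Suc proj; simp)
  then show ?thesis
    unfolding eq .
qed

lemma recursive_prod_encode:
  assumes "recursive k f" "recursive k g"
  shows "recursive k (\<lambda>xs. prod_encode (f xs, g xs))"
  unfolding prod_encode_def split by (intro recursive_add recursive_triangle assms)

text \<open>For \<open>n = prod_encode (a, b)\<close> this is the Cantor diagonal
  \<open>a + b\<close>, because such codes are \<open>triangle (a + b) + a\<close>. Both projections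
  are then obtained by subtraction.\<close>

definition tri_root :: "nat \<Rightarrow> nat" where
  "tri_root n = (LEAST s. n < triangle (Suc s))"

lemma le_triangle: "n \<le> triangle n"
  by (induction n) auto

lemma mono_triangle: "m \<le> n \<Longrightarrow> triangle m \<le> triangle n"
  by (induction n rule: dec_induct) auto

lemma tri_root_prod_encode: "tri_root (prod_encode (a, b)) = a + b"
  unfolding tri_root_def
proof (rule Least_equality)
  show "prod_encode (a, b) < triangle (Suc (a + b))"
    by (simp add: prod_encode_def)
  fix s assume "prod_encode (a, b) < triangle (Suc s)"
  then have "\<not> Suc s \<le> a + b"
    using mono_triangle[of "Suc s" "a + b"] by (auto simp: prod_encode_def)
  then show "a + b \<le> s" by simp
qed

lemma recursive_tri_root:
  assumes "recursive k f"
  shows "recursive k (\<lambda>xs. tri_root (f xs))"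
proof -
  \<comment> \<open>Truncated subtraction turns the comparison into a zero test: the value is 0
    exactly if \<open>f (tl xs) < triangle (Suc (xs ! 0))\<close>.\<close>
  let ?t = "\<lambda>xs. Suc (f (tl xs)) - triangle (Suc (xs ! 0))"
  have "recursive k (\<lambda>xs. LEAST n. ?t (n # xs) = 0)"
  proof (rule recursive_mu)
    show "recursive (Suc k) ?t"
      by (intro recursive_diff recursive_Suc recursive_triangle proj recursive_tail assms) auto
    show "\<exists>n. ?t (n # xs) = 0" for xs
      using le_triangle[of "Suc (f xs)"] by (intro exI[of _ "f xs"]) simp
  qed
  then show ?thesis
    by (simp add: tri_root_def Suc_le_eq del: triangle_Suc)
qed

lemma recursive_fst_decode:
  assumes "recursive k f"
  shows "recursive k (\<lambda>xs. fst (prod_decode (f xs)))"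
proof -
  have eq: "fst (prod_decode n) = n - triangle (tri_root n)" for n
  proof -
    obtain a b where n: "n = prod_encode (a, b)" using prod_decode_inverse[of n] by (metis surj_pair)
    have "prod_encode (a, b) - triangle (a + b) = a" by (simp add: prod_encode_def)
    then show ?thesis unfolding n tri_root_prod_encode by simp
  qed
  show ?thesis unfolding eq
    by (intro recursive_diff recursive_triangle recursive_tri_root assms)
qed

lemma recursive_snd_decode:
  assumes "recursive k f"
  shows "recursive k (\<lambda>xs. snd (prod_decode (f xs)))"
proof -
  have eq: "snd (prod_decode n) = tri_root n - fst (prod_decode n)" for n
  proof -
    obtain a b where n: "n = prod_encode (a, b)" using prod_decode_inverse[of n] by (metis surj_pair)
    show ?thesis unfolding n tri_root_prod_encode by simp
  qed
  show ?thesis unfolding eq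
    by (intro recursive_diff recursive_fst_decode recursive_tri_root assms)
qed

text \<open>A primitive recursion whose step discards the counter and the previous value:
  \<open>b\<close> is reached exactly if the bound is positive.\<close>

lemma recursive_if0:
  assumes "recursive k c" "recursive k a" "recursive k b"
  shows "recursive k (\<lambda>xs. if c xs = 0 then a xs else b xs)"
proof -
  have eq: "rec_nat x (\<lambda>m r. b (tl (tl (m # r # xs)))) n = (if n = 0 then x else b xs)"
    for n x and xs :: "nat list"
    by (cases n) auto
  have "recursive k (\<lambda>xs. rec_nat (a xs) (\<lambda>m r. b (tl (tl (m # r # xs)))) (c xs))"
    by (rule recursive_rec_nat[OF assms(1,2)]) (intro recursive_tail[of _ "\<lambda>xs. b (tl xs)"] recursive_tail assms(3))
  then show ?thesis
    unfolding eq .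
qed

lemma recursive_const: "recursive k (\<lambda>xs. c)"
  by (induction c) (auto intro: recursive.zero recursive_Suc)

section \<open>Encodable types and computable functions between them\<close>

class enc =
  fixes enc :: "'a \<Rightarrow> nat"
  assumes inj_enc: "inj enc"

lemma enc_eq_iff [simp]: "enc x = enc y \<longleftrightarrow> x = y"
  using inj_enc by (auto dest: injD)

instantiation nat :: enc begin
definition enc_nat :: "nat \<Rightarrow> nat" where [simp]: "enc_nat n = n"
instance by standard (auto intro: injI)
end

instantiation bool :: enc begin
definition enc_bool :: "bool \<Rightarrow> nat" where [simp]: "enc_bool b = (if b then 1 else 0)"
instance by standard (auto intro!: injI split: if_splits)
end

instantiation prod :: (enc, enc) enc begin
definition enc_prod :: "'a \<times> 'b \<Rightarrow> nat" where
  [simp]: "enc_prod p = prod_encode (enc (fst p), enc (snd p))"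
instance by standard (auto intro!: injI simp: prod_eq_iff)
end

text \<open>Only the empty list has code 0, so matching on a list is a zero test; each
  \<open>Cons\<close> adds at least one, so a code bounds the length.\<close>

instantiation list :: (enc) enc begin
fun enc_list :: "'a list \<Rightarrow> nat" where
  "enc_list [] = 0"
| "enc_list (x # xs) = Suc (prod_encode (enc x, enc_list xs))"
instance
proof
  show "inj (enc :: 'a list \<Rightarrow> nat)"
  proof (rule injI)
    fix xs ys :: "'a list"
    show "enc xs = enc ys \<Longrightarrow> xs = ys"
      by (induction xs arbitrary: ys; case_tac ys) auto
  qed
qed
end

definition rec1 :: "(nat \<Rightarrow> nat) \<Rightarrow> bool" where
  "rec1 g \<longleftrightarrow> recursive 1 (\<lambda>xs. g (xs ! 0))"

text \<open>The realizer \<open>g\<close> is unconstrained outside the range of \<open>enc\<close>,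
  so encodings need only be injective and the range need not be decided.\<close>

definition computable :: "('a::enc \<Rightarrow> 'b::enc) \<Rightarrow> bool" where
  "computable f \<longleftrightarrow> (\<exists>g. rec1 g \<and> (\<forall>x. g (enc x) = enc (f x)))"

lemma computableI: "rec1 g \<Longrightarrow> (\<And>x. g (enc x) = enc (f x)) \<Longrightarrow> computable f"
  unfolding computable_def by blast

lemma computableE:
  assumes "computable f"
  obtains g where "rec1 g" "\<And>x. g (enc x) = enc (f x)"
  using assms unfolding computable_def by blast

lemma rec1_id: "rec1 (\<lambda>n. n)"
  unfolding rec1_def by (rule proj) simp

lemma rec1_const: "rec1 (\<lambda>n. c)"
  unfolding rec1_def by (rule recursive_const)

lemma rec1_comp: "rec1 f \<Longrightarrow> rec1 g \<Longrightarrow> rec1 (\<lambda>n. f (g n))"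
  unfolding rec1_def by (rule recursive_comp1)

lemma rec1_pair: "rec1 f \<Longrightarrow> rec1 g \<Longrightarrow> rec1 (\<lambda>n. prod_encode (f n, g n))"
  unfolding rec1_def by (rule recursive_prod_encode)

lemma rec1_fst: "rec1 f \<Longrightarrow> rec1 (\<lambda>n. fst (prod_decode (f n)))"
  unfolding rec1_def by (rule recursive_fst_decode)

lemma rec1_snd: "rec1 f \<Longrightarrow> rec1 (\<lambda>n. snd (prod_decode (f n)))"
  unfolding rec1_def by (rule recursive_snd_decode)

lemma rec1_Suc: "rec1 f \<Longrightarrow> rec1 (\<lambda>n. Suc (f n))"
  unfolding rec1_def by (rule recursive_Suc)

lemma rec1_add: "rec1 f \<Longrightarrow> rec1 g \<Longrightarrow> rec1 (\<lambda>n. f n + g n)"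
  unfolding rec1_def by (rule recursive_add)

lemma rec1_diff: "rec1 f \<Longrightarrow> rec1 g \<Longrightarrow> rec1 (\<lambda>n. f n - g n)"
  unfolding rec1_def by (rule recursive_diff)

lemma rec1_if0: "rec1 c \<Longrightarrow> rec1 a \<Longrightarrow> rec1 b \<Longrightarrow> rec1 (\<lambda>n. if c n = 0 then a n else b n)"
  unfolding rec1_def by (rule recursive_if0)

lemma rec1_iterate:
  assumes "rec1 c" "rec1 a" "rec1 s"
  shows "rec1 (\<lambda>n. ((\<lambda>r. s (prod_encode (n, r))) ^^ c n) (a n))"
proof -
  \<comment> \<open>Index 2 is the parameter, handed unchanged to each round; index 1 is the
    iterated value.\<close>
  have eq: "rec_nat x (\<lambda>m r. s (prod_encode ((m # r # xs) ! 2, (m # r # xs) ! 1))) k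
    = ((\<lambda>r. s (prod_encode (xs ! 0, r))) ^^ k) x" for x k and xs :: "nat list"
    by (induction k) (auto simp: numeral_2_eq_2)
  have g: "recursive (Suc (Suc 1)) (\<lambda>ys. s (prod_encode (ys ! 2, ys ! 1)))"
    by (rule recursive_comp1[OF assms(3)[unfolded rec1_def]], intro recursive_prod_encode proj) auto
  have "recursive 1 (\<lambda>xs. rec_nat (a (xs ! 0))
      (\<lambda>m r. s (prod_encode ((m # r # xs) ! 2, (m # r # xs) ! 1))) (c (xs ! 0)))"
    by (rule recursive_rec_nat[OF assms(1,2)[unfolded rec1_def] g])
  then show ?thesis
    unfolding eq rec1_def .
qed

section \<open>Closure properties of computable functions\<close>

named_theorems comp_intro

lemma computable_const [comp_intro]: "computable (\<lambda>x. c)"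
  by (rule computableI[OF rec1_const]) simp

lemma computable_id [comp_intro]: "computable (\<lambda>x. x)"
  by (rule computableI[OF rec1_id]) simp

lemma computable_comp:
  assumes "computable f" "computable g"
  shows "computable (\<lambda>x. f (g x))"
proof -
  obtain f' g' where "rec1 f'" "\<And>x. f' (enc x) = enc (f x)" "rec1 g'" "\<And>x. g' (enc x) = enc (g x)"
    using assms by (meson computableE)
  then show ?thesis
    by (intro computableI[of "\<lambda>n. f' (g' n)"] rec1_comp[of f' g']) auto
qed

lemma computable_Pair [comp_intro]:
  assumes "computable f" "computable g"
  shows "computable (\<lambda>x. (f x, g x))"
proof -
  obtain f' g' where "rec1 f'" "\<And>x. f' (enc x) = enc (f x)" "rec1 g'" "\<And>x. g' (enc x) = enc (g x)"
    using assms by (meson computableE)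
  then show ?thesis
    by (intro computableI[of "\<lambda>n. prod_encode (f' n, g' n)"] rec1_pair) auto
qed

text \<open>Since \<open>computable\<close> speaks of unary functions, a function of several
  arguments is assumed computable in uncurried form; this rule plugs the arguments in.\<close>

lemma computable_comp2:
  "computable (\<lambda>p. h (fst p) (snd p)) \<Longrightarrow> computable f \<Longrightarrow> computable g \<Longrightarrow> computable (\<lambda>x. h (f x) (g x))"
  using computable_comp[of "\<lambda>p. h (fst p) (snd p)" "\<lambda>x. (f x, g x)"] computable_Pair[of f g] by simp

lemma computable_fst [comp_intro]:
  assumes "computable f"
  shows "computable (\<lambda>x. fst (f x))"
proof -
  obtain f' where "rec1 f'" "\<And>x. f' (enc x) = enc (f x)"
    using assms by (meson computableE)
  then show ?thesis
    by (intro computableI[of "\<lambda>n. fst (prod_decode (f' n))"] rec1_fst) auto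
qed

lemma computable_snd [comp_intro]:
  assumes "computable f"
  shows "computable (\<lambda>x. snd (f x))"
proof -
  obtain f' where "rec1 f'" "\<And>x. f' (enc x) = enc (f x)"
    using assms by (meson computableE)
  then show ?thesis
    by (intro computableI[of "\<lambda>n. snd (prod_decode (f' n))"] rec1_snd) auto
qed

lemma computable_enc [comp_intro]:
  assumes "computable f"
  shows "computable (\<lambda>x. enc (f x))"
proof -
  obtain f' where "rec1 f'" "\<And>x. f' (enc x) = enc (f x)"
    using assms by (meson computableE)
  then show ?thesis
    by (intro computableI[of f']) auto
qed

lemma computable_Suc [comp_intro]:
  assumes "computable f"
  shows "computable (\<lambda>x. Suc (f x))"
proof -
  obtain f' where "rec1 f'" "\<And>x. f' (enc x) = enc (f x)"
    using assms by (meson computableE)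
  then show ?thesis
    by (intro computableI[of "\<lambda>n. Suc (f' n)"] rec1_Suc) auto
qed

lemma computable_add [comp_intro]:
  fixes f g :: "'a::enc \<Rightarrow> nat"
  assumes "computable f" "computable g"
  shows "computable (\<lambda>x. f x + g x)"
proof -
  obtain f' g' where "rec1 f'" "\<And>x. f' (enc x) = enc (f x)" "rec1 g'" "\<And>x. g' (enc x) = enc (g x)"
    using assms by (meson computableE)
  then show ?thesis
    by (intro computableI[of "\<lambda>n. f' n + g' n"] rec1_add) auto
qed

lemma computable_diff [comp_intro]:
  fixes f g :: "'a::enc \<Rightarrow> nat"
  assumes "computable f" "computable g"
  shows "computable (\<lambda>x. f x - g x)"
proof -
  obtain f' g' where "rec1 f'" "\<And>x. f' (enc x) = enc (f x)" "rec1 g'" "\<And>x. g' (enc x) = enc (g x)"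
    using assms by (meson computableE)
  then show ?thesis
    by (intro computableI[of "\<lambda>n. f' n - g' n"] rec1_diff) auto
qed

lemma computable_if [comp_intro]:
  assumes "computable c" "computable a" "computable b"
  shows "computable (\<lambda>x. if c x then a x else b x)"
proof -
  obtain c' a' b' where "rec1 c'" "\<And>x. c' (enc x) = enc (c x)"
    "rec1 a'" "\<And>x. a' (enc x) = enc (a x)" "rec1 b'" "\<And>x. b' (enc x) = enc (b x)"
    using assms by (meson computableE)
  then show ?thesis
    by (intro computableI[of "\<lambda>n. if c' n = 0 then b' n else a' n"] rec1_if0) auto
qed

lemma computable_iterate [comp_intro]:
  fixes s :: "'a::enc \<Rightarrow> 'b::enc \<Rightarrow> 'b"
  assumes "computable c" "computable a" "computable (\<lambda>p. s (fst p) (snd p))"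
  shows "computable (\<lambda>x. (s x ^^ c x) (a x))"
proof -
  obtain c' a' s' where c: "rec1 c'" "\<And>x. c' (enc x) = enc (c x)" and
    a: "rec1 a'" "\<And>x. a' (enc x) = enc (a x)" and
    s: "rec1 s'" "\<And>p. s' (enc p) = enc (s (fst p) (snd p))"
    using assms by (meson computableE)
  have "((\<lambda>r. s' (prod_encode (enc x, r))) ^^ k) (enc y) = enc ((s x ^^ k) y)" for x y k
  proof (induction k)
    case (Suc k)
    then show ?case using s(2)[of "(x, (s x ^^ k) y)"] by simp
  qed simp
  then show ?thesis
    using c a s by (intro computableI[OF rec1_iterate[of c' a' s']]) auto
qed

lemma computable_not [comp_intro]:
  assumes "computable f"
  shows "computable (\<lambda>x. \<not> f x)"
proof -
  have "computable (\<lambda>x. if f x then False else True)"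
    by (intro comp_intro assms)
  then show ?thesis by (rule back_subst[of computable]) auto
qed

lemma computable_conj [comp_intro]:
  assumes "computable f" "computable g"
  shows "computable (\<lambda>x. f x \<and> g x)"
proof -
  have "computable (\<lambda>x. if f x then g x else False)"
    by (intro comp_intro assms)
  then show ?thesis by (rule back_subst[of computable]) auto
qed

lemma computable_less [comp_intro]:
  fixes f g :: "'a::enc \<Rightarrow> nat"
  assumes "computable f" "computable g"
  shows "computable (\<lambda>x. f x < g x)"
proof -
  obtain f' g' where "rec1 f'" "\<And>x. f' (enc x) = enc (f x)" "rec1 g'" "\<And>x. g' (enc x) = enc (g x)"
    using assms by (meson computableE)
  then show ?thesis
    by (intro computableI[of "\<lambda>n. if g' n - f' n = 0 then 0 else 1"] rec1_if0 rec1_const rec1_diff) auto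
qed

text \<open>By injectivity of \<open>enc\<close>, equality at any encodable type is equality of
  codes, that is, the failure of both strict inequalities.\<close>

lemma computable_eq [comp_intro]:
  assumes "computable f" "computable g"
  shows "computable (\<lambda>x. f x = g x)"
proof -
  have "computable (\<lambda>x. \<not> enc (f x) < enc (g x) \<and> \<not> enc (g x) < enc (f x))"
    by (intro comp_intro assms)
  moreover have "(\<not> enc (f x) < enc (g x) \<and> \<not> enc (g x) < enc (f x)) = (f x = g x)" for x
    using enc_eq_iff[of "f x" "g x"] by linarith
  ultimately show ?thesis by simp
qed

section \<open>Computable list operations, bounded search and arithmetic\<close>

lemma computable_case_list:
  assumes "computable l" "computable a" "computable (\<lambda>p. b (fst p) (fst (snd p)) (snd (snd p)))"
  shows "computable (\<lambda>x. case l x of [] \<Rightarrow> a x | y # ys \<Rightarrow> b x y ys)"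
proof -
  obtain l' a' b' where l: "rec1 l'" "\<And>x. l' (enc x) = enc (l x)" and
    a: "rec1 a'" "\<And>x. a' (enc x) = enc (a x)" and
    b: "rec1 b'" "\<And>p. b' (enc p) = enc (b (fst p) (fst (snd p)) (snd (snd p)))"
    using assms by (meson computableE)
  \<comment> \<open>A nonempty list has code \<open>Suc (prod_encode (head, tail))\<close>, so
    \<open>l' n - 1\<close> is already the code of the pair of head and tail.\<close>
  have "rec1 (\<lambda>n. if l' n = 0 then a' n else b' (prod_encode (n, l' n - 1)))"
    by (intro rec1_if0 l a rec1_comp[OF b(1)] rec1_pair rec1_id rec1_diff rec1_const)
  then show ?thesis
  proof (rule computableI)
    fix x
    show "(if l' (enc x) = 0 then a' (enc x) else b' (prod_encode (enc x, l' (enc x) - 1)))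
      = enc (case l x of [] \<Rightarrow> a x | y # ys \<Rightarrow> b x y ys)"
      using b(2)[of "(x, hd (l x), tl (l x))"] by (cases "l x") (auto simp: l a)
  qed
qed

lemma computable_Cons [comp_intro]:
  assumes "computable f" "computable g"
  shows "computable (\<lambda>x. f x # g x)"
proof -
  obtain f' g' where "rec1 f'" "\<And>x. f' (enc x) = enc (f x)" "rec1 g'" "\<And>x. g' (enc x) = enc (g x)"
    using assms by (meson computableE)
  then show ?thesis
    by (intro computableI[of "\<lambda>n. Suc (prod_encode (f' n, g' n))"] rec1_pair rec1_Suc) auto
qed

lemma length_le_enc: "length xs \<le> enc xs"
proof (induction xs)
  case (Cons x xs)
  then show ?case using le_prod_encode_2[of "enc xs" "enc x"] by simp
qed simp

text \<open>One round consumes one element, and a state with empty list is a fixed point. Hence any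
  number of rounds not below the length will do, and the code of the list is such a number; the
  length itself becomes computable only through this lemma.\<close>

lemma computable_foldl [comp_intro]:
  assumes "computable a" "computable l" "computable (\<lambda>p. h (fst p) (fst (snd p)) (snd (snd p)))"
  shows "computable (\<lambda>x. foldl (h x) (a x) (l x))"
proof -
  define s where "s x r = (case snd r of [] \<Rightarrow> r | y # ys \<Rightarrow> (h x (fst r) y, ys))" for x r
  have s: "computable (\<lambda>p. s (fst p) (snd p))"
    unfolding s_def
    by (intro computable_case_list comp_intro
        computable_comp[OF assms(3), of "\<lambda>q. (fst (fst q), fst (snd (fst q)), fst (snd q))", simplified])
  have iter: "length ys \<le> k \<Longrightarrow> (s x ^^ k) (c, ys) = (foldl (h x) c ys, [])" for x c ys k
  proof (induction k arbitrary: c ys)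
    case (Suc k)
    show ?case
    proof (cases ys)
      case Nil
      then show ?thesis using Suc.IH[of "[]" c] by (simp add: s_def)
    next
      case (Cons z zs)
      then show ?thesis using Suc by (simp add: funpow_Suc_right s_def del: funpow.simps)
    qed
  qed simp
  have "computable (\<lambda>x. fst ((s x ^^ enc (l x)) (a x, l x)))"
    by (intro comp_intro s assms)
  then show ?thesis
    by (simp add: iter[OF length_le_enc])
qed

lemma computable_rev [comp_intro]: "computable l \<Longrightarrow> computable (\<lambda>x. rev (l x))"
proof -
  assume l: "computable l"
  have eq: "foldl (\<lambda>acc y. y # acc) acc xs = rev xs @ acc" for acc xs :: "'b list"
    by (induction xs arbitrary: acc) auto
  have "computable (\<lambda>x. foldl (\<lambda>acc y. y # acc) [] (l x))"
    by (intro comp_intro l)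
  then show ?thesis by (simp add: eq)
qed

lemma computable_append [comp_intro]:
  assumes "computable l" "computable m"
  shows "computable (\<lambda>x. l x @ m x)"
proof -
  have eq: "foldl (\<lambda>acc y. y # acc) acc xs = rev xs @ acc" for acc xs :: "'b list"
    by (induction xs arbitrary: acc) auto
  have "computable (\<lambda>x. foldl (\<lambda>acc y. y # acc) (m x) (rev (l x)))"
    by (intro comp_intro assms)
  then show ?thesis by (simp add: eq)
qed

lemma computable_map [comp_intro]:
  assumes "computable (\<lambda>p. f (fst p) (snd p))" "computable l"
  shows "computable (\<lambda>x. map (f x) (l x))"
proof -
  have eq: "foldl (\<lambda>acc y. acc @ [f x y]) acc xs = acc @ map (f x) xs" for x acc xs
    by (induction xs arbitrary: acc) auto
  have "computable (\<lambda>x. foldl (\<lambda>acc y. acc @ [f x y]) [] (l x))"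
    by (intro comp_intro assms(2)
       computable_comp2[OF assms(1)])
  then show ?thesis by (simp add: eq)
qed

lemma computable_concat [comp_intro]:
  assumes "computable l"
  shows "computable (\<lambda>x. concat (l x))"
proof -
  have eq: "foldl (\<lambda>acc y. acc @ y) acc xs = acc @ concat xs" for acc :: "'b list" and xs
    by (induction xs arbitrary: acc) auto
  have "computable (\<lambda>x. foldl (\<lambda>acc y. acc @ y) [] (l x))"
    by (intro comp_intro assms)
  then show ?thesis by (simp add: eq)
qed

lemma computable_filter [comp_intro]:
  assumes "computable (\<lambda>p. f (fst p) (snd p))" "computable l"
  shows "computable (\<lambda>x. filter (f x) (l x))"
proof -
  have eq: "concat (map (\<lambda>y. if f x y then [y] else []) xs) = filter (f x) xs" for x xs
    by (induction xs) auto
  have "computable (\<lambda>x. concat (map (\<lambda>y. if f x y then [y] else []) (l x)))"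
    by (intro comp_intro assms)
  then show ?thesis by (simp add: eq)
qed

lemma computable_Bex [comp_intro]:
  assumes "computable (\<lambda>p. P (fst p) (snd p))" "computable l"
  shows "computable (\<lambda>x. \<exists>y\<in>set (l x). P x y)"
proof -
  have "computable (\<lambda>x. \<not> filter (P x) (l x) = [])"
    by (intro comp_intro assms)
  then show ?thesis by (simp add: filter_empty_conv)
qed

lemma computable_Ball [comp_intro]:
  assumes "computable (\<lambda>p. P (fst p) (snd p))" "computable l"
  shows "computable (\<lambda>x. \<forall>y\<in>set (l x). P x y)"
proof -
  have "computable (\<lambda>x. filter (\<lambda>y. \<not> P x y) (l x) = [])"
    by (intro comp_intro assms)
  then show ?thesis by (simp add: filter_empty_conv)
qed

lemma computable_length [comp_intro]:
  assumes "computable l"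
  shows "computable (\<lambda>x. length (l x))"
proof -
  have eq: "foldl (\<lambda>n _. Suc n) n xs = n + length xs" for n and xs :: "'b list"
    by (induction xs arbitrary: n) auto
  have "computable (\<lambda>x. foldl (\<lambda>n _. Suc n) 0 (l x))"
    by (intro comp_intro assms)
  then show ?thesis by (simp add: eq)
qed

lemma computable_upt [comp_intro]:
  assumes "computable n"
  shows "computable (\<lambda>x. [0..<n x])"
proof -
  have eq: "((\<lambda>l. l @ [length l]) ^^ k) [] = [0..<k]" for k
    by (induction k) auto
  have "computable (\<lambda>x. ((\<lambda>l. l @ [length l]) ^^ n x) [])"
    by (intro comp_intro assms)
  then show ?thesis by (simp add: eq)
qed

lemma computable_tl [comp_intro]:
  assumes "computable l"
  shows "computable (\<lambda>x. tl (l x))"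
proof -
  have "computable (\<lambda>x. case l x of [] \<Rightarrow> [] | y # ys \<Rightarrow> ys)"
    by (intro computable_case_list comp_intro assms)
  then show ?thesis by (simp add: tl_def)
qed

lemma computable_drop [comp_intro]:
  assumes "computable n" "computable l"
  shows "computable (\<lambda>x. drop (n x) (l x))"
proof -
  have eq: "(tl ^^ k) xs = drop k xs" for k and xs :: "'b list"
    by (induction k) (auto simp: drop_Suc tl_drop)
  have "computable (\<lambda>x. (tl ^^ n x) (l x))"
    by (intro comp_intro assms)
  then show ?thesis by (simp add: eq)
qed

lemma computable_take [comp_intro]:
  assumes "computable n" "computable l"
  shows "computable (\<lambda>x. take (n x) (l x))"
proof -
  have eq: "rev (drop (length xs - k) (rev xs)) = take k xs" for k and xs :: "'b list"
    by (cases "k \<le> length xs") (simp_all add: rev_drop)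
  have "computable (\<lambda>x. rev (drop (length (l x) - n x) (rev (l x))))"
    by (intro comp_intro assms)
  then show ?thesis by (simp add: eq)
qed

definition nth_default :: "'a \<Rightarrow> 'a list \<Rightarrow> nat \<Rightarrow> 'a" where
  "nth_default d xs n = (if n < length xs then xs ! n else d)"

lemma computable_nth_default [comp_intro]:
  assumes "computable d" "computable l" "computable n"
  shows "computable (\<lambda>x. nth_default (d x) (l x) (n x))"
proof -
  have eq: "(case drop k xs of [] \<Rightarrow> e | y # ys \<Rightarrow> y) = nth_default e xs k" for k e and xs :: "'b list"
    by (cases "k < length xs") (simp_all add: nth_default_def Cons_nth_drop_Suc[symmetric])
  have "computable (\<lambda>x. case drop (n x) (l x) of [] \<Rightarrow> d x | y # ys \<Rightarrow> y)"
    by (intro computable_case_list comp_intro assms)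
  then show ?thesis by (simp add: eq)
qed

lemma computable_n_lists [comp_intro]:
  assumes "computable n" "computable l"
  shows "computable (\<lambda>x. List.n_lists (n x) (l x))"
proof -
  have eq: "((\<lambda>r. concat (map (\<lambda>ys. map (\<lambda>y. y # ys) xs) r)) ^^ k) [[]] = List.n_lists k xs"
    for k and xs :: "'b list"
    by (induction k) auto
  have "computable (\<lambda>x. ((\<lambda>r. concat (map (\<lambda>ys. map (\<lambda>y. y # ys) (l x)) r)) ^^ n x) [[]])"
    by (intro comp_intro computable_comp[OF assms(1)] computable_comp[OF assms(2)])
  then show ?thesis by (simp add: eq)
qed

lemma computable_mult [comp_intro]:
  fixes f g :: "'a::enc \<Rightarrow> nat"
  assumes "computable f" "computable g"
  shows "computable (\<lambda>x. f x * g x)"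
proof -
  have eq: "((\<lambda>r. r + a) ^^ k) 0 = k * a" for k a :: nat
    by (induction k) auto
  have "computable (\<lambda>x. ((\<lambda>r. r + g x) ^^ f x) 0)"
    by (intro comp_intro computable_comp[OF assms(1)] computable_comp[OF assms(2)])
  then show ?thesis by (simp add: eq)
qed

text \<open>A counter that is reset when it would reach the divisor. Divisor 0 is never reached, in
  accordance with \<open>a mod 0 = a\<close>.\<close>

lemma computable_mod [comp_intro]:
  fixes f g :: "'a::enc \<Rightarrow> nat"
  assumes "computable f" "computable g"
  shows "computable (\<lambda>x. f x mod g x)"
proof -
  have eq: "((\<lambda>r. if Suc r = b then 0 else Suc r) ^^ a) 0 = a mod b" for a b :: nat
    by (induction a) (auto simp: mod_Suc)
  have "computable (\<lambda>x. ((\<lambda>r. if Suc r = g x then 0 else Suc r) ^^ f x) 0)"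
    by (intro comp_intro computable_comp[OF assms(1)] computable_comp[OF assms(2)])
  then show ?thesis by (simp add: eq)
qed

lemma computable_div [comp_intro]:
  fixes f g :: "'a::enc \<Rightarrow> nat"
  assumes "computable f" "computable g"
  shows "computable (\<lambda>x. f x div g x)"
proof -
  have eq: "((\<lambda>r. if Suc (snd r) = b then (Suc (fst r), 0) else (fst r, Suc (snd r))) ^^ a) (0, 0)
      = (a div b, a mod b)" for a b :: nat
    by (induction a) (auto simp: mod_Suc div_Suc)
  have "computable (\<lambda>x. fst (((\<lambda>r. if Suc (snd r) = g x then (Suc (fst r), 0) else (fst r, Suc (snd r))) ^^ f x) (0, 0)))"
    by (intro comp_intro computable_comp[OF assms(1)] computable_comp[OF assms(2)])
  then show ?thesis by (simp add: eq)
qed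

lemma computable_power [comp_intro]:
  fixes f g :: "'a::enc \<Rightarrow> nat"
  assumes "computable f" "computable g"
  shows "computable (\<lambda>x. f x ^ g x)"
proof -
  have eq: "((\<lambda>r. a * r) ^^ k) 1 = a ^ k" for k a :: nat
    by (induction k) auto
  have "computable (\<lambda>x. ((\<lambda>r. f x * r) ^^ g x) 1)"
    by (intro comp_intro computable_comp[OF assms(1)] computable_comp[OF assms(2)])
  then show ?thesis unfolding eq .
qed

lemma computable_fact [comp_intro]:
  assumes "computable f"
  shows "computable (\<lambda>x. fact (f x) :: nat)"
proof -
  have eq: "((\<lambda>r. (Suc (fst r), Suc (fst r) * snd r)) ^^ k) (0, 1) = (k, fact k)" for k :: nat
    by (induction k) auto
  have "computable (\<lambda>x. snd (((\<lambda>r. (Suc (fst r), Suc (fst r) * snd r)) ^^ f x) (0, 1 :: nat)))"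
    by (intro comp_intro assms)
  then show ?thesis unfolding eq by simp
qed

text \<open>The tree of recursive calls is unfolded breadth first, which needs only bounded iteration
  because the measure \<open>m\<close> bounds its depth; the values are then propagated from the deepest level upwards.\<close>

fun collect :: "('a \<Rightarrow> 'a list) \<Rightarrow> ('a \<Rightarrow> 'b list \<Rightarrow> 'b) \<Rightarrow> 'a list \<Rightarrow> 'b list \<Rightarrow> 'b list" where
  "collect deps step [] vs = []"
| "collect deps step (y # ys) vs =
     step y (take (length (deps y)) vs) # collect deps step ys (drop (length (deps y)) vs)"

theorem computable_recursion:
  fixes f :: "'a::enc \<Rightarrow> 'b::enc" and m :: "'a \<Rightarrow> nat"
  assumes deps: "computable deps" and step: "computable (\<lambda>p. step (fst p) (snd p))" and m: "computable m"
    and f: "\<And>x. f x = step x (map f (deps x))"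
    and dec: "\<And>x y. y \<in> set (deps x) \<Longrightarrow> m y < m x"
  shows "computable f"
proof -
  \<comment> \<open>All calls at depth \<open>k\<close> of the call tree of \<open>x\<close>, from
    left to right and with repetitions.\<close>
  define lev where "lev x k = ((\<lambda>l. concat (map deps l)) ^^ k) [x]" for x k
  have lev: "computable (\<lambda>p. lev (fst p) (snd p))"
    unfolding lev_def by (intro comp_intro computable_comp[OF deps])
  have bound: "y \<in> set (lev x k) \<Longrightarrow> m y + k \<le> m x" for x y k
  proof (induction k arbitrary: y)
    case (Suc k)
    then obtain z where "z \<in> set (lev x k)" "y \<in> set (deps z)"
      by (auto simp: lev_def)
    then show ?case using Suc.IH[of z] dec[of y z] by simp
  qed (simp add: lev_def)
  \<comment> \<open>The measure drops by at least one per level, so nothing is left at depth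
    \<open>m x + 1\<close>.\<close>
  have lev_empty: "lev x (Suc (m x)) = []" for x
    using bound[of _ x "Suc (m x)"] by (cases "lev x (Suc (m x))") force+
  define h where "h r y = (drop (length (deps y)) (fst r), snd r @ [step y (take (length (deps y)) (fst r))])"
    for r :: "'b list \<times> 'b list" and y
  have collect_fold: "snd (foldl h (vs, acc) ys) = acc @ collect deps step ys vs" for ys vs acc
    by (induction ys arbitrary: vs acc) (auto simp: h_def)
  have collect_map: "collect deps step ys (map f (concat (map deps ys))) = map f ys" for ys
    by (induction ys) (auto simp: f[symmetric])
  \<comment> \<open>The state is a level together with the values of \<open>f\<close> on the calls
    of that level; one round produces the state of the level above.\<close>
  define up where "up x r = (fst r - 1, collect deps step (lev x (fst r - 1)) (snd r))"
    for x and r :: "nat \<times> 'b list"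
  have h: "computable (\<lambda>p. h (fst (snd p)) (snd (snd p)))"
    unfolding h_def by (intro comp_intro computable_comp[OF deps] computable_comp2[OF step])
  have up: "computable (\<lambda>p. up (fst p) (snd p))"
    unfolding up_def collect_fold[of _ "[]", simplified, symmetric]
    by (intro comp_intro computable_comp2[OF lev] h)
  have up_iter: "k \<le> Suc (m x) \<Longrightarrow>
      (up x ^^ k) (Suc (m x), []) = (Suc (m x) - k, map f (lev x (Suc (m x) - k)))" for x k
  proof (induction k)
    case 0
    then show ?case by (simp add: lev_empty)
  next
    case (Suc k)
    have "lev x (Suc (m x) - k) = concat (map deps (lev x (m x - k)))"
      using Suc.prems by (simp add: Suc_diff_le lev_def)
    then show ?case using Suc by (simp add: up_def collect_map)
  qed
  \<comment> \<open>After all rounds the state is level 0, whose only call is \<open>x\<close>; the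
    default of \<open>nth_default\<close> is therefore never returned.\<close>
  have "computable (\<lambda>x. nth_default (f undefined) (snd ((up x ^^ Suc (m x)) (Suc (m x), []))) 0)"
    by (intro comp_intro up m)
  then show ?thesis
    unfolding up_iter[OF order_refl] by (simp add: nth_default_def lev_def)
qed

section \<open>Recognizable languages of infinite words\<close>

definition seg :: "(nat \<Rightarrow> 'a) \<Rightarrow> nat \<Rightarrow> nat \<Rightarrow> 'a list" where
  "seg w i j = map w [i..<j]"

lemma length_seg [simp]: "length (seg w i j) = j - i"
  by (simp add: seg_def)

lemma nth_seg [simp]: "k < j - i \<Longrightarrow> seg w i j ! k = w (i + k)"
  by (simp add: seg_def)

lemma seg_append:
  assumes "i \<le> j" "j \<le> k"
  shows "seg w i j @ seg w j k = seg w i k"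
proof -
  have "[i..<k] = [i..<j] @ [j..<k]"
    using upt_add_eq_append[OF assms(1), of "k - j"] assms(2) by simp
  then show ?thesis by (simp add: seg_def)
qed

lemma map_seg: "map h (seg w i j) = seg (\<lambda>n. h (w n)) i j"
  by (simp add: seg_def)

lemma seg_Cons: "i < j \<Longrightarrow> seg w i j = w i # seg w (Suc i) j"
  by (simp add: seg_def upt_conv_Cons)

text \<open>The cutting points of a factorization of an infinite word into finite nonempty
  blocks.\<close>

definition cuts :: "(nat \<Rightarrow> nat) \<Rightarrow> bool" where
  "cuts c \<longleftrightarrow> strict_mono c \<and> c 0 = 0"

lemma cuts_block:
  assumes "cuts c"
  shows "\<exists>!i. c i \<le> n \<and> n < c (Suc i)"
proof -
  have mono: "strict_mono c" and 0: "c 0 = 0"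
    using assms by (auto simp: cuts_def)
  have "\<exists>i. c i \<le> n \<and> n < c (Suc i)"
  proof (induction n)
    case 0
    then show ?case using mono \<open>c 0 = 0\<close> by (intro exI[of _ 0]) (metis le_zero_eq less_numeral_extra(3) neq0_conv n_not_Suc_n strict_mono_eq)
  next
    case (Suc n)
    then obtain i where i: "c i \<le> n" "n < c (Suc i)" by blast
    show ?case
    proof (cases "Suc n < c (Suc i)")
      case True
      then show ?thesis using i by (intro exI[of _ i]) auto
    next
      case False
      then show ?thesis using i strict_monoD[OF mono, of "Suc i" "Suc (Suc i)"]
        by (intro exI[of _ "Suc i"]) auto
    qed
  qed
  moreover have "i = j" if "c i \<le> n" "n < c (Suc i)" "c j \<le> n" "n < c (Suc j)" for i j
  proof -
    have "c i < c (Suc j)" "c j < c (Suc i)" using that by auto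
    then have "i < Suc j" "j < Suc i" using strict_mono_less[OF mono] by blast+
    then show ?thesis by simp
  qed
  ultimately show ?thesis by blast
qed

lemma cuts_mono: "cuts c \<Longrightarrow> c i < c (Suc i)"
  by (auto simp: cuts_def strict_mono_def)

text \<open>Each position of the glued word is looked up in the unique block containing it, so
  concatenating infinitely many blocks needs no recursion.\<close>

lemma cuts_glue:
  assumes c: "cuts c" and len: "\<And>i. length (us i) = c (Suc i) - c i"
  obtains y where "\<And>i. seg y (c i) (c (Suc i)) = us i"
proof
  define y where "y n = (let i = (THE i. c i \<le> n \<and> n < c (Suc i)) in us i ! (n - c i))" for n
  fix i
  have "y (c i + k) = us i ! k" if "k < c (Suc i) - c i" for k
  proof -
    have "(THE j. c j \<le> c i + k \<and> c i + k < c (Suc j)) = i"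
      by (rule the1_equality[OF cuts_block[OF c]]) (use that in auto)
    then show ?thesis by (simp add: y_def)
  qed
  then show "seg y (c i) (c (Suc i)) = us i"
    by (intro nth_equalityI) (auto simp: len)
qed

text \<open>Saturation is required for arbitrary factorizations into blocks, not only for those with eventually
  constant type. In this strong form, existential projection is just the power set construction.\<close>

definition saturates :: "('a list \<Rightarrow> 'b) \<Rightarrow> ((nat \<Rightarrow> 'a) \<Rightarrow> bool) \<Rightarrow> bool" where
  "saturates f X \<longleftrightarrow>
     (\<forall>u u' v v'. f u = f u' \<longrightarrow> f v = f v' \<longrightarrow> f (u @ v) = f (u' @ v')) \<and>
     (\<forall>w w' c c'. cuts c \<longrightarrow> cuts c' \<longrightarrow>
        (\<forall>i. f (seg w (c i) (c (Suc i))) = f (seg w' (c' i) (c' (Suc i)))) \<longrightarrow> X w \<longrightarrow> X w')"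

text \<open>The first conjunct of \<open>saturates\<close> makes the kernel of \<open>f\<close> a
  congruence, so the range of \<open>f\<close> is a semigroup with at most \<open>N\<close>
  elements. Fixing the type \<open>nat\<close> for its elements avoids quantifying over types;
  \<open>recognizableI\<close> renames other finite ranges.\<close>

definition recognizable :: "nat \<Rightarrow> ((nat \<Rightarrow> 'a) \<Rightarrow> bool) \<Rightarrow> bool" where
  "recognizable N X \<longleftrightarrow> (\<exists>f :: 'a list \<Rightarrow> nat. (\<forall>u. f u < N) \<and> saturates f X)"

lemma saturatesI:
  assumes "\<And>u u' v v'. f u = f u' \<Longrightarrow> f v = f v' \<Longrightarrow> f (u @ v) = f (u' @ v')"
    and "\<And>w w' c c'. cuts c \<Longrightarrow> cuts c' \<Longrightarrow>
      (\<And>i. f (seg w (c i) (c (Suc i))) = f (seg w' (c' i) (c' (Suc i)))) \<Longrightarrow> X w \<Longrightarrow> X w'"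
  shows "saturates f X"
  using assms unfolding saturates_def by blast

lemma saturates_append:
  assumes "saturates f X" "f u = f u'" "f v = f v'"
  shows "f (u @ v) = f (u' @ v')"
  using conjunct1[OF assms(1)[unfolded saturates_def], rule_format, OF assms(2,3)] .

lemma saturates_word:
  assumes "saturates f X" "cuts c" "cuts c'"
    "\<And>i. f (seg w (c i) (c (Suc i))) = f (seg w' (c' i) (c' (Suc i)))"
  shows "X w \<longleftrightarrow> X w'"
proof -
  have imp: "X v \<Longrightarrow> X v'" if "cuts d" "cuts d'" "\<forall>i. f (seg v (d i) (d (Suc i))) = f (seg v' (d' i) (d' (Suc i)))"
    for v v' d d'
    using assms(1) that unfolding saturates_def by blast
  show ?thesis
    using imp[OF assms(2,3)] imp[OF assms(3,2)] assms(4) by metis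
qed

lemma recognizableI:
  assumes f: "saturates f X" and S: "finite S" "range f \<subseteq> S" "card S \<le> N"
  shows "recognizable N X"
proof -
  obtain h where h: "bij_betw h S {0..<card S}"
    using ex_bij_betw_finite_nat[OF S(1)] by blast
  have eq: "h (f u) = h (f v) \<longleftrightarrow> f u = f v" for u v
    using inj_on_eq_iff[OF bij_betw_imp_inj_on[OF h]] S(2) by blast
  have "h (f u) < N" for u
  proof -
    have "h (f u) < card S" using bij_betwE[OF h] S(2) by auto
    then show ?thesis using S(3) by simp
  qed
  moreover have "saturates (\<lambda>u. h (f u)) X"
    using f unfolding saturates_def eq by blast
  ultimately show ?thesis
    unfolding recognizable_def by (intro exI[of _ "\<lambda>u. h (f u)"]) simp
qed

lemma recognizable_mono:
  assumes "recognizable N X" "N \<le> M"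
  shows "recognizable M X"
proof -
  obtain f where f: "\<And>u. f u < N" "saturates f X"
    using assms(1) unfolding recognizable_def by blast
  have "f u < M" for u
    using f(1)[of u] assms(2) by simp
  then show ?thesis
    using f(2) unfolding recognizable_def by blast
qed

text \<open>The same \<open>f\<close> works, since saturation can be applied from either word to the
  other.\<close>

lemma recognizable_not:
  assumes "recognizable N X"
  shows "recognizable N (\<lambda>w. \<not> X w)"
proof -
  obtain f where f: "\<And>u. f u < N" "saturates f X"
    using assms unfolding recognizable_def by blast
  have "saturates f (\<lambda>w. \<not> X w)"
    using saturates_append[OF f(2)] saturates_word[OF f(2)] by (intro saturatesI) blast+
  then show ?thesis
    using f(1) unfolding recognizable_def by blast
qed

lemma recognizable_conj:
  assumes "recognizable N X" "recognizable M Y"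
  shows "recognizable (N * M) (\<lambda>w. X w \<and> Y w)"
proof -
  obtain f g where f: "\<And>u. f u < N" "saturates f X" and g: "\<And>u. g u < M" "saturates g Y"
    using assms unfolding recognizable_def by blast
  show ?thesis
  proof (rule recognizableI)
    show "saturates (\<lambda>u. (f u, g u)) (\<lambda>w. X w \<and> Y w)"
    proof (rule saturatesI)
      fix u u' v v'
      assume "(f u, g u) = (f u', g u')" "(f v, g v) = (f v', g v')"
      then show "(f (u @ v), g (u @ v)) = (f (u' @ v'), g (u' @ v'))"
        using saturates_append[OF f(2), of u u' v v'] saturates_append[OF g(2), of u u' v v'] by simp
    next
      fix w w' c c'
      assume "cuts c" "cuts c'" "X w \<and> Y w"
        "\<And>i. (f (seg w (c i) (c (Suc i))), g (seg w (c i) (c (Suc i))))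
          = (f (seg w' (c' i) (c' (Suc i))), g (seg w' (c' i) (c' (Suc i))))"
      then show "X w' \<and> Y w'"
        using saturates_word[OF f(2), of c c' w w'] saturates_word[OF g(2), of c c' w w'] by auto
    qed
    show "range (\<lambda>u. (f u, g u)) \<subseteq> {..<N} \<times> {..<M}"
      using f(1) g(1) by blast
  qed auto
qed

text \<open>Inverse images under letter-to-letter maps: \<open>map h\<close> respects concatenation
  and keeps cutting points. Setting a proposition and selecting worlds from a tuple take this
  form.\<close>

lemma recognizable_letterwise:
  assumes "recognizable N X"
  shows "recognizable N (\<lambda>w. X (\<lambda>n. h (w n)))"
proof -
  obtain f where f: "\<And>u. f u < N" "saturates f X"
    using assms unfolding recognizable_def by blast
  have "saturates (\<lambda>u. f (map h u)) (\<lambda>w. X (\<lambda>n. h (w n)))"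
  proof (rule saturatesI)
    fix u u' v v'
    assume "f (map h u) = f (map h u')" "f (map h v) = f (map h v')"
    then show "f (map h (u @ v)) = f (map h (u' @ v'))"
      unfolding map_append by (rule saturates_append[OF f(2)])
  next
    fix w w' c c'
    assume "cuts c" "cuts c'" "X (\<lambda>n. h (w n))"
      "\<And>i. f (map h (seg w (c i) (c (Suc i)))) = f (map h (seg w' (c' i) (c' (Suc i))))"
    then show "X (\<lambda>n. h (w' n))"
      using saturates_word[OF f(2), of c c' "\<lambda>n. h (w n)" "\<lambda>n. h (w' n)"] by (simp add: map_seg)
  qed
  then show ?thesis
    using f(1) unfolding recognizable_def by (intro exI[of _ "\<lambda>u. f (map h u)"]) simp
qed

text \<open>The map \<open>g\<close> sends a word to the set of types of all its annotations by
  letters from \<open>A\<close>. Given an annotation of \<open>w\<close>, each block of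
  \<open>w'\<close> has an annotation of the same type as the corresponding annotated block of
  \<open>w\<close>; gluing these yields an annotation of \<open>w'\<close>.\<close>

lemma recognizable_ex:
  assumes "recognizable N X"
  shows "recognizable (2 ^ N) (\<lambda>w. \<exists>x. range x \<subseteq> A \<and> X (\<lambda>n. (w n, x n)))"
proof -
  obtain f where f: "\<And>u. f u < N" "saturates f X"
    using assms unfolding recognizable_def by blast
  define g where "g u = {f v | v. map fst v = u \<and> snd ` set v \<subseteq> A}" for u
  \<comment> \<open>The right-hand side depends on \<open>u\<close> and \<open>v\<close> only
    through \<open>g u\<close> and \<open>g v\<close>, which is all the congruence property
    needs.\<close>
  have g_append: "g (u @ v) = (\<Union>a\<in>{(p, q). f p \<in> g u \<and> f q \<in> g v}. {f (fst a @ snd a)})" for u v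
  proof (intro equalityI subsetI)
    fix s assume "s \<in> g (u @ v)"
    then obtain z where z: "s = f z" "map fst z = u @ v" "snd ` set z \<subseteq> A"
      unfolding g_def by blast
    let ?p = "take (length u) z" and ?q = "drop (length u) z"
    have "map fst ?p = u" "map fst ?q = v"
      using z(2) by (simp_all add: take_map[symmetric] drop_map[symmetric])
    moreover have "snd ` set ?p \<subseteq> A" "snd ` set ?q \<subseteq> A"
      using z(3) set_take_subset[of "length u" z] set_drop_subset[of "length u" z] by blast+
    ultimately have "f ?p \<in> g u" "f ?q \<in> g v"
      unfolding g_def by blast+
    then show "s \<in> (\<Union>a\<in>{(p, q). f p \<in> g u \<and> f q \<in> g v}. {f (fst a @ snd a)})"
      using z(1) by (intro UN_I[of "(?p, ?q)"]) auto
  next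
    fix s assume "s \<in> (\<Union>a\<in>{(p, q). f p \<in> g u \<and> f q \<in> g v}. {f (fst a @ snd a)})"
    then obtain p q where s: "s = f (p @ q)" "f p \<in> g u" "f q \<in> g v" by auto
    then obtain p' q' where "f p = f p'" "map fst p' = u" "snd ` set p' \<subseteq> A"
      "f q = f q'" "map fst q' = v" "snd ` set q' \<subseteq> A"
      unfolding g_def by auto
    moreover from this have "s = f (p' @ q')"
      using s(1) saturates_append[OF f(2)] by metis
    ultimately show "s \<in> g (u @ v)"
      unfolding g_def by (intro CollectI exI[of _ "p' @ q'"]) auto
  qed
  show ?thesis
  proof (rule recognizableI)
    show "saturates g (\<lambda>w. \<exists>x. range x \<subseteq> A \<and> X (\<lambda>n. (w n, x n)))"
    proof (rule saturatesI)
      show "g (u @ v) = g (u' @ v')" if "g u = g u'" "g v = g v'" for u u' v v'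
        unfolding g_append that ..
      fix w w' c c'
      assume c: "cuts c" "cuts c'" and eq: "\<And>i. g (seg w (c i) (c (Suc i))) = g (seg w' (c' i) (c' (Suc i)))"
        and "\<exists>x. range x \<subseteq> A \<and> X (\<lambda>n. (w n, x n))"
      then obtain x where x: "range x \<subseteq> A" "X (\<lambda>n. (w n, x n))" by blast
      let ?z = "\<lambda>n. (w n, x n)"
      have "\<exists>v. map fst v = seg w' (c' i) (c' (Suc i)) \<and> snd ` set v \<subseteq> A \<and>
          f v = f (seg ?z (c i) (c (Suc i)))" for i
      proof -
        have "f (seg ?z (c i) (c (Suc i))) \<in> g (seg w (c i) (c (Suc i)))"
          unfolding g_def using x(1)
          by (intro CollectI exI[of _ "seg ?z (c i) (c (Suc i))"]) (auto simp: map_seg, auto simp: seg_def)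
        then have "f (seg ?z (c i) (c (Suc i))) \<in> g (seg w' (c' i) (c' (Suc i)))"
          by (simp only: eq)
        then show ?thesis unfolding g_def by fastforce
      qed
      then obtain v where v: "\<And>i. map fst (v i) = seg w' (c' i) (c' (Suc i))"
        "\<And>i. snd ` set (v i) \<subseteq> A" "\<And>i. f (v i) = f (seg ?z (c i) (c (Suc i)))" by metis
      have len: "length (v i) = c' (Suc i) - c' i" for i
        using arg_cong[OF v(1)[of i], of length] by simp
      obtain y where y: "\<And>i. seg y (c' i) (c' (Suc i)) = v i"
        using cuts_glue[OF c(2) len] by blast
      have pt: "y n \<in> set (v i) \<and> fst (y n) = w' n" if "c' i \<le> n" "n < c' (Suc i)" for i n
      proof -
        have "y n = v i ! (n - c' i)"
          using that unfolding y[symmetric] by simp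
        moreover have "fst (v i ! (n - c' i)) = w' n"
          using arg_cong[OF v(1)[of i], of "\<lambda>l. l ! (n - c' i)"] that len[of i] by simp
        ultimately show ?thesis using len[of i] that by simp
      qed
      have fst: "fst (y n) = w' n" and snd: "snd (y n) \<in> A" for n
        using cuts_block[OF c(2), of n] pt v(2) by blast+
      have "X ?z \<longleftrightarrow> X y"
        by (rule saturates_word[OF f(2) c]) (simp add: v y)
      then have "X y" using x(2) by simp
      moreover have "y = (\<lambda>n. (w' n, snd (y n)))"
        by (rule HOL.ext) (simp add: fst[symmetric])
      ultimately show "\<exists>x. range x \<subseteq> A \<and> X (\<lambda>n. (w' n, x n))"
        using snd by (intro exI[of _ "\<lambda>n. snd (y n)"]) auto
    qed
    show "range g \<subseteq> Pow {..<N}"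
      unfolding g_def using f(1) by auto
    show "card (Pow {..<N}) \<le> 2 ^ N" by (simp add: card_Pow)
  qed simp
qed

section \<open>Ultimately periodic words and pumping\<close>

text \<open>One number is both preperiod and period. Being a lasso then passes to positive multiples
  of \<open>L\<close>, so finitely many words can share one parameter.\<close>

definition lasso :: "nat \<Rightarrow> (nat \<Rightarrow> 'a) \<Rightarrow> bool" where
  "lasso L w \<longleftrightarrow> (\<forall>n\<ge>L. w (n + L) = w n)"

lemma lasso_add_mult:
  assumes "lasso L w" "L \<le> n"
  shows "w (n + L * k) = w n"
proof (induction k)
  case (Suc k)
  have "w (n + L * k + L) = w (n + L * k)"
    using assms unfolding lasso_def by simp
  then show ?case using Suc by (simp add: algebra_simps)
qed simp

lemma lasso_mult:
  assumes "lasso L w" "0 < k"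
  shows "lasso (L * k) w"
  unfolding lasso_def
proof (intro allI impI)
  fix n assume "L * k \<le> n"
  then have "L \<le> n" using assms(2) by (metis le_trans mult_le_mono2 nat_mult_1_right Suc_leI One_nat_def)
  then show "w (n + L * k) = w n" by (rule lasso_add_mult[OF assms(1)])
qed

lemma lasso_seg_shift:
  assumes "lasso L w" "L \<le> i"
  shows "seg w (i + L * k) (j + L * k) = seg w i j"
proof (rule nth_equalityI)
  fix n assume "n < length (seg w (i + L * k) (j + L * k))"
  then show "seg w (i + L * k) (j + L * k) ! n = seg w i j ! n"
    using lasso_add_mult[OF assms(1), of "i + n" k] assms(2) by (simp add: ac_simps)
qed simp

text \<open>Removing a factor of length divisible by \<open>L\<close> between two prefixes of the same type keeps the first component,
  because \<open>w\<close> is periodic there.\<close>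

lemma pump_down:
  fixes f :: "('a \<times> 'b) list \<Rightarrow> nat"
  assumes f: "\<And>u. f u < N" "saturates f X" and w: "lasso L w"
    and v: "map fst v = seg w m (m + L * k)" "snd ` set v \<subseteq> A" "0 < k"
  shows "\<exists>a v'. 0 < a \<and> a \<le> N \<and> map fst v' = seg w m (m + L * a) \<and> snd ` set v' \<subseteq> A \<and> f v' = f v"
proof -
  let ?Q = "\<lambda>a. 0 < a \<and> (\<exists>v'. map fst v' = seg w m (m + L * a) \<and> snd ` set v' \<subseteq> A \<and> f v' = f v)"
  define a where "a = (LEAST a. ?Q a)"
  have "?Q k" using v by blast
  then have "?Q a"
    unfolding a_def by (rule LeastI)
  have least: "a \<le> b" if "?Q b" for b
    unfolding a_def using that by (rule Least_le)
  from \<open>?Q a\<close>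
  obtain v' where a: "0 < a" and v': "map fst v' = seg w m (m + L * a)" "snd ` set v' \<subseteq> A" "f v' = f v"
    by blast
  have "a \<le> N"
  proof (rule ccontr)
    assume "\<not> a \<le> N"
    \<comment> \<open>Prefixes are cut at positive multiples of \<open>L\<close>; if there are more
      than \<open>N\<close>, two have the same type. Starting at 1 puts the position
      \<open>m + L * i\<close> at or beyond \<open>L\<close>, where \<open>w\<close> is periodic;
      \<open>m\<close> itself may be 0.\<close>
    let ?p = "\<lambda>j. f (take (L * j) v')"
    have "card (?p ` {1..a}) \<le> card {..<N}"
      using f(1) by (intro card_mono) auto
    also have "\<dots> < card {1..a}"
      using \<open>\<not> a \<le> N\<close> by simp
    finally have "\<not> inj_on ?p {1..a}"
      by (rule pigeonhole)
    then obtain i j where "i \<in> {1..a}" "j \<in> {1..a}" "i < j" "?p i = ?p j"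
      using linorder_inj_onI'[of "{1..a}" ?p] by blast
    then have ij: "1 \<le> i" "i < j" "j \<le> a" and eq: "?p i = ?p j"
      by auto
    let ?v = "take (L * i) v' @ drop (L * j) v'"
    have "f ?v = f (take (L * j) v' @ drop (L * j) v')"
      by (rule saturates_append[OF f(2) eq refl])
    then have "f ?v = f v" using v' by simp
    moreover have "snd ` set ?v \<subseteq> A"
      using v'(2) set_take_subset[of "L * i" v'] set_drop_subset[of "L * j" v'] by auto
    moreover have "map fst ?v = seg w m (m + L * (a - (j - i)))"
    proof -
      have le: "L * i \<le> L * j" "L * j \<le> L * a" "L \<le> m + L * i" using ij by (auto intro: trans_le_add2)
      have "map fst (take (L * i) v') = seg w m (m + L * i)"
      proof -
        have "m + L * i \<le> m + L * a" using le by linarith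
        then show ?thesis
          unfolding take_map[symmetric] v'(1) seg_def by (simp only: take_map take_upt)
      qed
      moreover have "map fst (drop (L * j) v') = seg w (m + L * j) (m + L * a)"
        unfolding drop_map[symmetric] v'(1) by (simp add: seg_def drop_map)
      \<comment> \<open>The rest of the annotated word moves left by \<open>L * (j - i)\<close>, a
        multiple of the period, so it still annotates \<open>w\<close>.\<close>
      moreover have "seg w (m + L * j) (m + L * a) = seg w (m + L * i) (m + L * (a - (j - i)))"
      proof -
        have "m + L * j = m + L * i + L * (j - i)" "m + L * a = m + L * (a - (j - i)) + L * (j - i)"
          using ij by (simp_all add: add.assoc add_mult_distrib2[symmetric])
        then show ?thesis using lasso_seg_shift[OF w le(3)] by metis
      qed
      moreover have "L * i \<le> L * (a - (j - i))" using ij by (intro mult_le_mono2) linarith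
      ultimately show ?thesis by (simp add: seg_append)
    qed
    ultimately have "a \<le> a - (j - i)" using ij by (intro least conjI exI[of _ ?v]) simp_all
    then show False using ij by simp
  qed
  then show ?thesis using a v' by blast
qed

text \<open>Pairs of multiples of \<open>L\<close> are coloured by the type of the factor between
  them; Ramsey's theorem gives a factorization whose blocks after the first all have one type
  \<open>e\<close>. Pumping the first block down to \<open>u\<close> and the second down to
  \<open>v\<close> gives the witness \<open>u v v v ...\<close>, of preperiod \<open>L * a\<close>
  and period \<open>L * b\<close> with \<open>a\<close> and \<open>b\<close> at most
  \<open>N\<close>.\<close>

theorem lasso_witness:
  fixes X :: "(nat \<Rightarrow> 'a \<times> 'b) \<Rightarrow> bool"
  assumes X: "recognizable N X" and NB: "N \<le> B" and L: "0 < L" "lasso L w"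
    and x: "range x \<subseteq> A" "X (\<lambda>n. (w n, x n))"
  shows "\<exists>y. range y \<subseteq> A \<and> lasso (L * fact B) y \<and> X (\<lambda>n. (w n, y n))"
proof -
  obtain f where f: "\<And>u. f u < N" "saturates f X"
    using X unfolding recognizable_def by blast
  let ?z = "\<lambda>n. (w n, x n)"
  define col where "col S = f (seg ?z (L * Min S) (L * Max S))" for S
  \<comment> \<open>Zero is excluded so that the initial block, from 0 to \<open>L * r 0\<close>, is
    nonempty.\<close>
  have "\<exists>Y t. Y \<subseteq> {1..} \<and> infinite Y \<and> t < N \<and> (\<forall>i\<in>Y. \<forall>j\<in>Y. i \<noteq> j \<longrightarrow> col {i, j} = t)"
    by (rule Ramsey2) (auto simp: col_def f(1) infinite_Ici)
  then obtain Y e where Y: "Y \<subseteq> {1..}" "infinite Y" and e: "\<forall>i\<in>Y. \<forall>j\<in>Y. i \<noteq> j \<longrightarrow> col {i, j} = e"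
    by (elim exE conjE)
  define r where "r = enumerate Y"
  have r: "\<And>i. r i \<in> Y" "strict_mono r"
    unfolding r_def using Y by (auto simp: enumerate_in_set strict_mono_enumerate)
  have r0: "0 < r 0" using r(1)[of 0] Y by auto
  have re: "f (seg ?z (L * r i) (L * r (Suc i))) = e" for i
  proof -
    have lt: "r i < r (Suc i)" using r(2) by (simp add: strict_mono_def)
    then show ?thesis using e[rule_format, OF r(1) r(1), of i "Suc i"] by (simp add: col_def min_def max_def)
  qed
  define c where "c i = (case i of 0 \<Rightarrow> 0 | Suc j \<Rightarrow> L * r j)" for i
  have c: "cuts c"
    unfolding cuts_def strict_mono_Suc_iff c_def using L r r0 by (auto split: nat.split simp: strict_mono_Suc_iff)
  have "\<exists>a u. 0 < a \<and> a \<le> N \<and> map fst u = seg w 0 (0 + L * a) \<and> snd ` set u \<subseteq> A \<and> f u = f (seg ?z 0 (L * r 0))"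
    by (rule pump_down[OF f L(2), of _ _ "r 0"]) (use r0 x(1) in \<open>auto simp: map_seg seg_def\<close>)
  then obtain a u where a: "0 < a" "a \<le> N" and u: "map fst u = seg w 0 (L * a)" "snd ` set u \<subseteq> A"
    "f u = f (seg ?z 0 (L * r 0))" by auto
  have "\<exists>b v. 0 < b \<and> b \<le> N \<and> map fst v = seg w (L * r 0) (L * r 0 + L * b) \<and> snd ` set v \<subseteq> A \<and>
      f v = f (seg ?z (L * r 0) (L * r 1))"
  proof (rule pump_down[OF f L(2), of _ _ "r 1 - r 0"])
    have "r 0 < r 1" using r(2) by (simp add: strict_mono_def)
    then have "L * r 0 + L * (r 1 - r 0) = L * r 1" "0 < r 1 - r 0"
      by (simp_all add: add_mult_distrib2[symmetric])
    then show "map fst (seg ?z (L * r 0) (L * r 1)) = seg w (L * r 0) (L * r 0 + L * (r 1 - r 0))" "0 < r 1 - r 0"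
      by (simp_all add: map_seg)
  qed (use x(1) in \<open>auto simp: seg_def\<close>)
  then obtain b v where b: "0 < b" "b \<le> N" and v: "map fst v = seg w (L * r 0) (L * r 0 + L * b)" "snd ` set v \<subseteq> A"
    "f v = e" using re[of 0] by auto
  have lenu: "length u = L * a" and lenv: "length v = L * b"
    using arg_cong[OF u(1), of length] arg_cong[OF v(1), of length] by simp_all
  have La: "0 < L * a" and Lb: "0 < L * b" using L a b by simp_all
  define z' where "z' n = (if n < L * a then u ! n else v ! ((n - L * a) mod (L * b)))" for n
  \<comment> \<open>The word \<open>v\<close> was built over the factor of \<open>w\<close> starting
    at \<open>L * r 0\<close> but is read from \<open>L * a\<close> on. Both positions are positive
    multiples of \<open>L\<close>, so \<open>w\<close> continues in the same way from
    either.\<close>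
  have fst_z': "fst (z' n) = w n" for n
  proof (cases "n < L * a")
    case True
    then show ?thesis using arg_cong[OF u(1), of "\<lambda>l. l ! n"] lenu by (simp add: z'_def)
  next
    case False
    define q where "q = (n - L * a) mod (L * b)"
    have q: "q < L * b" unfolding q_def using Lb by simp
    have "n = L * a + q + L * (b * ((n - L * a) div (L * b)))"
      using False mult_div_mod_eq[of "L * b" "n - L * a"] unfolding q_def by (simp add: mult.assoc)
    then have "w n = w (L * a + q)"
      using lasso_add_mult[OF L(2), of "L * a + q"] a by (metis le_add1 le_trans mult_le_mono2 nat_mult_1_right Suc_leI One_nat_def)
    moreover have "w (L * r 0 + q) = w (L + q)" if "0 < r 0" for r :: "nat \<Rightarrow> nat"
      using lasso_add_mult[OF L(2), of "L + q" "r 0 - 1"] that by (cases "r 0") (auto simp: algebra_simps)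
    from this[of r] this[of "\<lambda>_. a"] have "w (L * r 0 + q) = w (L * a + q)" using r0 a by simp
    moreover have "fst (v ! q) = w (L * r 0 + q)"
      using arg_cong[OF v(1), of "\<lambda>l. l ! q"] lenv q by simp
    ultimately show ?thesis using False by (simp add: z'_def q_def)
  qed
  define y where "y n = snd (z' n)" for n
  have z'_eq: "z' = (\<lambda>n. (w n, y n))"
    by (rule HOL.ext) (simp add: y_def fst_z'[symmetric])
  have yA: "range y \<subseteq> A"
  proof
    fix s assume "s \<in> range y"
    then obtain n where s: "s = snd (z' n)" by (auto simp: y_def)
    have "z' n \<in> set u \<union> set v" using lenu lenv Lb by (auto simp: z'_def)
    then show "s \<in> A" using s u(2) v(2) by blast
  qed
  have y_lasso: "lasso (L * fact B) y"
    unfolding lasso_def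
  proof (intro allI impI)
    fix n assume n: "L * fact B \<le> n"
    have "a \<le> fact B" using a NB fact_ge_self[of B] by linarith
    then have "L * a \<le> n" using n by (meson le_trans mult_le_mono2)
    moreover have "b dvd fact B" using b NB by (intro dvd_fact) auto
    then obtain t where t: "fact B = b * t" by blast
    have "n + L * fact B - L * a = (n - L * a) + (L * b) * t"
      using \<open>L * a \<le> n\<close> by (simp add: t mult.assoc)
    then have "(n + L * fact B - L * a) mod (L * b) = (n - L * a) mod (L * b)" by (metis mod_mult_self2)
    then show "y (n + L * fact B) = y n" using \<open>L * a \<le> n\<close> by (simp add: y_def z'_def)
  qed
  define c' where "c' i = (case i of 0 \<Rightarrow> 0 | Suc j \<Rightarrow> L * a + L * b * j)" for i
  have c': "cuts c'"
    unfolding cuts_def strict_mono_Suc_iff c'_def using La Lb by (auto split: nat.split)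
  \<comment> \<open>Block by block the types agree: \<open>u\<close> replaces the first block, and
    each copy of \<open>v\<close> a block of type \<open>e\<close>.\<close>
  have "f (seg ?z (c i) (c (Suc i))) = f (seg z' (c' i) (c' (Suc i)))" for i
  proof (cases i)
    case 0
    have "seg z' 0 (L * a) = u"
      by (rule nth_equalityI) (auto simp: lenu z'_def)
    then show ?thesis using 0 u(3) by (simp add: c_def c'_def)
  next
    case (Suc j)
    have "seg z' (L * a + L * b * j) (L * a + L * b * Suc j) = v"
      by (rule nth_equalityI) (auto simp: lenv z'_def)
    then show ?thesis using Suc v(3) re[of j] by (simp add: c_def c'_def)
  qed
  then have "X ?z \<longleftrightarrow> X z'" by (rule saturates_word[OF f(2) c c'])
  then show ?thesis using x(2) yA y_lasso unfolding z'_eq by blast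
qed


section \<open>Recognizability of LTL by backward transformers\<close>

fun subformulas :: "'p ltl \<Rightarrow> 'p ltl set" where
  "subformulas (Prop a) = {Prop a}"
| "subformulas (Neg \<phi>) = insert (Neg \<phi>) (subformulas \<phi>)"
| "subformulas (Conj \<phi> \<psi>) = insert (Conj \<phi> \<psi>) (subformulas \<phi> \<union> subformulas \<psi>)"
| "subformulas (Next \<phi>) = insert (Next \<phi>) (subformulas \<phi>)"
| "subformulas (Until \<phi> \<psi>) = insert (Until \<phi> \<psi>) (subformulas \<phi> \<union> subformulas \<psi>)"

fun ltl_size :: "'p ltl \<Rightarrow> nat" where
  "ltl_size (Prop a) = 1"
| "ltl_size (Neg \<phi>) = Suc (ltl_size \<phi>)"
| "ltl_size (Conj \<phi> \<psi>) = Suc (ltl_size \<phi> + ltl_size \<psi>)"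
| "ltl_size (Next \<phi>) = Suc (ltl_size \<phi>)"
| "ltl_size (Until \<phi> \<psi>) = Suc (ltl_size \<phi> + ltl_size \<psi>)"

lemma subformulas_self: "\<phi> \<in> subformulas \<phi>"
  by (cases \<phi>) auto

lemma subformulas_trans: "\<psi> \<in> subformulas \<phi> \<Longrightarrow> subformulas \<psi> \<subseteq> subformulas \<phi>"
  by (induction \<phi>) auto

lemma card_subformulas: "finite (subformulas \<phi>) \<and> card (subformulas \<phi>) \<le> ltl_size \<phi>"
proof (induction \<phi>)
  case (Conj \<phi> \<psi>)
  then show ?case using card_Un_le[of "subformulas \<phi>" "subformulas \<psi>"] by (auto simp: card_insert_if)
next
  case (Until \<phi> \<psi>)
  then show ?case using card_Un_le[of "subformulas \<phi>" "subformulas \<psi>"] by (auto simp: card_insert_if)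
qed (auto simp: card_insert_if)

text \<open>Truth at a position, computed from the letter there and the set \<open>b\<close> of formulas true at the next position.\<close>

fun local_sat :: "'p set \<Rightarrow> 'p ltl set \<Rightarrow> 'p ltl \<Rightarrow> bool" where
  "local_sat c b (Prop a) \<longleftrightarrow> a \<in> c"
| "local_sat c b (Neg \<phi>) \<longleftrightarrow> \<not> local_sat c b \<phi>"
| "local_sat c b (Conj \<phi> \<psi>) \<longleftrightarrow> local_sat c b \<phi> \<and> local_sat c b \<psi>"
| "local_sat c b (Next \<phi>) \<longleftrightarrow> \<phi> \<in> b"
| "local_sat c b (Until \<phi> \<psi>) \<longleftrightarrow> local_sat c b \<psi> \<or> local_sat c b \<phi> \<and> Until \<phi> \<psi> \<in> b"

definition bstep :: "'p ltl set \<Rightarrow> 'p set \<Rightarrow> 'p ltl set \<Rightarrow> 'p ltl set" where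
  "bstep S c b = {\<phi> \<in> S. local_sat c b \<phi>}"

fun visited :: "'p ltl set \<Rightarrow> 'p set list \<Rightarrow> 'p ltl set \<Rightarrow> 'p ltl set" where
  "visited S [] b = {}"
| "visited S (c # u) b = foldr (bstep S) (c # u) b \<union> visited S u b"

text \<open>The second component records which formulas become true inside the block; it is needed to tell whether
  an until formula that holds at all block boundaries is eventually fulfilled.\<close>

definition ltl_type :: "'p ltl set \<Rightarrow> 'p set list \<Rightarrow> 'p ltl set \<Rightarrow> 'p ltl set \<times> 'p ltl set" where
  "ltl_type S u = restrict (\<lambda>b. (foldr (bstep S) u b, visited S u b)) (Pow S)"

lemma foldr_bstep_subset: "b \<subseteq> S \<Longrightarrow> foldr (bstep S) u b \<subseteq> S"
  by (induction u) (auto simp: bstep_def)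

lemma visited_subset: "b \<subseteq> S \<Longrightarrow> visited S u b \<subseteq> S"
  by (induction u) (auto simp: bstep_def)

lemma visited_append: "visited S (u @ v) b = visited S u (foldr (bstep S) v b) \<union> visited S v b"
  by (induction u) auto

lemma ltl_type_eqD:
  assumes "ltl_type S u = ltl_type S u'" "b \<subseteq> S"
  shows "foldr (bstep S) u b = foldr (bstep S) u' b" "visited S u b = visited S u' b"
  using fun_cong[OF assms(1), of b] assms(2) by (simp_all add: ltl_type_def)

lemma ltl_type_append:
  assumes "ltl_type S u = ltl_type S u'" "ltl_type S v = ltl_type S v'"
  shows "ltl_type S (u @ v) = ltl_type S (u' @ v')"
proof -
  have "(foldr (bstep S) (u @ v) b, visited S (u @ v) b) = (foldr (bstep S) (u' @ v') b, visited S (u' @ v') b)"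
    if "b \<in> Pow S" for b
    using that ltl_type_eqD[OF assms(1) foldr_bstep_subset[of b S v']] ltl_type_eqD[OF assms(2), of b]
    by (simp add: visited_append)
  then show ?thesis
    unfolding ltl_type_def by (rule restrict_ext)
qed

definition truth :: "'p ltl set \<Rightarrow> 'p trace \<Rightarrow> nat \<Rightarrow> 'p ltl set" where
  "truth S w n = {\<phi> \<in> S. ltl_sat w n \<phi>}"

lemma until_unfold:
  "ltl_sat w n (Until \<phi> \<psi>) \<longleftrightarrow> ltl_sat w n \<psi> \<or> ltl_sat w n \<phi> \<and> ltl_sat w (Suc n) (Until \<phi> \<psi>)" (is "?l \<longleftrightarrow> ?r")
proof
  assume ?l
  then obtain j where j: "n \<le> j" "ltl_sat w j \<psi>" "\<forall>k. n \<le> k \<and> k < j \<longrightarrow> ltl_sat w k \<phi>" by auto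
  show ?r
  proof (cases "j = n")
    case False
    then have "Suc n \<le> j" "ltl_sat w n \<phi>" using j by auto
    then show ?thesis using j by auto
  qed (use j in auto)
next
  assume ?r
  then show ?l
  proof
    assume "ltl_sat w n \<psi>"
    then show ?l by (auto intro!: exI[of _ n])
  next
    assume "ltl_sat w n \<phi> \<and> ltl_sat w (Suc n) (Until \<phi> \<psi>)"
    then obtain j where j: "Suc n \<le> j" "ltl_sat w j \<psi>" "\<forall>k. Suc n \<le> k \<and> k < j \<longrightarrow> ltl_sat w k \<phi>" "ltl_sat w n \<phi>" by auto
    have "\<forall>k. n \<le> k \<and> k < j \<longrightarrow> ltl_sat w k \<phi>"
      using j(3,4) by (metis Suc_leI le_neq_implies_less)
    then show ?l using j(1,2) by (auto intro!: exI[of _ j])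
  qed
qed

lemma local_sat_iff:
  assumes "subformulas \<phi> \<subseteq> S"
  shows "local_sat (w n) (truth S w (Suc n)) \<phi> \<longleftrightarrow> ltl_sat w n \<phi>"
  using assms
proof (induction \<phi>)
  case (Next \<phi>)
  then show ?case using subformulas_self[of \<phi>] by (auto simp: truth_def)
next
  case (Until \<phi> \<psi>)
  then show ?case using until_unfold[of w n \<phi> \<psi>] by (auto simp: truth_def simp del: ltl_sat.simps)
qed auto

lemma truth_bstep:
  assumes "\<And>\<phi>. \<phi> \<in> S \<Longrightarrow> subformulas \<phi> \<subseteq> S"
  shows "truth S w n = bstep S (w n) (truth S w (Suc n))"
  using local_sat_iff[OF assms, of _ w n] unfolding truth_def[of _ _ n] bstep_def by blast

text \<open>Truth is determined from right to left, which is why a block acts by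
  \<open>foldr\<close>.\<close>

lemma foldr_truth:
  assumes "\<And>\<phi>. \<phi> \<in> S \<Longrightarrow> subformulas \<phi> \<subseteq> S" "m \<le> n"
  shows "foldr (bstep S) (seg w m n) (truth S w n) = truth S w m"
  using assms(2)
proof (induction m rule: inc_induct)
  case base
  then show ?case by (simp add: seg_def)
next
  case (step m)
  then show ?case using truth_bstep[OF assms(1), of w m] by (simp add: seg_Cons)
qed

lemma visited_seg:
  assumes "m \<le> n"
  shows "visited S (seg w m n) b = (\<Union>k\<in>{m..<n}. foldr (bstep S) (seg w k n) b)"
  using assms
proof (induction m rule: inc_induct)
  case base
  then show ?case by (simp add: seg_def)
next
  case (step m)
  then have "{m..<n} = insert m {Suc m..<n}" by auto
  then show ?case using step by (simp add: seg_Cons)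
qed

text \<open>The truth sets of \<open>w\<close> at its cutting points are carried over to the cutting
  points of \<open>w'\<close>; equal types make them fit the blocks of \<open>w'\<close>, and they
  extend to all positions. The resulting sets satisfy the one-step conditions of
  \<open>local_sat\<close>, which determine truth except that an until might be postponed forever.
  The second component of the types excludes this.\<close>

lemma ltl_type_saturates:
  assumes S: "\<And>\<phi>. \<phi> \<in> S \<Longrightarrow> subformulas \<phi> \<subseteq> S" and "\<chi> \<in> S"
  shows "saturates (ltl_type S) (\<lambda>w. ltl_sat w 0 \<chi>)"
proof (rule saturatesI)
  fix w w' :: "'a trace" and c c'
  assume c: "cuts c" and c': "cuts c'" and sat: "ltl_sat w 0 \<chi>"
    and eq: "\<And>i. ltl_type S (seg w (c i) (c (Suc i))) = ltl_type S (seg w' (c' i) (c' (Suc i)))"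
  define a where "a i = truth S w (c i)" for i
  have aS: "a i \<subseteq> S" for i by (auto simp: a_def truth_def)
  have le: "c i \<le> c (Suc i)" "c' i \<le> c' (Suc i)" for i
    using cuts_mono[OF c, of i] cuts_mono[OF c', of i] by simp_all
  have c'_mono: "i \<le> j \<Longrightarrow> c' i \<le> c' j" and c'_ge: "i \<le> c' i" for i j
    using c' unfolding cuts_def by (auto simp: strict_mono_less_eq strict_mono_imp_increasing)
  have a_step: "a i = foldr (bstep S) (seg w' (c' i) (c' (Suc i))) (a (Suc i))" for i
    using foldr_truth[OF S le(1), of w i] ltl_type_eqD(1)[OF eq aS] by (simp add: a_def)
  have a_visited: "(\<Union>k\<in>{c i..<c (Suc i)}. truth S w k)
      = (\<Union>k\<in>{c' i..<c' (Suc i)}. foldr (bstep S) (seg w' k (c' (Suc i))) (a (Suc i)))" for i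
  proof -
    have "(\<Union>k\<in>{c i..<c (Suc i)}. truth S w k) = visited S (seg w (c i) (c (Suc i))) (a (Suc i))"
      unfolding visited_seg[OF le(1)] a_def using foldr_truth[OF S, of _ "c (Suc i)" w] by simp
    also have "\<dots> = visited S (seg w' (c' i) (c' (Suc i))) (a (Suc i))"
      by (rule ltl_type_eqD(2)[OF eq aS])
    finally show ?thesis unfolding visited_seg[OF le(2)] .
  qed
  \<comment> \<open>The set at \<open>k\<close> is computed backwards from a cutting point at or
    after \<open>k\<close>; \<open>c' k\<close> qualifies because \<open>c'\<close> is strictly
    increasing. By \<open>y_eq\<close> the choice is immaterial.\<close>
  define y where "y k = foldr (bstep S) (seg w' k (c' k)) (a k)" for k
  have y_eq: "y k = foldr (bstep S) (seg w' k (c' i)) (a i)" if "k \<le> c' i" for k i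
  proof -
    have *: "foldr (bstep S) (seg w' k (c' j)) (a j) = foldr (bstep S) (seg w' k (c' i)) (a i)"
      if "i \<le> j" "k \<le> c' i" for i j
      using that(1)
    proof (induction j rule: dec_induct)
      case (step j)
      have "k \<le> c' j" using that c'_mono[OF step(1)] by simp
      then have "seg w' k (c' (Suc j)) = seg w' k (c' j) @ seg w' (c' j) (c' (Suc j))"
        using le(2) by (simp add: seg_append)
      then show ?case using step.IH a_step[of j] by simp
    qed simp
    show ?thesis
      using *[of i k] *[of k i] that c'_ge[of k] unfolding y_def by (cases "i \<le> k") auto
  qed
  have y_bstep: "y k = bstep S (w' k) (y (Suc k))" for k
  proof -
    have "k < c' (Suc k)" using c'_ge[of "Suc k"] by simp
    then show ?thesis using y_eq[of k "Suc k"] by (simp add: seg_Cons y_def)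
  qed
  have ya: "y (c' i) = a i" for i
    using y_eq[of "c' i" i] by (simp add: seg_def)
  have y_local: "\<phi> \<in> y k \<longleftrightarrow> local_sat (w' k) (y (Suc k)) \<phi>" if "\<phi> \<in> S" for \<phi> k
    using y_bstep[of k] that unfolding bstep_def by blast
  \<comment> \<open>The sets \<open>y k\<close> are the truth sets of \<open>w'\<close> on
    \<open>S\<close>. Only the fulfilment of an until contained in \<open>y k\<close> needs more
    than local consistency.\<close>
  have "\<phi> \<in> y k \<longleftrightarrow> ltl_sat w' k \<phi>" if "\<phi> \<in> S" for \<phi> k
    using that
  proof (induction \<phi> arbitrary: k)
    case (Prop x)
    then show ?case using y_local[OF Prop(1)] by simp
  next
    case (Neg \<phi>)
    then have "\<phi> \<in> S" using S[OF Neg(2)] subformulas_self by auto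
    then show ?case using y_local[OF Neg(2), of k] y_local[of \<phi> k] Neg(1)[of k] by simp
  next
    case (Conj \<phi> \<psi>)
    then have "\<phi> \<in> S" "\<psi> \<in> S" using S[OF Conj(3)] subformulas_self[of \<phi>] subformulas_self[of \<psi>] by auto
    then show ?case using y_local[OF Conj(3), of k] y_local[of \<phi> k] y_local[of \<psi> k] Conj(1,2)[of k] by simp
  next
    case (Next \<phi>)
    then have "\<phi> \<in> S" using S[OF Next(2)] subformulas_self by auto
    then show ?case using y_local[OF Next(2), of k] Next(1)[of "Suc k"] by simp
  next
    case (Until \<phi> \<psi>)
    let ?u = "Until \<phi> \<psi>"
    have sub: "\<phi> \<in> S" "\<psi> \<in> S" using S[OF Until(3)] subformulas_self[of \<phi>] subformulas_self[of \<psi>] by auto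
    note IH = Until(1)[OF sub(1)] Until(2)[OF sub(2)]
    have unf: "?u \<in> y k \<longleftrightarrow> \<psi> \<in> y k \<or> \<phi> \<in> y k \<and> ?u \<in> y (Suc k)" for k
      using y_local[OF Until(3), of k] y_local[OF sub(1), of k] y_local[OF sub(2), of k] by simp
    show ?case
    proof
      assume "ltl_sat w' k ?u"
      then obtain j where j: "k \<le> j" "\<psi> \<in> y j" "\<forall>i. k \<le> i \<and> i < j \<longrightarrow> \<phi> \<in> y i"
        unfolding ltl_sat.simps IH[symmetric] by blast
      from j(1) show "?u \<in> y k"
      proof (induction k rule: inc_induct)
        case base
        show ?case using j(2) unf by blast
      next
        case (step n)
        then show ?case using j(3) unf[of n] by auto
      qed
    next
      assume u: "?u \<in> y k"
      show "ltl_sat w' k ?u"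
      proof (rule ccontr)
        assume neg: "\<not> ltl_sat w' k ?u"
        have inv: "?u \<in> y j \<and> \<not> ltl_sat w' j ?u" if "k \<le> j" for j
          using that
        proof (induction j rule: dec_induct)
          case base
          then show ?case using u neg by blast
        next
          case (step n)
          then show ?case using unf[of n] until_unfold[of w' n \<phi> \<psi>] IH by blast
        qed
        have no: "\<psi> \<notin> y j" if "k \<le> j" for j
          using inv[OF that] until_unfold[of w' j \<phi> \<psi>] IH by blast
        \<comment> \<open>An until postponed forever is still present at the cutting point
          \<open>c' k\<close>, hence true in \<open>w\<close> at \<open>c k\<close>. It is fulfilled
          in \<open>w\<close> in some block \<open>i \<ge> k\<close>, and equal visited sets put
          \<open>\<psi>\<close> into block \<open>i\<close> of \<open>w'\<close>, at a position not
          before \<open>k\<close>.\<close>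
        have "?u \<in> a k" using inv[of "c' k"] ya c'_ge by auto
        then obtain j where j: "c k \<le> j" "ltl_sat w j \<psi>"
          by (auto simp: a_def truth_def)
        obtain i where i: "c i \<le> j" "j < c (Suc i)"
          using cuts_block[OF c, of j] by blast
        have "k < Suc i"
          using j(1) i(2) c strict_mono_less[of c k "Suc i"] by (auto simp: cuts_def)
        have "\<psi> \<in> (\<Union>k\<in>{c i..<c (Suc i)}. truth S w k)"
          using i j(2) sub(2) by (auto simp: truth_def)
        then obtain l where l: "c' i \<le> l" "l < c' (Suc i)" "\<psi> \<in> foldr (bstep S) (seg w' l (c' (Suc i))) (a (Suc i))"
          unfolding a_visited by auto
        then have "\<psi> \<in> y l" using y_eq[of l "Suc i"] by simp
        moreover have "k \<le> l"
          using l(1) c'_ge[of k] c'_mono[of k i] \<open>k < Suc i\<close> by linarith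
        ultimately show False using no by blast
      qed
    qed
  qed
  then show "ltl_sat w' 0 \<chi>"
    using sat ya[of 0] c c' \<open>\<chi> \<in> S\<close> by (auto simp: a_def truth_def cuts_def)
qed (rule ltl_type_append)

section \<open>Size bounds by towers of exponentials\<close>

text \<open>With bounds of the form \<open>tower n\<close>, each construction only has to say by how
  much the height grows; projection adds one, since the power set bound for \<open>tower n\<close>
  is \<open>tower (Suc n)\<close>.\<close>

fun tower :: "nat \<Rightarrow> nat" where
  "tower 0 = 1"
| "tower (Suc n) = 2 ^ tower n"

lemma tower_ge: "n < tower n"
proof (induction n)
  case (Suc n)
  then show ?case using less_exp[of "tower n"] unfolding tower.simps by linarith
qed simp

lemma tower_mono: "m \<le> n \<Longrightarrow> tower m \<le> tower n"
proof (induction n rule: dec_induct)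
  case (step k)
  show ?case using order.trans[OF step.IH less_imp_le[OF less_exp]] by simp
qed simp

lemma double_le_exp: "2 * n \<le> (2::nat) ^ n"
proof (induction n)
  case (Suc n)
  then show ?case using less_exp[of n] by (cases n) auto
qed simp

text \<open>The product is at most \<open>2 ^ (2 * tower (m + n))\<close>, hence at most
  \<open>2 ^ 2 ^ tower (m + n)\<close>. This is the origin of the 2 added for a conjunction in
  \<open>fo_rank\<close>.\<close>

lemma tower_mult: "tower m * tower n \<le> tower (m + n + 2)"
proof -
  have le: "tower m \<le> tower (m + n)" "tower n \<le> tower (m + n)"
    by (auto intro: tower_mono)
  have "tower m * tower n \<le> 2 ^ tower m * 2 ^ tower n"
    by (intro mult_le_mono less_imp_le less_exp)
  also have "\<dots> = 2 ^ (tower m + tower n)" by (simp add: power_add)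
  also have "\<dots> \<le> 2 ^ (2 * tower (m + n))" using le by (intro power_increasing) auto
  also have "\<dots> \<le> 2 ^ 2 ^ tower (m + n)" by (intro power_increasing double_le_exp) auto
  finally show ?thesis by simp
qed

text \<open>With \<open>s\<close> subformulas there are \<open>(2 ^ s * 2 ^ s) ^ 2 ^ s\<close>
  possible types, at most a threefold exponential of \<open>s\<close>; hence the summand 3.\<close>

lemma recognizable_ltl: "recognizable (tower (ltl_size \<phi> + 3)) (\<lambda>w. ltl_sat w 0 \<phi>)"
proof (rule recognizableI)
  let ?S = "subformulas \<phi>"
  let ?T = "Pow ?S \<rightarrow>\<^sub>E Pow ?S \<times> Pow ?S"
  show "saturates (ltl_type ?S) (\<lambda>w. ltl_sat w 0 \<phi>)"
    by (rule ltl_type_saturates[OF subformulas_trans subformulas_self])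
  show "finite ?T" using card_subformulas[of \<phi>] by (intro finite_PiE) auto
  show "range (ltl_type ?S) \<subseteq> ?T"
    unfolding ltl_type_def
    by (intro image_subsetI restrict_PiE_iff[THEN iffD2]) (simp add: foldr_bstep_subset visited_subset)
  define s where "s = card ?S"
  have "card ?T = (2 ^ s * 2 ^ s) ^ 2 ^ s"
    using card_subformulas[of \<phi>] by (simp add: card_funcsetE card_Pow card_cartesian_product s_def)
  also have "\<dots> = 2 ^ (2 * s * 2 ^ s)"
    by (simp add: power_mult power_add[symmetric] mult_2)
  also have "\<dots> \<le> 2 ^ (2 ^ s * 2 ^ s)"
    by (intro power_increasing mult_le_mono1 double_le_exp) auto
  also have "\<dots> = 2 ^ 2 ^ (2 * s)"
    by (simp add: power_add mult_2)
  also have "\<dots> \<le> 2 ^ 2 ^ 2 ^ s"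
    by (intro power_increasing double_le_exp) auto
  also have "\<dots> \<le> 2 ^ 2 ^ 2 ^ tower (ltl_size \<phi>)"
  proof -
    have "s \<le> tower (ltl_size \<phi>)"
      using card_subformulas[of \<phi>] tower_ge[of "ltl_size \<phi>"] unfolding s_def by linarith
    then show ?thesis by (intro power_increasing) auto
  qed
  finally show "card ?T \<le> tower (ltl_size \<phi> + 3)"
    by (simp add: numeral_3_eq_3)
qed

section \<open>Evaluation on ultimately periodic words\<close>

fun qptl_rank :: "'p qptl \<Rightarrow> nat" where
  "qptl_rank (Matrix \<phi>) = ltl_size \<phi> + 3"
| "qptl_rank (Exists q \<psi>) = Suc (qptl_rank \<psi>)"
| "qptl_rank (Forall q \<psi>) = Suc (qptl_rank \<psi>)"

definition letter_update :: "'p \<Rightarrow> 'p set \<times> 'p set \<Rightarrow> 'p set" where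
  "letter_update q p = (fst p - {q}) \<union> (snd p \<inter> {q})"

lemma trace_update_letterwise: "trace_update t q x = (\<lambda>n. letter_update q (t n, x n))"
  by (simp add: trace_update_def letter_update_def)

lemma traces_range: "x \<in> traces A \<longleftrightarrow> range x \<subseteq> Pow A"
  by (auto simp: traces_def)

lemma tower_le_Suc: "tower n \<le> tower (Suc n)"
  by (rule tower_mono) simp

text \<open>A quantifier is a projection after the letterwise map that installs the chosen values of
  \<open>q\<close>; the universal one is the dual and costs the same exponential.\<close>

lemma recognizable_qptl: "recognizable (tower (qptl_rank \<phi>)) (\<lambda>t. qptl_sat t \<phi>)"
proof (induction \<phi>)
  case (Matrix \<phi>)
  then show ?case using recognizable_ltl[of \<phi>] by simp
next
  case (Exists q \<psi>)
  then show ?case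
    using recognizable_ex[OF recognizable_letterwise[OF Exists, of "letter_update q"], of "Pow {q}"]
    by (simp add: trace_update_letterwise traces_range Bex_def)
next
  case (Forall q \<psi>)
  then show ?case
    using recognizable_not[OF recognizable_ex[OF recognizable_not[OF recognizable_letterwise[OF Forall, of "letter_update q"]], of "Pow {q}"]]
    by (simp add: trace_update_letterwise traces_range Ball_def)
qed

text \<open>A list of length \<open>2 * L\<close> represents the word whose first \<open>L\<close> letters are the first half of the list, followed by
  the second half repeated forever.\<close>

definition unroll :: "'a \<Rightarrow> 'a list \<Rightarrow> nat \<Rightarrow> 'a" where
  "unroll d l n = (if n < length l div 2 then nth_default d l n
     else nth_default d l (length l div 2 + n mod (length l div 2)))"

lemma lasso_unroll:
  assumes "length l = 2 * L"
  shows "lasso L (unroll d l)"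
  unfolding lasso_def unroll_def using assms by simp

lemma unroll_map_upt:
  assumes w: "lasso L w" and L: "0 < L"
  shows "unroll d (map w [0..<2 * L]) = w"
proof (rule HOL.ext)
  fix n
  show "unroll d (map w [0..<2 * L]) n = w n"
  proof (cases "n < L")
    case True
    then show ?thesis by (simp add: unroll_def nth_default_def)
  next
    case False
    \<comment> \<open>Beyond \<open>L\<close> the lookup goes to \<open>L + n mod L\<close>, which
      differs from \<open>n\<close> by the multiple \<open>L * (n div L - 1)\<close> of the
      period.\<close>
    have "L * (n div L) + n mod L = n" by simp
    moreover have "0 < n div L" using False L by (simp add: div_greater_zero_iff)
    ultimately have n: "L + n mod L + L * (n div L - 1) = n"
      by (cases "n div L") auto
    have "n mod L < L" using L by simp
    then show ?thesis
      using False lasso_add_mult[OF w, of "L + n mod L" "n div L - 1"] unfolding n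
      by (simp add: unroll_def nth_default_def)
  qed
qed

text \<open>Slots of an environment that were never assigned thus denote a constant word, a lasso
  for every parameter.\<close>

lemma unroll_Nil [simp]: "unroll d [] n = d"
  by (simp add: unroll_def nth_default_def)

lemma unroll_in_set: "length l = 2 * L \<Longrightarrow> 0 < L \<Longrightarrow> unroll d l n \<in> set l"
  using mod_less_divisor[of L n] by (simp add: unroll_def nth_default_def)

text \<open>The map \<open>g\<close> separates letters from their representatives: Booleans stand
  for the subsets of \<open>{q}\<close>, lists for sets of propositions. Choosing representatives by
  \<open>h\<close> preserves periodicity because it acts on each letter separately.\<close>

lemma ex_lasso_iff:
  assumes L: "0 < L"
  shows "(\<exists>x. range x \<subseteq> g ` set A \<and> lasso L x \<and> P x) \<longleftrightarrow>
    (\<exists>l\<in>set (List.n_lists (2 * L) A). P (\<lambda>n. g (unroll d l n)))"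
proof
  assume "\<exists>x. range x \<subseteq> g ` set A \<and> lasso L x \<and> P x"
  then obtain x where x: "range x \<subseteq> g ` set A" "lasso L x" "P x" by blast
  define h where "h = inv_into (set A) g"
  have h: "g (h (x n)) = x n" "h (x n) \<in> set A" for n
    using x(1) unfolding h_def by (auto intro!: f_inv_into_f inv_into_into)
  let ?l = "map (\<lambda>n. h (x n)) [0..<2 * L]"
  have "lasso L (\<lambda>n. h (x n))" using x(2) by (simp add: lasso_def)
  then have "unroll d ?l = (\<lambda>n. h (x n))" by (rule unroll_map_upt[OF _ L])
  then have "P (\<lambda>n. g (unroll d ?l n))" using h(1) x(3) by simp
  moreover have "?l \<in> set (List.n_lists (2 * L) A)"
    using h(2) by (auto simp: set_n_lists)
  ultimately show "\<exists>l\<in>set (List.n_lists (2 * L) A). P (\<lambda>n. g (unroll d l n))" by blast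
next
  assume "\<exists>l\<in>set (List.n_lists (2 * L) A). P (\<lambda>n. g (unroll d l n))"
  then obtain l where l: "length l = 2 * L" "set l \<subseteq> set A" "P (\<lambda>n. g (unroll d l n))"
    by (auto simp: set_n_lists)
  have "lasso L (\<lambda>n. g (unroll d l n))"
    using lasso_unroll[OF l(1), of d] by (simp add: lasso_def)
  moreover have "range (\<lambda>n. g (unroll d l n)) \<subseteq> g ` set A"
    using unroll_in_set[OF l(1) L] l(2) by blast
  ultimately show "\<exists>x. range x \<subseteq> g ` set A \<and> lasso L x \<and> P x"
    using l(3) by blast
qed

text \<open>Letters are represented by lists rather than sets, since the evaluators must work on
  encodable data.\<close>

definition word :: "'p list list \<Rightarrow> 'p trace" where
  "word l n = set (unroll [] l n)"

lemma lasso_word: "length l = 2 * L \<Longrightarrow> lasso L (word l)"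
  using lasso_unroll[of l L "[]"] by (simp add: lasso_def word_def)

section \<open>Evaluation of LTL and QPTL on represented words\<close>

fun ltl_eval :: "'p list list \<Rightarrow> nat \<Rightarrow> 'p ltl \<Rightarrow> bool" where
  "ltl_eval l i (Prop a) \<longleftrightarrow> (\<exists>y\<in>set (unroll [] l i). y = a)"
| "ltl_eval l i (Neg \<phi>) \<longleftrightarrow> \<not> ltl_eval l i \<phi>"
| "ltl_eval l i (Conj \<phi> \<psi>) \<longleftrightarrow> ltl_eval l i \<phi> \<and> ltl_eval l i \<psi>"
| "ltl_eval l i (Next \<phi>) \<longleftrightarrow> ltl_eval l (Suc i) \<phi>"
| "ltl_eval l i (Until \<phi> \<psi>) \<longleftrightarrow>
     (\<exists>d\<in>set [0..<length l]. ltl_eval l (i + d) \<psi> \<and> (\<forall>k\<in>set [0..<d]. ltl_eval l (i + k) \<phi>))"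

lemma ltl_sat_shift: "ltl_sat (\<lambda>k. w (k + m)) i \<phi> \<longleftrightarrow> ltl_sat w (i + m) \<phi>"
proof (induction \<phi> arbitrary: i)
  case (Until \<phi> \<psi>)
  show ?case
  proof
    assume "ltl_sat (\<lambda>k. w (k + m)) i (Until \<phi> \<psi>)"
    then obtain j where j: "i \<le> j" "ltl_sat w (j + m) \<psi>" "\<forall>k. i \<le> k \<and> k < j \<longrightarrow> ltl_sat w (k + m) \<phi>"
      unfolding ltl_sat.simps Until by blast
    have "ltl_sat w k \<phi>" if "i + m \<le> k" "k < j + m" for k
      using j(3)[rule_format, of "k - m"] that by force
    then show "ltl_sat w (i + m) (Until \<phi> \<psi>)"
      unfolding ltl_sat.simps using j(1,2) by (intro exI[of _ "j + m"]) simp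
  next
    assume "ltl_sat w (i + m) (Until \<phi> \<psi>)"
    then obtain j where j: "i + m \<le> j" "ltl_sat w j \<psi>" "\<forall>k. i + m \<le> k \<and> k < j \<longrightarrow> ltl_sat w k \<phi>"
      unfolding ltl_sat.simps by blast
    then show "ltl_sat (\<lambda>k. w (k + m)) i (Until \<phi> \<psi>)"
      unfolding ltl_sat.simps Until by (intro exI[of _ "j - m"]) auto
  qed
qed auto

lemma lasso_ltl_sat:
  assumes "lasso L w"
  shows "lasso L (\<lambda>n. ltl_sat w n \<phi>)"
  unfolding lasso_def
proof (intro allI impI)
  fix n assume n: "L \<le> n"
  have "w (k + (n + L)) = w (k + n)" for k
    using assms[unfolded lasso_def, rule_format, of "k + n"] n by (simp add: add.assoc)
  then have "(\<lambda>k. w (k + (n + L))) = (\<lambda>k. w (k + n))" by simp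
  then show "ltl_sat w (n + L) \<phi> = ltl_sat w n \<phi>"
    using ltl_sat_shift[of w "n + L" 0 \<phi>] ltl_sat_shift[of w n 0 \<phi>] by simp
qed

text \<open>A window of length \<open>2 * L\<close> suffices for an until at any position
  \<open>i\<close>: if the least distance \<open>d\<close> to a position satisfying
  \<open>\<psi>\<close> were at least \<open>2 * L\<close>, then \<open>i + (d - L)\<close> would
  still lie in the periodic part and satisfy \<open>\<psi>\<close> too.\<close>

lemma ltl_eval_correct:
  assumes l: "length l = 2 * L" and L: "0 < L"
  shows "ltl_eval l i \<phi> \<longleftrightarrow> ltl_sat (word l) i \<phi>"
proof (induction \<phi> arbitrary: i)
  case (Until \<phi> \<psi>)
  let ?s = "ltl_sat (word l)"
  have "ltl_eval l i (Until \<phi> \<psi>) \<longleftrightarrow> (\<exists>d<2 * L. ?s (i + d) \<psi> \<and> (\<forall>k<d. ?s (i + k) \<phi>))"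
    unfolding ltl_eval.simps Until l by auto
  also have "\<dots> \<longleftrightarrow> ?s i (Until \<phi> \<psi>)"
  proof
    assume "\<exists>d<2 * L. ?s (i + d) \<psi> \<and> (\<forall>k<d. ?s (i + k) \<phi>)"
    then obtain d where d: "?s (i + d) \<psi>" "\<forall>k<d. ?s (i + k) \<phi>" by blast
    have "?s k \<phi>" if "i \<le> k" "k < i + d" for k
      using d(2)[rule_format, of "k - i"] that by simp
    then show "?s i (Until \<phi> \<psi>)"
      unfolding ltl_sat.simps using d(1) by (intro exI[of _ "i + d"]) simp
  next
    assume "?s i (Until \<phi> \<psi>)"
    then obtain j where j: "i \<le> j" "?s j \<psi>" "\<forall>k. i \<le> k \<and> k < j \<longrightarrow> ?s k \<phi>"
      unfolding ltl_sat.simps by blast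
    define d where "d = (LEAST d. ?s (i + d) \<psi>)"
    have ex: "?s (i + (j - i)) \<psi>" using j by simp
    have d: "?s (i + d) \<psi>" unfolding d_def by (rule LeastI[of "\<lambda>d. ?s (i + d) \<psi>", OF ex])
    have least: "d \<le> e" if "?s (i + e) \<psi>" for e
      unfolding d_def by (rule Least_le[of "\<lambda>d. ?s (i + d) \<psi>", OF that])
    have "d \<le> j - i" by (rule least[OF ex])
    then have "\<forall>k<d. ?s (i + k) \<phi>" using j(3) by auto
    moreover have "d < 2 * L"
    proof (rule ccontr)
      assume "\<not> d < 2 * L"
      then have "L \<le> i + (d - L)" "i + d = i + (d - L) + L" by auto
      then have "?s (i + (d - L)) \<psi>"
        using lasso_ltl_sat[OF lasso_word[OF l], of \<psi>] d unfolding lasso_def by metis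
      then have "d \<le> d - L" by (rule least)
      then show False using \<open>\<not> d < 2 * L\<close> L by simp
    qed
    ultimately show "\<exists>d<2 * L. ?s (i + d) \<psi> \<and> (\<forall>k<d. ?s (i + k) \<phi>)" using d by blast
  qed
  finally show ?case .
qed (auto simp: word_def)

text \<open>The old word is listed anew on \<open>length l * F\<close> positions, to match the
  length of the list \<open>x\<close> of truth values for \<open>q\<close>.\<close>

definition list_update_prop :: "nat \<Rightarrow> 'p list list \<Rightarrow> 'p \<Rightarrow> bool list \<Rightarrow> 'p list list" where
  "list_update_prop F l q x =
     map (\<lambda>n. if unroll False x n then q # unroll [] l n else filter (\<lambda>a. \<not> a = q) (unroll [] l n))
       [0..<length l * F]"

text \<open>The parameter \<open>F\<close> is meant to be \<open>B!\<close>. It stays fixed during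
  the recursion, while each quantifier multiplies the length of the list by
  \<open>F\<close>.\<close>

fun qptl_eval :: "nat \<Rightarrow> 'p list list \<Rightarrow> 'p qptl \<Rightarrow> bool" where
  "qptl_eval F l (Matrix \<phi>) \<longleftrightarrow> ltl_eval l 0 \<phi>"
| "qptl_eval F l (Exists q \<psi>) \<longleftrightarrow>
     (\<exists>x\<in>set (List.n_lists (length l * F) [False, True]). qptl_eval F (list_update_prop F l q x) \<psi>)"
| "qptl_eval F l (Forall q \<psi>) \<longleftrightarrow>
     (\<forall>x\<in>set (List.n_lists (length l * F) [False, True]). qptl_eval F (list_update_prop F l q x) \<psi>)"

lemma word_list_update_prop:
  assumes l: "length l = 2 * L" and L: "0 < L" and F: "0 < F" and x: "length x = 2 * (L * F)"
  shows "word (list_update_prop F l q x) =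
    trace_update (word l) q (\<lambda>n. if unroll False x n then {q} else {})"
proof -
  let ?w = "\<lambda>n. if unroll False x n then q # unroll [] l n else filter (\<lambda>a. \<not> a = q) (unroll [] l n)"
  have "lasso (L * F) (unroll [] l)" "lasso (L * F) (unroll False x)"
    using lasso_mult[OF lasso_unroll[OF l] F] lasso_unroll[OF x] by auto
  then have "lasso (L * F) ?w"
    by (simp add: lasso_def)
  then have "unroll [] (list_update_prop F l q x) = ?w"
    unfolding list_update_prop_def using unroll_map_upt[of "L * F" ?w "[]"] L F l by (simp add: mult.assoc)
  then show ?thesis
    by (auto simp: fun_eq_iff word_def trace_update_def)
qed

text \<open>This is where quantification over infinite words becomes a finite search; it serves
  quantified propositions and quantified worlds alike.\<close>

lemma ex_lasso_world:
  fixes X :: "(nat \<Rightarrow> 'a \<times> 'b) \<Rightarrow> bool"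
  assumes X: "recognizable N X" and NB: "N \<le> B" and L: "0 < L" "lasso L w" and A: "A' = g ` set A"
  shows "(\<exists>x. range x \<subseteq> A' \<and> X (\<lambda>n. (w n, x n))) \<longleftrightarrow>
    (\<exists>l\<in>set (List.n_lists (2 * (L * fact B)) A). X (\<lambda>n. (w n, g (unroll d l n))))"
proof -
  have "(\<exists>x. range x \<subseteq> A' \<and> X (\<lambda>n. (w n, x n))) \<longleftrightarrow>
      (\<exists>x. range x \<subseteq> A' \<and> lasso (L * fact B) x \<and> X (\<lambda>n. (w n, x n)))"
    using lasso_witness[OF X NB L] by blast
  also have "\<dots> \<longleftrightarrow> (\<exists>l\<in>set (List.n_lists (2 * (L * fact B)) A). X (\<lambda>n. (w n, g (unroll d l n))))"
    unfolding A by (rule ex_lasso_iff) (use L in simp)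
  finally show ?thesis .
qed

lemma qptl_eval_correct:
  assumes "length l = 2 * L" "0 < L" "tower (qptl_rank \<phi>) \<le> B"
  shows "qptl_eval (fact B) l \<phi> \<longleftrightarrow> qptl_sat (word l) \<phi>"
  using assms
proof (induction \<phi> arbitrary: l L)
  case (Matrix \<phi>)
  then show ?case using ltl_eval_correct[of l L] by simp
next
  case (Exists q \<psi>)
  let ?g = "\<lambda>b. if b then {q} else {}"
  have B: "tower (qptl_rank \<psi>) \<le> B"
    using order.trans[OF tower_le_Suc] Exists.prems(3) by simp
  have A: "Pow {q} = ?g ` set [False, True]" by auto
  have "qptl_sat (word l) (Exists q \<psi>) \<longleftrightarrow>
      (\<exists>x. range x \<subseteq> Pow {q} \<and> qptl_sat (\<lambda>n. letter_update q (word l n, x n)) \<psi>)"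
    by (simp add: trace_update_letterwise traces_range Bex_def)
  also have "\<dots> \<longleftrightarrow> (\<exists>x\<in>set (List.n_lists (2 * (L * fact B)) [False, True]).
      qptl_sat (\<lambda>n. letter_update q (word l n, ?g (unroll False x n))) \<psi>)"
    using ex_lasso_world[OF recognizable_letterwise[OF recognizable_qptl[of \<psi>], of "letter_update q"] B
      Exists.prems(2) lasso_word[OF Exists.prems(1)] A, of False] by simp
  also have "\<dots> \<longleftrightarrow> (\<exists>x\<in>set (List.n_lists (2 * (L * fact B)) [False, True]).
      qptl_eval (fact B) (list_update_prop (fact B) l q x) \<psi>)"
  proof (rule bex_cong[OF refl])
    fix x :: "bool list"
    assume "x \<in> set (List.n_lists (2 * (L * fact B)) [False, True])"
    then have x: "length x = 2 * (L * fact B)" by (simp add: set_n_lists)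
    show "qptl_sat (\<lambda>n. letter_update q (word l n, ?g (unroll False x n))) \<psi> \<longleftrightarrow>
        qptl_eval (fact B) (list_update_prop (fact B) l q x) \<psi>"
      using Exists.IH[of "list_update_prop (fact B) l q x" "L * fact B"] B Exists.prems
        word_list_update_prop[OF Exists.prems(1,2) _ x, of q]
      by (simp add: list_update_prop_def[of _ l] trace_update_letterwise mult.assoc)
  qed
  finally show ?case using Exists.prems(1) by (simp add: mult.assoc)
next
  case (Forall q \<psi>)
  let ?g = "\<lambda>b. if b then {q} else {}"
  have B: "tower (qptl_rank \<psi>) \<le> B"
    using order.trans[OF tower_le_Suc] Forall.prems(3) by simp
  have A: "Pow {q} = ?g ` set [False, True]" by auto
  have "qptl_sat (word l) (Forall q \<psi>) \<longleftrightarrow>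
      \<not> (\<exists>x. range x \<subseteq> Pow {q} \<and> \<not> qptl_sat (\<lambda>n. letter_update q (word l n, x n)) \<psi>)"
    by (simp add: trace_update_letterwise traces_range Ball_def)
  also have "\<dots> \<longleftrightarrow> \<not> (\<exists>x\<in>set (List.n_lists (2 * (L * fact B)) [False, True]).
      \<not> qptl_sat (\<lambda>n. letter_update q (word l n, ?g (unroll False x n))) \<psi>)"
    using ex_lasso_world[OF recognizable_not[OF recognizable_letterwise[OF recognizable_qptl[of \<psi>], of "letter_update q"]] B
      Forall.prems(2) lasso_word[OF Forall.prems(1)] A, of False] by simp
  also have "\<dots> \<longleftrightarrow> (\<forall>x\<in>set (List.n_lists (2 * (L * fact B)) [False, True]).
      qptl_sat (\<lambda>n. letter_update q (word l n, ?g (unroll False x n))) \<psi>)"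
    by blast
  also have "\<dots> \<longleftrightarrow> (\<forall>x\<in>set (List.n_lists (2 * (L * fact B)) [False, True]).
      qptl_eval (fact B) (list_update_prop (fact B) l q x) \<psi>)"
  proof (rule ball_cong[OF refl])
    fix x :: "bool list"
    assume "x \<in> set (List.n_lists (2 * (L * fact B)) [False, True])"
    then have x: "length x = 2 * (L * fact B)" by (simp add: set_n_lists)
    show "qptl_sat (\<lambda>n. letter_update q (word l n, ?g (unroll False x n))) \<psi> \<longleftrightarrow>
        qptl_eval (fact B) (list_update_prop (fact B) l q x) \<psi>"
      using Forall.IH[of "list_update_prop (fact B) l q x" "L * fact B"] B Forall.prems
        word_list_update_prop[OF Forall.prems(1,2) _ x, of q]
      by (simp add: list_update_prop_def[of _ l] trace_update_letterwise mult.assoc)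
  qed
  finally show ?case using Forall.prems(1) by (simp add: mult.assoc)
qed

section \<open>First-order formulas over worlds\<close>

text \<open>Worlds are the values of numbered slots. The quantifier ranges over all traces, the
  universe being a relativization; equality of worlds serves to say that one world is added to an
  antecedent.\<close>

datatype fo =
    FQ "nat qptl" nat
  | FR "(nat \<times> nat) qptl" nat nat nat
  | FE nat nat
  | FNot fo
  | FAnd fo fo
  | FEx nat fo

fun fo_sat :: "nat set \<Rightarrow> (nat \<Rightarrow> nat trace) \<Rightarrow> fo \<Rightarrow> bool" where
  "fo_sat A \<rho> (FQ \<phi> i) \<longleftrightarrow> qptl_sat (\<rho> i) \<phi>"
| "fo_sat A \<rho> (FR \<phi> i j k) \<longleftrightarrow> qptl_sat (trace_merge (\<rho> i) (\<rho> j) (\<rho> k)) \<phi>"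
| "fo_sat A \<rho> (FE i j) \<longleftrightarrow> \<rho> i = \<rho> j"
| "fo_sat A \<rho> (FNot f) \<longleftrightarrow> \<not> fo_sat A \<rho> f"
| "fo_sat A \<rho> (FAnd f g) \<longleftrightarrow> fo_sat A \<rho> f \<and> fo_sat A \<rho> g"
| "fo_sat A \<rho> (FEx i f) \<longleftrightarrow> (\<exists>x\<in>traces A. fo_sat A (\<rho>(i := x)) f)"

fun fo_rank :: "fo \<Rightarrow> nat" where
  "fo_rank (FQ \<phi> i) = qptl_rank \<phi>"
| "fo_rank (FR \<phi> i j k) = qptl_rank \<phi>"
| "fo_rank (FE i j) = 1"
| "fo_rank (FNot f) = fo_rank f"
| "fo_rank (FAnd f g) = fo_rank f + fo_rank g + 2"
| "fo_rank (FEx i f) = Suc (fo_rank f)"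

lemma recognizable_eq: "recognizable 2 (\<lambda>w. (\<lambda>n. w n i) = (\<lambda>n. w n j))"
proof (rule recognizableI)
  let ?f = "\<lambda>u. \<forall>c\<in>set u. c i = c j"
  show "saturates ?f (\<lambda>w. (\<lambda>n. w n i) = (\<lambda>n. w n j))"
  proof (rule saturatesI)
    fix w w' c c'
    assume c: "cuts c'" and eq: "\<And>i. ?f (seg w (c i) (c (Suc i))) = ?f (seg w' (c' i) (c' (Suc i)))"
      and w: "(\<lambda>n. w n i) = (\<lambda>n. w n j)"
    have "w' n i = w' n j" for n
    proof -
      obtain k where k: "c' k \<le> n" "n < c' (Suc k)" using cuts_block[OF c, of n] by blast
      have "?f (seg w (c k) (c (Suc k)))" using w by (auto simp: seg_def fun_eq_iff)
      then have "?f (seg w' (c' k) (c' (Suc k)))" by (simp only: eq)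
      then show ?thesis using k by (auto simp: seg_def)
    qed
    then show "(\<lambda>n. w' n i) = (\<lambda>n. w' n j)" by blast
  qed auto
  show "card (UNIV :: bool set) \<le> 2" by simp
qed auto

definition fo_assign :: "nat \<Rightarrow> (nat \<Rightarrow> 'a) \<times> 'a \<Rightarrow> nat \<Rightarrow> 'a" where
  "fo_assign i p = (fst p)(i := snd p)"

lemma fo_assign_word: "(\<lambda>k n. fo_assign i (w n, x n) k) = (\<lambda>k n. w n k)(i := x)"
  by (auto simp: fo_assign_def fun_eq_iff)

text \<open>An assignment of worlds to slots is read as a single word whose letters are functions
  from slots to sets of propositions. That this alphabet is infinite does no harm, as only the
  number of types is bounded.\<close>

lemma recognizable_fo: "recognizable (tower (fo_rank f)) (\<lambda>w. fo_sat A (\<lambda>i n. w n i) f)"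
proof (induction f)
  case (FQ \<phi> i)
  then show ?case using recognizable_letterwise[OF recognizable_qptl[of \<phi>], of "\<lambda>c. c i"] by simp
next
  case (FR \<phi> i j k)
  then show ?case
    using recognizable_letterwise[OF recognizable_qptl[of \<phi>], of "\<lambda>c. c i \<times> {1} \<union> c j \<times> {2} \<union> c k \<times> {3}"]
    by (simp add: trace_merge_def)
next
  case (FE i j)
  then show ?case using recognizable_eq[of i j] by simp
next
  case (FNot f)
  then show ?case using recognizable_not by auto
next
  case (FAnd f g)
  then show ?case
    using recognizable_mono[OF recognizable_conj[OF FAnd] tower_mult] by simp
next
  case (FEx i f)
  then show ?case
    using recognizable_ex[OF recognizable_letterwise[OF FEx, of "fo_assign i"], of "Pow A"]
    by (simp add: traces_range Bex_def fo_assign_word)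
qed

text \<open>The new length covers both the old slots and slot \<open>k\<close>; gaps are filled with
  the default.\<close>

definition env_update :: "'a \<Rightarrow> 'a list \<Rightarrow> nat \<Rightarrow> 'a \<Rightarrow> 'a list" where
  "env_update d env k x = map (\<lambda>j. if j = k then x else nth_default d env j) [0..<length env + Suc k]"

lemma nth_env_update: "nth_default d (env_update d env k x) j = (if j = k then x else nth_default d env j)"
  by (auto simp: env_update_def nth_default_def nth_append)

definition merge_letters :: "nat list \<Rightarrow> nat list \<Rightarrow> nat list \<Rightarrow> (nat \<times> nat) list" where
  "merge_letters c1 c2 c3 = map (\<lambda>a. (a, 1)) c1 @ map (\<lambda>a. (a, 2)) c2 @ map (\<lambda>a. (a, 3)) c3"

abbreviation env_letter :: "'a list list list \<Rightarrow> nat \<Rightarrow> nat \<Rightarrow> 'a list" where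
  "env_letter env i n \<equiv> unroll [] (nth_default [] env i) n"

text \<open>All slots denote lassos for the common parameter \<open>L\<close>, although their lists
  may stem from smaller ones; the atoms therefore list their words anew on \<open>2 * L\<close>
  positions.\<close>

fun fo_eval :: "nat \<Rightarrow> nat list list \<Rightarrow> nat \<Rightarrow> nat list list list \<Rightarrow> fo \<Rightarrow> bool" where
  "fo_eval F As L env (FQ \<phi> i) \<longleftrightarrow> qptl_eval F (map (\<lambda>n. env_letter env i n) [0..<2 * L]) \<phi>"
| "fo_eval F As L env (FR \<phi> i j k) \<longleftrightarrow>
     qptl_eval F (map (\<lambda>n. merge_letters (env_letter env i n) (env_letter env j n) (env_letter env k n))
       [0..<2 * L]) \<phi>"
| "fo_eval F As L env (FE i j) \<longleftrightarrow>
     (\<forall>n\<in>set [0..<2 * L]. (\<forall>a\<in>set (env_letter env i n). \<exists>b\<in>set (env_letter env j n). b = a) \<and>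
        (\<forall>a\<in>set (env_letter env j n). \<exists>b\<in>set (env_letter env i n). b = a))"
| "fo_eval F As L env (FNot f) \<longleftrightarrow> \<not> fo_eval F As L env f"
| "fo_eval F As L env (FAnd f g) \<longleftrightarrow> fo_eval F As L env f \<and> fo_eval F As L env g"
| "fo_eval F As L env (FEx k f) \<longleftrightarrow>
     (\<exists>x\<in>set (List.n_lists (2 * (L * F)) As). fo_eval F As (L * F) (env_update [] env k x) f)"

lemma fo_eval_correct:
  assumes "tower (fo_rank f) \<le> B" "0 < L" "\<And>i. lasso L (unroll [] (nth_default [] env i))"
    "Pow A = set ` set As"
  shows "fo_eval (fact B) As L env f \<longleftrightarrow> fo_sat A (\<lambda>i. word (nth_default [] env i)) f"
  using assms
proof (induction f arbitrary: L env)
  case (FQ \<phi> i)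
  then show ?case
    using qptl_eval_correct[of "map (env_letter env i) [0..<2 * L]" L \<phi> B] unroll_map_upt[OF FQ(3,2), of "[]" i]
    by (simp add: word_def[abs_def])
next
  case (FR \<phi> i j k)
  let ?w = "\<lambda>n. merge_letters (env_letter env i n) (env_letter env j n) (env_letter env k n)"
  have "lasso L ?w" using FR(3) by (simp add: lasso_def)
  then have "word (map ?w [0..<2 * L]) = trace_merge (word (nth_default [] env i)) (word (nth_default [] env j)) (word (nth_default [] env k))"
    using unroll_map_upt[OF _ FR(2), of ?w "[]"]
    by (auto simp: word_def[abs_def] trace_merge_def merge_letters_def fun_eq_iff)
  then show ?case
    using qptl_eval_correct[of "map ?w [0..<2 * L]" L \<phi> B] FR by simp
next
  case (FE i j)
  let ?u = "\<lambda>k. word (nth_default [] env k)"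
  have las: "lasso L (?u k)" for k using FE(3)[of k] by (simp add: lasso_def word_def)
  have "fo_eval (fact B) As L env (FE i j) \<longleftrightarrow> (\<forall>n<2 * L. ?u i n = ?u j n)"
    by (auto simp: word_def)
  also have "\<dots> \<longleftrightarrow> ?u i = ?u j"
  proof
    assume "\<forall>n<2 * L. ?u i n = ?u j n"
    then have "map (?u i) [0..<2 * L] = map (?u j) [0..<2 * L]" by simp
    then show "?u i = ?u j" using unroll_map_upt[OF las FE(2), of "{}"] by metis
  qed simp
  finally show ?case by simp
next
  case (FNot f)
  then show ?case by simp
next
  case (FAnd f g)
  have "tower (fo_rank f) \<le> tower (fo_rank (FAnd f g))" "tower (fo_rank g) \<le> tower (fo_rank (FAnd f g))"
    by (intro tower_mono; simp)+
  then have "tower (fo_rank f) \<le> B" "tower (fo_rank g) \<le> B"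
    using FAnd.prems(1) by linarith+
  then show ?case using FAnd by simp
next
  case (FEx k f)
  have B: "tower (fo_rank f) \<le> B"
    using order.trans[OF tower_le_Suc] FEx.prems(1) by simp
  \<comment> \<open>All slots together form one word over function letters, again a lasso for
    \<open>L\<close>, so \<open>ex_lasso_world\<close> applies with the whole environment as its
    parameter.\<close>
  let ?w = "\<lambda>n i. word (nth_default [] env i) n"
  have las: "lasso L ?w" using FEx.prems(3) by (simp add: lasso_def word_def fun_eq_iff)
  have "fo_sat A (\<lambda>i. word (nth_default [] env i)) (FEx k f) \<longleftrightarrow>
      (\<exists>x. range x \<subseteq> Pow A \<and> fo_sat A (\<lambda>i n. fo_assign k (?w n, x n) i) f)"
    by (simp add: traces_range Bex_def fo_assign_word)
  also have "\<dots> \<longleftrightarrow> (\<exists>x\<in>set (List.n_lists (2 * (L * fact B)) As).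
      fo_sat A (\<lambda>i n. fo_assign k (?w n, set (unroll [] x n)) i) f)"
    using ex_lasso_world[OF recognizable_letterwise[OF recognizable_fo[of f A], of "fo_assign k"] B
      FEx.prems(2) las FEx.prems(4), of "[]"] by simp
  also have "\<dots> \<longleftrightarrow> (\<exists>x\<in>set (List.n_lists (2 * (L * fact B)) As).
      fo_eval (fact B) As (L * fact B) (env_update [] env k x) f)"
  proof (rule bex_cong[OF refl])
    fix x
    assume "x \<in> set (List.n_lists (2 * (L * fact B)) As)"
    then have x: "length x = 2 * (L * fact B)" by (simp add: set_n_lists)
    have "lasso (L * fact B) (unroll [] (nth_default [] (env_update [] env k x) i))" for i
      using lasso_unroll[OF x] lasso_mult[OF FEx.prems(3)] by (simp add: nth_env_update)
    then have "fo_eval (fact B) As (L * fact B) (env_update [] env k x) f \<longleftrightarrow>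
        fo_sat A (\<lambda>i. word (nth_default [] (env_update [] env k x) i)) f"
      using FEx.IH[OF B _ _ FEx.prems(4), of "L * fact B" "env_update [] env k x"] FEx.prems(2) by simp
    moreover have "(\<lambda>i. word (nth_default [] (env_update [] env k x) i)) = (\<lambda>i n. fo_assign k (?w n, set (unroll [] x n)) i)"
      by (auto simp: nth_env_update fo_assign_def word_def fun_eq_iff)
    ultimately show "fo_sat A (\<lambda>i n. fo_assign k (?w n, set (unroll [] x n)) i) f \<longleftrightarrow>
        fo_eval (fact B) As (L * fact B) (env_update [] env k x) f" by simp
  qed
  finally show ?case by simp
qed

section \<open>Reduction of counterfactuals to first-order quantification over worlds\<close>

text \<open>If the relevant witness for \<open>P'\<close> lies outside \<open>P\<close>, it can be
  added itself; if it lies in \<open>P\<close>, it survives the addition of any world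
  \<open>V\<close> of \<open>P'\<close>. The operators differ in how the worlds of \<open>P\<close>
  keep their old witnesses.\<close>

lemma cf_holds_insert:
  assumes refl: "reflp_on U le" and trans: "transp_on U le"
    and P: "cf_holds U le c P Q" and P': "cf_holds U le c P' Q"
    and sub: "\<forall>V\<in>U. V \<in> P \<longrightarrow> V \<in> P'" and ex: "\<exists>V\<in>U. V \<in> P' \<and> V \<notin> P"
  shows "\<exists>V\<in>U. V \<notin> P \<and> cf_holds U le c (insert V P) Q"
proof -
  obtain V where V: "V \<in> U" "V \<in> P'" "V \<notin> P" using ex by blast
  have r: "le x x" if "x \<in> U" for x using refl that by (auto simp: reflp_on_def)
  have t: "le x z" if "le x y" "le y z" "x \<in> U" "y \<in> U" "z \<in> U" for x y z
    using trans that by (auto dest: transp_onD)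
  show ?thesis
  proof (cases c)
    case Would
    then obtain W1 where W1: "W1 \<in> U" "W1 \<in> P'" "\<forall>W2\<in>U. le W2 W1 \<longrightarrow> W2 \<in> P' \<longrightarrow> W2 \<in> Q"
      using P' V by auto
    show ?thesis
    proof (cases "W1 \<in> P")
      case True
      have "cf_holds U le c (insert V P) Q"
        unfolding Would cf_holds.simps using W1 True V sub by blast
      then show ?thesis using V by blast
    next
      case False
      have "cf_holds U le c (insert W1 P) Q"
        unfolding Would cf_holds.simps using W1 sub by blast
      then show ?thesis using W1 False by blast
    qed
  next
    case Might
    then obtain V2 where V2: "V2 \<in> U" "le V2 V" "V2 \<in> P'" "V2 \<in> Q"
      using P' V by auto
    have PP: "\<forall>W1\<in>U. W1 \<in> P \<longrightarrow> (\<exists>W2\<in>U. le W2 W1 \<and> W2 \<in> P \<and> W2 \<in> Q)"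
      using P Might by simp
    show ?thesis
    proof (cases "V2 \<in> P")
      case True
      have "cf_holds U le c (insert V P) Q"
        unfolding Might cf_holds.simps using V V2 True PP by blast
      then show ?thesis using V by blast
    next
      case False
      have "cf_holds U le c (insert V2 P) Q"
        unfolding Might cf_holds.simps using V2 PP r[of V2] by blast
      then show ?thesis using V2 False by blast
    qed
  next
    case UnivWould
    then obtain W2 where W2: "W2 \<in> U" "le W2 V" "W2 \<in> P'" "\<forall>W3\<in>U. le W3 W2 \<longrightarrow> W3 \<in> P' \<longrightarrow> W3 \<in> Q"
      using P' V by auto
    have PP: "\<exists>W2\<in>U. le W2 W1 \<and> W2 \<in> P \<and> (\<forall>W3\<in>U. le W3 W2 \<longrightarrow> W3 \<in> P \<longrightarrow> W3 \<in> Q)"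
      if "W1 \<in> U" "W1 \<in> P" for W1
      using P UnivWould that by auto
    show ?thesis
    proof (cases "W2 \<in> P")
      case True
      have "\<exists>Y\<in>U. le Y X \<and> Y \<in> insert V P \<and> (\<forall>Z\<in>U. le Z Y \<longrightarrow> Z \<in> insert V P \<longrightarrow> Z \<in> Q)"
        if X: "X \<in> U" "X \<in> insert V P" for X
      proof (cases "le W2 X")
        case True
        then show ?thesis using W2 \<open>W2 \<in> P\<close> V sub by blast
      next
        case False
        then have "X \<in> P" using X W2 by blast
        then obtain Y where Y: "Y \<in> U" "le Y X" "Y \<in> P" "\<forall>Z\<in>U. le Z Y \<longrightarrow> Z \<in> P \<longrightarrow> Z \<in> Q"
          using PP X by blast
        \<comment> \<open>If \<open>V\<close> were below \<open>Y\<close>, then \<open>W2\<close>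
          would be below \<open>X\<close> by transitivity through \<open>V\<close> and
          \<open>Y\<close>. So the new world does not lie below the old witness
          \<open>Y\<close>.\<close>
        have "\<not> le V Y"
        proof
          assume "le V Y"
          then have "le W2 X" using W2 V X Y t[of W2 V Y] t[of W2 Y X] by blast
          then show False using False by blast
        qed
        then show ?thesis using Y by blast
      qed
      then have "cf_holds U le c (insert V P) Q"
        unfolding UnivWould cf_holds.simps by blast
      then show ?thesis using V by blast
    next
      case False
      have Q2: "W2 \<in> Q" using W2 r by blast
      have "\<exists>Y\<in>U. le Y X \<and> Y \<in> insert W2 P \<and> (\<forall>Z\<in>U. le Z Y \<longrightarrow> Z \<in> insert W2 P \<longrightarrow> Z \<in> Q)"
        if X: "X \<in> U" "X \<in> insert W2 P" for X
      proof (cases "X = W2")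
        case True
        then show ?thesis using W2 r[of W2] sub by blast
      next
        case False
        then obtain Y where "Y \<in> U" "le Y X" "Y \<in> P" "\<forall>Z\<in>U. le Z Y \<longrightarrow> Z \<in> P \<longrightarrow> Z \<in> Q"
          using PP X by blast
        then show ?thesis using Q2 by blast
      qed
      then have "cf_holds U le c (insert W2 P) Q"
        unfolding UnivWould cf_holds.simps by blast
      then show ?thesis using W2 False by blast
    qed
  next
    case ExMight
    obtain W0 where W0: "W0 \<in> U" "W0 \<in> P"
      "\<forall>W2\<in>U. le W2 W0 \<and> W2 \<in> P \<longrightarrow> (\<exists>W3\<in>U. le W3 W2 \<and> W3 \<in> P \<and> W3 \<in> Q)"
      using P ExMight by auto
    obtain W1 where W1: "W1 \<in> U" "W1 \<in> P'"
      "\<forall>W2\<in>U. le W2 W1 \<and> W2 \<in> P' \<longrightarrow> (\<exists>W3\<in>U. le W3 W2 \<and> W3 \<in> P' \<and> W3 \<in> Q)"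
      using P' ExMight by auto
    show ?thesis
    \<comment> \<open>An added world in \<open>Q\<close> answers for itself by reflexivity and
      leaves \<open>W0\<close> a witness. If there is none, \<open>P'\<close> and \<open>Q\<close>
      meet within \<open>U\<close> only inside \<open>P\<close>, so all answers required by
      \<open>W1\<close> are already in \<open>P\<close>.\<close>
    proof (cases "\<exists>X\<in>U. X \<in> P' \<and> X \<in> Q \<and> X \<notin> P")
      case True
      then obtain X where X: "X \<in> U" "X \<in> Q" "X \<notin> P" by blast
      have "cf_holds U le c (insert X P) Q"
        unfolding ExMight cf_holds.simps using W0 X r[of X] by blast
      then show ?thesis using X by blast
    next
      case False
      define X where "X = (if W1 \<in> P then V else W1)"
      have X: "X \<in> U" "X \<in> P'" "X \<notin> P" "W1 \<in> insert X P"
        using V W1 by (auto simp: X_def)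
      have "\<exists>W3\<in>U. le W3 W2 \<and> W3 \<in> insert X P \<and> W3 \<in> Q" if "W2 \<in> U" "le W2 W1" "W2 \<in> insert X P" for W2
        using W1(3) that False sub X by blast
      then have "cf_holds U le c (insert X P) Q"
        unfolding ExMight cf_holds.simps using W1(1) X(4) by blast
      then show ?thesis using X by blast
    qed
  qed
qed

text \<open>This removes the only quantifier of the counterfactual semantics that does not range
  over worlds. Left to right, \<open>insert V P\<close> is itself a candidate for
  \<open>P'\<close>.\<close>

lemma cf_min_holds_iff:
  assumes "reflp_on U le" "transp_on U le"
  shows "cf_min_holds U le c P Q \<longleftrightarrow>
    cf_holds U le c P Q \<and> \<not> (\<exists>V\<in>U. V \<notin> P \<and> cf_holds U le c (insert V P) Q)"
proof
  assume min: "cf_min_holds U le c P Q"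
  have "\<not> cf_holds U le c (insert V P) Q" if "V \<in> U" "V \<notin> P" for V
    using min that unfolding cf_min_holds_def by blast
  then show "cf_holds U le c P Q \<and> \<not> (\<exists>V\<in>U. V \<notin> P \<and> cf_holds U le c (insert V P) Q)"
    using min unfolding cf_min_holds_def by blast
next
  assume "cf_holds U le c P Q \<and> \<not> (\<exists>V\<in>U. V \<notin> P \<and> cf_holds U le c (insert V P) Q)"
  then show "cf_min_holds U le c P Q"
    using cf_holds_insert[OF assms, of c P Q] unfolding cf_min_holds_def by blast
qed

section \<open>Translation of counterfactual formulas\<close>

definition FOr :: "fo \<Rightarrow> fo \<Rightarrow> fo" where
  "FOr f g = FNot (FAnd (FNot f) (FNot g))"

definition FImp :: "fo \<Rightarrow> fo \<Rightarrow> fo" where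
  "FImp f g = FNot (FAnd f (FNot g))"

definition FExU :: "nat qptl \<Rightarrow> nat \<Rightarrow> fo \<Rightarrow> fo" where
  "FExU \<phi>U k f = FEx k (FAnd (FQ \<phi>U k) f)"

definition FAllU :: "nat qptl \<Rightarrow> nat \<Rightarrow> fo \<Rightarrow> fo" where
  "FAllU \<phi>U k f = FNot (FExU \<phi>U k (FNot f))"

lemma fo_sat_derived [simp]:
  "fo_sat A \<rho> (FOr f g) \<longleftrightarrow> fo_sat A \<rho> f \<or> fo_sat A \<rho> g"
  "fo_sat A \<rho> (FImp f g) \<longleftrightarrow> (fo_sat A \<rho> f \<longrightarrow> fo_sat A \<rho> g)"
  "fo_sat A \<rho> (FExU \<phi>U k f) \<longleftrightarrow> (\<exists>x\<in>qptl_lang A \<phi>U. fo_sat A (\<rho>(k := x)) f)"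
  "fo_sat A \<rho> (FAllU \<phi>U k f) \<longleftrightarrow> (\<forall>x\<in>qptl_lang A \<phi>U. fo_sat A (\<rho>(k := x)) f)"
  by (auto simp: FOr_def FImp_def FExU_def FAllU_def qptl_lang_def)

text \<open>Slot 0 holds the reference world and slot 1 the world that is added to the antecedent when \<open>e\<close> is true.\<close>

definition antecedent :: "nat qptl \<Rightarrow> bool \<Rightarrow> nat \<Rightarrow> fo" where
  "antecedent \<phi> e i = (if e then FOr (FQ \<phi> i) (FE i 1) else FQ \<phi> i)"

text \<open>Slots 2 to 4 hold the worlds quantified in \<open>cf_holds\<close>;
  \<open>FR \<phi>R 0 3 2\<close> says that world 3 is at least as close to the reference world as
  world 2.\<close>

definition cf_formula ::
  "nat qptl \<Rightarrow> (nat \<times> nat) qptl \<Rightarrow> cf_op \<Rightarrow> nat qptl \<Rightarrow> bool \<Rightarrow> nat qptl \<Rightarrow> fo" where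
  "cf_formula \<phi>U \<phi>R c \<phi> e \<psi> = (case c of
     Would \<Rightarrow> FOr (FAllU \<phi>U 2 (FNot (antecedent \<phi> e 2)))
       (FExU \<phi>U 2 (FAnd (antecedent \<phi> e 2)
         (FAllU \<phi>U 3 (FImp (FR \<phi>R 0 3 2) (FImp (antecedent \<phi> e 3) (FQ \<psi> 3))))))
   | Might \<Rightarrow> FAnd (FExU \<phi>U 2 (antecedent \<phi> e 2))
       (FAllU \<phi>U 2 (FImp (antecedent \<phi> e 2)
         (FExU \<phi>U 3 (FAnd (FR \<phi>R 0 3 2) (FAnd (antecedent \<phi> e 3) (FQ \<psi> 3))))))
   | UnivWould \<Rightarrow> FOr (FAllU \<phi>U 2 (FNot (antecedent \<phi> e 2)))
       (FAllU \<phi>U 2 (FImp (antecedent \<phi> e 2)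
         (FExU \<phi>U 3 (FAnd (FR \<phi>R 0 3 2) (FAnd (antecedent \<phi> e 3)
           (FAllU \<phi>U 4 (FImp (FR \<phi>R 0 4 3) (FImp (antecedent \<phi> e 4) (FQ \<psi> 4)))))))))
   | ExMight \<Rightarrow> FExU \<phi>U 2 (FAnd (antecedent \<phi> e 2)
       (FAllU \<phi>U 3 (FImp (FAnd (FR \<phi>R 0 3 2) (antecedent \<phi> e 3))
         (FExU \<phi>U 4 (FAnd (FR \<phi>R 0 4 3) (FAnd (antecedent \<phi> e 4) (FQ \<psi> 4))))))))"

lemma fo_sat_antecedent:
  "fo_sat A \<rho> (antecedent \<phi> e i) \<longleftrightarrow> \<rho> i \<in> {V. qptl_sat V \<phi>} \<union> (if e then {\<rho> 1} else {})"
  by (auto simp: antecedent_def)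

lemma fo_sat_cf_formula:
  assumes R: "defines_similarity A \<phi>R R" and W: "\<rho> 0 \<in> traces A"
  shows "fo_sat A \<rho> (cf_formula \<phi>U \<phi>R c \<phi> e \<psi>) \<longleftrightarrow>
    cf_holds (qptl_lang A \<phi>U) (R (\<rho> 0)) c ({V. qptl_sat V \<phi>} \<union> (if e then {\<rho> 1} else {})) {V. qptl_sat V \<psi>}"
proof -
  \<comment> \<open>The formula describes \<open>R\<close> on traces over \<open>A\<close> only;
    worlds of the universe are such traces, and \<open>W\<close> supplies this for the reference
    world.\<close>
  have merge: "R (\<rho> 0) x y \<longleftrightarrow> qptl_sat (trace_merge (\<rho> 0) x y) \<phi>R"
    if "x \<in> qptl_lang A \<phi>U" "y \<in> qptl_lang A \<phi>U" for x y
    using R W that unfolding defines_similarity_def qptl_lang_def by blast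
  show ?thesis
    by (cases c) (simp_all add: cf_formula_def fo_sat_antecedent merge cong: ball_cong_simp bex_cong_simp)
qed

fun cf_fo :: "nat qptl \<Rightarrow> (nat \<times> nat) qptl \<Rightarrow> nat qptl_cf \<Rightarrow> fo" where
  "cf_fo \<phi>U \<phi>R (CF c \<phi> \<psi>) = cf_formula \<phi>U \<phi>R c \<phi> False \<psi>"
| "cf_fo \<phi>U \<phi>R (CFmin c \<phi> \<psi>) = FAnd (cf_formula \<phi>U \<phi>R c \<phi> False \<psi>)
     (FNot (FExU \<phi>U 1 (FAnd (FNot (FQ \<phi> 1)) (cf_formula \<phi>U \<phi>R c \<phi> True \<psi>))))"
| "cf_fo \<phi>U \<phi>R (CConj \<xi> \<zeta>) = FAnd (cf_fo \<phi>U \<phi>R \<xi>) (cf_fo \<phi>U \<phi>R \<zeta>)"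
| "cf_fo \<phi>U \<phi>R (CNeg \<xi>) = FNot (cf_fo \<phi>U \<phi>R \<xi>)"
| "cf_fo \<phi>U \<phi>R (Qptl \<psi>) = FQ \<psi> 0"

lemma fo_sat_cf_fo:
  assumes R: "defines_similarity A \<phi>R R" and sim: "similarity A (qptl_lang A \<phi>U) R"
    and W: "\<rho> 0 \<in> traces A"
  shows "fo_sat A \<rho> (cf_fo \<phi>U \<phi>R \<xi>) \<longleftrightarrow> qptl_cf_sat (qptl_lang A \<phi>U) R (\<rho> 0) \<xi>"
proof (induction \<xi>)
  case (CF c \<phi> \<psi>)
  then show ?case using fo_sat_cf_formula[OF R, of \<rho>] W by simp
next
  case (CFmin c \<phi> \<psi>)
  have "reflp_on (qptl_lang A \<phi>U) (R (\<rho> 0))" "transp_on (qptl_lang A \<phi>U) (R (\<rho> 0))"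
    using sim W unfolding similarity_def by auto
  note min = cf_min_holds_iff[OF this]
  have upd: "fo_sat A (\<rho>(1 := V)) (cf_formula \<phi>U \<phi>R c \<phi> True \<psi>) \<longleftrightarrow>
      cf_holds (qptl_lang A \<phi>U) (R (\<rho> 0)) c (insert V {V. qptl_sat V \<phi>}) {V. qptl_sat V \<psi>}" for V
    using fo_sat_cf_formula[OF R, of "\<rho>(1 := V)" \<phi>U c \<phi> True \<psi>] W by simp
  show ?case
    using fo_sat_cf_formula[OF R, of \<rho>] W upd by (simp add: min)
qed auto

text \<open>The outermost quantifier is not relativized to the universe, because satisfiability asks
  for any trace over \<open>A\<close>.\<close>

lemma satisfiable_iff_fo_sat:
  assumes "defines_similarity A \<phi>R R" "similarity A (qptl_lang A \<phi>U) R"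
  shows "qptl_cf_satisfiable A (qptl_lang A \<phi>U) R \<xi> \<longleftrightarrow> fo_sat A \<rho> (FEx 0 (cf_fo \<phi>U \<phi>R \<xi>))"
  using fo_sat_cf_fo[OF assms, of "\<rho>(0 := _)"] unfolding qptl_cf_satisfiable_def by (auto simp: fun_upd_same)

section \<open>Computability of the evaluation\<close>

lemma prod_encode_ge: "a + b \<le> prod_encode (a, b)"
  using le_triangle[of "a + b"] by (simp add: prod_encode_def)

lemma ltl_code_inj:
  assumes "inj e"
  shows "ltl_code e \<phi> = ltl_code e \<psi> \<Longrightarrow> \<phi> = \<psi>"
  by (induction \<phi> arbitrary: \<psi>; case_tac \<psi>) (auto dest: injD[OF assms])

lemma qptl_code_inj:
  assumes "inj e"
  shows "qptl_code e \<phi> = qptl_code e \<psi> \<Longrightarrow> \<phi> = \<psi>"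
  by (induction \<phi> arbitrary: \<psi>; case_tac \<psi>) (auto dest: injD[OF assms] ltl_code_inj[OF assms])

lemma cf_op_code_inj: "cf_op_code c = cf_op_code d \<Longrightarrow> c = d"
  by (cases c; cases d) auto

lemma qptl_cf_code_inj:
  assumes "inj e"
  shows "qptl_cf_code e \<phi> = qptl_cf_code e \<psi> \<Longrightarrow> \<phi> = \<psi>"
  by (induction \<phi> arbitrary: \<psi>; case_tac \<psi>) (auto dest: cf_op_code_inj qptl_code_inj[OF assms])

text \<open>Taking the given numberings of syntax as encodings makes the codes in the final
  statement values of \<open>enc\<close>, without conversion.\<close>

instantiation ltl :: (enc) enc begin
definition enc_ltl :: "'a ltl \<Rightarrow> nat" where "enc_ltl = ltl_code enc"
instance by standard (auto intro!: injI simp: enc_ltl_def dest: ltl_code_inj[OF inj_enc])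
end

instantiation qptl :: (enc) enc begin
definition enc_qptl :: "'a qptl \<Rightarrow> nat" where "enc_qptl = qptl_code enc"
instance by standard (auto intro!: injI simp: enc_qptl_def dest: qptl_code_inj[OF inj_enc])
end

instantiation cf_op :: enc begin
definition enc_cf_op :: "cf_op \<Rightarrow> nat" where "enc_cf_op = cf_op_code"
instance by standard (auto intro!: injI simp: enc_cf_op_def dest: cf_op_code_inj)
end

instantiation qptl_cf :: (enc) enc begin
definition enc_qptl_cf :: "'a qptl_cf \<Rightarrow> nat" where "enc_qptl_cf = qptl_cf_code enc"
instance by standard (auto intro!: injI simp: enc_qptl_cf_def dest: qptl_cf_code_inj[OF inj_enc])
end

text \<open>The tags are chosen such that the code of a formula bounds its rank (up to one).\<close>

instantiation fo :: enc begin
fun enc_fo :: "fo \<Rightarrow> nat" where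
  "enc_fo (FE i j) = prod_encode (0, prod_encode (i, j))"
| "enc_fo (FNot f) = prod_encode (1, enc_fo f)"
| "enc_fo (FEx k f) = prod_encode (2, prod_encode (k, enc_fo f))"
| "enc_fo (FAnd f g) = prod_encode (3, prod_encode (enc_fo f, enc_fo g))"
| "enc_fo (FR \<phi> i j k) = prod_encode (4, prod_encode (enc \<phi>, prod_encode (i, prod_encode (j, k))))"
| "enc_fo (FQ \<phi> i) = prod_encode (5, prod_encode (enc \<phi>, i))"
instance
proof
  show "inj (enc :: fo \<Rightarrow> nat)"
  proof (rule injI)
    fix f g :: fo
    show "enc f = enc g \<Longrightarrow> f = g"
      by (induction f arbitrary: g; case_tac g) auto
  qed
qed
end

lemma enc_ltl_simps [simp]:
  "enc (Prop a) = prod_encode (0, enc a)"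
  "enc (Neg \<phi>) = prod_encode (1, enc \<phi>)"
  "enc (Conj \<phi> \<psi>) = prod_encode (2, prod_encode (enc \<phi>, enc \<psi>))"
  "enc (Next \<phi>) = prod_encode (3, enc \<phi>)"
  "enc (Until \<phi> \<psi>) = prod_encode (4, prod_encode (enc \<phi>, enc \<psi>))"
  by (simp_all add: enc_ltl_def)

lemma enc_qptl_simps [simp]:
  "enc (Matrix \<chi>) = prod_encode (0, enc \<chi>)"
  "enc (Exists q \<psi>) = prod_encode (1, prod_encode (enc q, enc \<psi>))"
  "enc (Forall q \<psi>) = prod_encode (2, prod_encode (enc q, enc \<psi>))"
  by (simp_all add: enc_qptl_def enc_ltl_def)

lemma enc_qptl_cf_simps [simp]:
  "enc (CF c \<phi> \<psi>) = prod_encode (0, prod_encode (enc c, prod_encode (enc \<phi>, enc \<psi>)))"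
  "enc (CFmin c \<phi> \<psi>) = prod_encode (1, prod_encode (enc c, prod_encode (enc \<phi>, enc \<psi>)))"
  "enc (CConj \<xi> \<zeta>) = prod_encode (2, prod_encode (enc \<xi>, enc \<zeta>))"
  "enc (CNeg \<xi>) = prod_encode (3, enc \<xi>)"
  "enc (Qptl \<psi>) = prod_encode (4, enc \<psi>)"
  by (simp_all add: enc_qptl_def enc_qptl_cf_def enc_cf_op_def)

lemma ltl_size_le_enc: "ltl_size \<phi> \<le> enc \<phi> + 1"
proof (induction \<phi>)
  case (Neg \<phi>)
  then show ?case using prod_encode_ge[of 1 "enc \<phi>"] by simp
next
  case (Conj \<phi> \<psi>)
  then show ?case
    using prod_encode_ge[of 2 "prod_encode (enc \<phi>, enc \<psi>)"] prod_encode_ge[of "enc \<phi>" "enc \<psi>"] by simp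
next
  case (Next \<phi>)
  then show ?case using prod_encode_ge[of 3 "enc \<phi>"] by simp
next
  case (Until \<phi> \<psi>)
  then show ?case
    using prod_encode_ge[of 4 "prod_encode (enc \<phi>, enc \<psi>)"] prod_encode_ge[of "enc \<phi>" "enc \<psi>"] by simp
qed simp

lemma qptl_rank_le_enc: "qptl_rank \<phi> \<le> enc \<phi> + 4"
proof (induction \<phi>)
  case (Matrix \<chi>)
  then show ?case using ltl_size_le_enc[of \<chi>] prod_encode_ge[of 0 "enc \<chi>"] by simp
next
  case (Exists q \<psi>)
  then show ?case
    using prod_encode_ge[of 1 "prod_encode (enc q, enc \<psi>)"] prod_encode_ge[of "enc q" "enc \<psi>"] by simp
next
  case (Forall q \<psi>)
  then show ?case
    using prod_encode_ge[of 2 "prod_encode (enc q, enc \<psi>)"] prod_encode_ge[of "enc q" "enc \<psi>"] by simp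
qed

text \<open>A tower of height \<open>enc f + 1\<close> thus bounds the number of types for
  \<open>f\<close>, and the rank itself never has to be computed.\<close>

lemma fo_rank_le_enc: "fo_rank f \<le> enc f + 1"
proof (induction f)
  case (FQ \<phi> i)
  then show ?case
    using qptl_rank_le_enc[of \<phi>] prod_encode_ge[of 5 "prod_encode (enc \<phi>, i)"] prod_encode_ge[of "enc \<phi>" i] by simp
next
  case (FR \<phi> i j k)
  then show ?case
    using qptl_rank_le_enc[of \<phi>] prod_encode_ge[of 4 "prod_encode (enc \<phi>, prod_encode (i, prod_encode (j, k)))"]
      prod_encode_ge[of "enc \<phi>" "prod_encode (i, prod_encode (j, k))"] by simp
next
  case (FNot f)
  then show ?case using prod_encode_ge[of 1 "enc f"] by simp
next
  case (FAnd f g)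
  then show ?case
    using prod_encode_ge[of 3 "prod_encode (enc f, enc g)"] prod_encode_ge[of "enc f" "enc g"] by simp
next
  case (FEx k f)
  then show ?case
    using prod_encode_ge[of 2 "prod_encode (k, enc f)"] prod_encode_ge[of k "enc f"] by simp
qed simp

text \<open>Constructors with recursive arguments carry positive tags, so those arguments have
  strictly smaller codes, and \<open>enc\<close> can serve as the measure in
  \<open>computable_recursion\<close>.\<close>

lemma prod_encode_less:
  "0 < a \<Longrightarrow> b < prod_encode (a, b)"
  "0 < a \<Longrightarrow> b < prod_encode (a, prod_encode (b, c))"
  "0 < a \<Longrightarrow> c < prod_encode (a, prod_encode (b, c))"
  using prod_encode_ge[of a b] prod_encode_ge[of a "prod_encode (b, c)"] prod_encode_ge[of b c] by linarith+

text \<open>Constructor tags are tested by successive subtraction, since branching is on a number being zero.\<close>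

fun tag_case :: "nat \<Rightarrow> (nat \<Rightarrow> nat) list \<Rightarrow> nat \<Rightarrow> nat" where
  "tag_case t [] y = 0"
| "tag_case t (g # gs) y = (if t = 0 then g y else tag_case (t - 1) gs y)"

lemma rec1_tag_case:
  "rec1 t \<Longrightarrow> rec1 y \<Longrightarrow> \<forall>g\<in>set gs. rec1 g \<Longrightarrow> rec1 (\<lambda>n. tag_case (t n) gs (y n))"
proof (induction gs arbitrary: t)
  case Nil
  then show ?case by (simp add: rec1_const)
next
  case (Cons g gs)
  have "rec1 (\<lambda>n. tag_case (t n - 1) gs (y n))"
    using Cons.prems by (intro Cons.IH rec1_diff rec1_const) auto
  moreover have "rec1 (\<lambda>n. g (y n))"
    using Cons.prems by (intro rec1_comp[of g y]) auto
  ultimately show ?case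
    using rec1_if0[OF Cons.prems(1)] by simp
qed

text \<open>A branch receives the whole input paired with what follows the tag. The latter is
  already the code of the tuple of constructor arguments, so realizers of the branch functions apply
  to it directly.\<close>

lemma rec1_tagged:
  assumes "rec1 t" "\<forall>g\<in>set gs. rec1 g"
  shows "rec1 (\<lambda>n. tag_case (fst (prod_decode (t n))) gs (prod_encode (n, snd (prod_decode (t n)))))"
  by (intro rec1_tag_case rec1_fst rec1_snd rec1_pair rec1_id assms)

lemma computable_case_ltl [comp_intro]:
  assumes "computable t" "computable (\<lambda>p. f1 (fst p) (snd p))" "computable (\<lambda>p. f2 (fst p) (snd p))"
    "computable (\<lambda>p. f3 (fst p) (fst (snd p)) (snd (snd p)))" "computable (\<lambda>p. f4 (fst p) (snd p))"
    "computable (\<lambda>p. f5 (fst p) (fst (snd p)) (snd (snd p)))"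
  shows "computable (\<lambda>x. case t x of Prop a \<Rightarrow> f1 x a | Neg \<phi> \<Rightarrow> f2 x \<phi> | Conj \<phi> \<psi> \<Rightarrow> f3 x \<phi> \<psi>
    | Next \<phi> \<Rightarrow> f4 x \<phi> | Until \<phi> \<psi> \<Rightarrow> f5 x \<phi> \<psi>)" (is "computable ?F")
proof -
  obtain t' g1 g2 g3 g4 g5 where t: "rec1 t'" "\<And>x. t' (enc x) = enc (t x)" and
    g: "rec1 g1" "rec1 g2" "rec1 g3" "rec1 g4" "rec1 g5" and
    e: "\<And>p. g1 (enc p) = enc (f1 (fst p) (snd p))" "\<And>p. g2 (enc p) = enc (f2 (fst p) (snd p))"
    "\<And>p. g3 (enc p) = enc (f3 (fst p) (fst (snd p)) (snd (snd p)))" "\<And>p. g4 (enc p) = enc (f4 (fst p) (snd p))"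
    "\<And>p. g5 (enc p) = enc (f5 (fst p) (fst (snd p)) (snd (snd p)))"
    using assms unfolding computable_def by metis
  show ?thesis
  proof (rule computableI[OF rec1_tagged[OF t(1), of "[g1, g2, g3, g4, g5]"]])
    fix x
    show "tag_case (fst (prod_decode (t' (enc x)))) [g1, g2, g3, g4, g5]
        (prod_encode (enc x, snd (prod_decode (t' (enc x))))) = enc (?F x)"
      using e(1)[of "(x, _)"] e(2)[of "(x, _)"] e(3)[of "(x, _, _)"] e(4)[of "(x, _)"] e(5)[of "(x, _, _)"]
      by (cases "t x") (simp_all add: t(2))
  qed (use g in simp)
qed

lemma computable_case_qptl [comp_intro]:
  assumes "computable t" "computable (\<lambda>p. f1 (fst p) (snd p))"
    "computable (\<lambda>p. f2 (fst p) (fst (snd p)) (snd (snd p)))"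
    "computable (\<lambda>p. f3 (fst p) (fst (snd p)) (snd (snd p)))"
  shows "computable (\<lambda>x. case t x of Matrix \<chi> \<Rightarrow> f1 x \<chi> | Exists q \<psi> \<Rightarrow> f2 x q \<psi> | Forall q \<psi> \<Rightarrow> f3 x q \<psi>)"
    (is "computable ?F")
proof -
  obtain t' g1 g2 g3 where t: "rec1 t'" "\<And>x. t' (enc x) = enc (t x)" and
    g: "rec1 g1" "rec1 g2" "rec1 g3" and
    e: "\<And>p. g1 (enc p) = enc (f1 (fst p) (snd p))"
    "\<And>p. g2 (enc p) = enc (f2 (fst p) (fst (snd p)) (snd (snd p)))"
    "\<And>p. g3 (enc p) = enc (f3 (fst p) (fst (snd p)) (snd (snd p)))"
    using assms unfolding computable_def by metis
  show ?thesis
  proof (rule computableI[OF rec1_tagged[OF t(1), of "[g1, g2, g3]"]])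
    fix x
    show "tag_case (fst (prod_decode (t' (enc x)))) [g1, g2, g3]
        (prod_encode (enc x, snd (prod_decode (t' (enc x))))) = enc (?F x)"
      using e(1)[of "(x, _)"] e(2)[of "(x, _, _)"] e(3)[of "(x, _, _)"]
      by (cases "t x") (simp_all add: t(2))
  qed (use g in simp)
qed

lemma computable_case_qptl_cf [comp_intro]:
  assumes "computable t"
    "computable (\<lambda>p. f1 (fst p) (fst (snd p)) (fst (snd (snd p))) (snd (snd (snd p))))"
    "computable (\<lambda>p. f2 (fst p) (fst (snd p)) (fst (snd (snd p))) (snd (snd (snd p))))"
    "computable (\<lambda>p. f3 (fst p) (fst (snd p)) (snd (snd p)))"
    "computable (\<lambda>p. f4 (fst p) (snd p))" "computable (\<lambda>p. f5 (fst p) (snd p))"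
  shows "computable (\<lambda>x. case t x of CF c \<phi> \<psi> \<Rightarrow> f1 x c \<phi> \<psi> | CFmin c \<phi> \<psi> \<Rightarrow> f2 x c \<phi> \<psi>
    | CConj \<xi> \<zeta> \<Rightarrow> f3 x \<xi> \<zeta> | CNeg \<xi> \<Rightarrow> f4 x \<xi> | Qptl \<psi> \<Rightarrow> f5 x \<psi>)" (is "computable ?F")
proof -
  obtain t' g1 g2 g3 g4 g5 where t: "rec1 t'" "\<And>x. t' (enc x) = enc (t x)" and
    g: "rec1 g1" "rec1 g2" "rec1 g3" "rec1 g4" "rec1 g5" and
    e: "\<And>p. g1 (enc p) = enc (f1 (fst p) (fst (snd p)) (fst (snd (snd p))) (snd (snd (snd p))))"
    "\<And>p. g2 (enc p) = enc (f2 (fst p) (fst (snd p)) (fst (snd (snd p))) (snd (snd (snd p))))"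
    "\<And>p. g3 (enc p) = enc (f3 (fst p) (fst (snd p)) (snd (snd p)))"
    "\<And>p. g4 (enc p) = enc (f4 (fst p) (snd p))" "\<And>p. g5 (enc p) = enc (f5 (fst p) (snd p))"
    using assms unfolding computable_def by metis
  show ?thesis
  proof (rule computableI[OF rec1_tagged[OF t(1), of "[g1, g2, g3, g4, g5]"]])
    fix x
    show "tag_case (fst (prod_decode (t' (enc x)))) [g1, g2, g3, g4, g5]
        (prod_encode (enc x, snd (prod_decode (t' (enc x))))) = enc (?F x)"
      using e(1)[of "(x, _, _, _)"] e(2)[of "(x, _, _, _)"] e(3)[of "(x, _, _)"] e(4)[of "(x, _)"] e(5)[of "(x, _)"]
      by (cases "t x") (simp_all add: t(2))
  qed (use g in simp)
qed

lemma computable_case_cf_op [comp_intro]: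
  assumes "computable t" "computable f1" "computable f2" "computable f3" "computable f4"
  shows "computable (\<lambda>x. case t x of Would \<Rightarrow> f1 x | Might \<Rightarrow> f2 x | UnivWould \<Rightarrow> f3 x | ExMight \<Rightarrow> f4 x)"
proof -
  have "computable (\<lambda>x. if t x = Would then f1 x else if t x = Might then f2 x
      else if t x = UnivWould then f3 x else f4 x)"
    by (intro comp_intro assms)
  then show ?thesis
    by (rule back_subst[of computable]) (auto split: cf_op.split)
qed

text \<open>The branches are numbered by the tags of the encoding, which do not follow the order of
  the constructors.\<close>

lemma computable_case_fo [comp_intro]:
  assumes "computable t"
    "computable (\<lambda>p. f1 (fst p) (fst (snd p)) (snd (snd p)))"
    "computable (\<lambda>p. f2 (fst p) (snd p))"
    "computable (\<lambda>p. f3 (fst p) (fst (snd p)) (snd (snd p)))"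
    "computable (\<lambda>p. f4 (fst p) (fst (snd p)) (snd (snd p)))"
    "computable (\<lambda>p. f5 (fst p) (fst (snd p)) (fst (snd (snd p))) (fst (snd (snd (snd p)))) (snd (snd (snd (snd p)))))"
    "computable (\<lambda>p. f6 (fst p) (fst (snd p)) (snd (snd p)))"
  shows "computable (\<lambda>x. case t x of FQ \<phi> i \<Rightarrow> f6 x \<phi> i | FR \<phi> i j k \<Rightarrow> f5 x \<phi> i j k | FE i j \<Rightarrow> f1 x i j
    | FNot f \<Rightarrow> f2 x f | FAnd f g \<Rightarrow> f4 x f g | FEx k f \<Rightarrow> f3 x k f)" (is "computable ?F")
proof -
  obtain t' g1 g2 g3 g4 g5 g6 where t: "rec1 t'" "\<And>x. t' (enc x) = enc (t x)" and
    g: "rec1 g1" "rec1 g2" "rec1 g3" "rec1 g4" "rec1 g5" "rec1 g6" and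
    e: "\<And>p. g1 (enc p) = enc (f1 (fst p) (fst (snd p)) (snd (snd p)))"
    "\<And>p. g2 (enc p) = enc (f2 (fst p) (snd p))"
    "\<And>p. g3 (enc p) = enc (f3 (fst p) (fst (snd p)) (snd (snd p)))"
    "\<And>p. g4 (enc p) = enc (f4 (fst p) (fst (snd p)) (snd (snd p)))"
    "\<And>p. g5 (enc p) = enc (f5 (fst p) (fst (snd p)) (fst (snd (snd p))) (fst (snd (snd (snd p)))) (snd (snd (snd (snd p)))))"
    "\<And>p. g6 (enc p) = enc (f6 (fst p) (fst (snd p)) (snd (snd p)))"
    using assms unfolding computable_def by metis
  show ?thesis
  proof (rule computableI[OF rec1_tagged[OF t(1), of "[g1, g2, g3, g4, g5, g6]"]])
    fix x
    show "tag_case (fst (prod_decode (t' (enc x)))) [g1, g2, g3, g4, g5, g6]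
        (prod_encode (enc x, snd (prod_decode (t' (enc x))))) = enc (?F x)"
      using e(1)[of "(x, _, _)"] e(2)[of "(x, _)"] e(3)[of "(x, _, _)"] e(4)[of "(x, _, _)"]
        e(5)[of "(x, _, _, _, _)"] e(6)[of "(x, _, _)"]
      by (cases "t x") (simp_all add: t(2))
  qed (use g in simp)
qed

lemma computable_tagI:
  assumes "computable (\<lambda>x. (c, p x))" "\<And>x. enc (f x) = enc ((c :: nat), p x)"
  shows "computable f"
  using assms unfolding computable_def by simp

lemma computable_fo_constructors [comp_intro]:
  "computable i \<Longrightarrow> computable j \<Longrightarrow> computable (\<lambda>x. FE (i x) (j x))"
  "computable f \<Longrightarrow> computable (\<lambda>x. FNot (f x))"
  "computable i \<Longrightarrow> computable f \<Longrightarrow> computable (\<lambda>x. FEx (i x) (f x))"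
  "computable f \<Longrightarrow> computable g \<Longrightarrow> computable (\<lambda>x. FAnd (f x) (g x))"
  "computable \<phi> \<Longrightarrow> computable i \<Longrightarrow> computable j \<Longrightarrow> computable k \<Longrightarrow> computable (\<lambda>x. FR (\<phi> x) (i x) (j x) (k x))"
  "computable \<psi> \<Longrightarrow> computable i \<Longrightarrow> computable (\<lambda>x. FQ (\<psi> x) (i x))"
  subgoal by (rule computable_tagI[of 0 "\<lambda>x. (i x, j x)"]) (intro comp_intro, assumption+, simp)
  subgoal by (rule computable_tagI[of 1 f]) (intro comp_intro, assumption+, simp)
  subgoal by (rule computable_tagI[of 2 "\<lambda>x. (i x, f x)"]) (intro comp_intro, assumption+, simp)
  subgoal by (rule computable_tagI[of 3 "\<lambda>x. (f x, g x)"]) (intro comp_intro, assumption+, simp)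
  subgoal by (rule computable_tagI[of 4 "\<lambda>x. (\<phi> x, i x, j x, k x)"]) (intro comp_intro, assumption+, simp)
  subgoal by (rule computable_tagI[of 5 "\<lambda>x. (\<psi> x, i x)"]) (intro comp_intro, assumption+, simp)
  done

lemma computable_unroll [comp_intro]:
  assumes "computable d" "computable l" "computable n"
  shows "computable (\<lambda>x. unroll (d x) (l x) (n x))"
  unfolding unroll_def by (intro comp_intro assms)


lemma nth_default_map: "n < length xs \<Longrightarrow> nth_default d (map f xs) n = f (xs ! n)"
  by (simp add: nth_default_def)

lemma nth_default_append:
  "n < length xs \<Longrightarrow> nth_default d (xs @ ys) n = nth_default d xs n"
  "nth_default d (xs @ ys) (length xs + n) = nth_default d ys n"
  by (auto simp: nth_default_def nth_append)

section \<open>Computability of the evaluators and of the translation\<close>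

lemma computable_ltl_eval:
  "computable (\<lambda>x :: 'p::enc list list \<times> nat \<times> 'p ltl. ltl_eval (fst x) (fst (snd x)) (snd (snd x)))"
proof -
  let ?f = "\<lambda>x :: 'p list list \<times> nat \<times> 'p ltl. ltl_eval (fst x) (fst (snd x)) (snd (snd x))"
  \<comment> \<open>For an until, the calls for \<open>\<phi>\<close> on the window precede those
    for \<open>\<psi>\<close>; hence the offset \<open>length (fst x)\<close> in
    \<open>step\<close>.\<close>
  define deps where "deps x = (case snd (snd x) of
      Prop a \<Rightarrow> []
    | Neg \<phi> \<Rightarrow> [(fst x, fst (snd x), \<phi>)]
    | Conj \<phi> \<psi> \<Rightarrow> [(fst x, fst (snd x), \<phi>), (fst x, fst (snd x), \<psi>)]
    | Next \<phi> \<Rightarrow> [(fst x, Suc (fst (snd x)), \<phi>)]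
    | Until \<phi> \<psi> \<Rightarrow> map (\<lambda>d. (fst x, fst (snd x) + d, \<phi>)) [0..<length (fst x)]
        @ map (\<lambda>d. (fst x, fst (snd x) + d, \<psi>)) [0..<length (fst x)])"
    for x :: "'p list list \<times> nat \<times> 'p ltl"
  define step where "step x vs = (case snd (snd x) of
      Prop a \<Rightarrow> \<exists>y\<in>set (unroll [] (fst x) (fst (snd x))). y = a
    | Neg \<phi> \<Rightarrow> \<not> nth_default False vs 0
    | Conj \<phi> \<psi> \<Rightarrow> nth_default False vs 0 \<and> nth_default False vs 1
    | Next \<phi> \<Rightarrow> nth_default False vs 0
    | Until \<phi> \<psi> \<Rightarrow> \<exists>d\<in>set [0..<length (fst x)]. nth_default False vs (length (fst x) + d) \<and>
        (\<forall>k\<in>set [0..<d]. nth_default False vs k))"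
    for x :: "'p list list \<times> nat \<times> 'p ltl" and vs
  show ?thesis
  proof (rule computable_recursion[of deps step "\<lambda>x. enc (snd (snd x))"])
    show "computable deps"
      unfolding deps_def by (intro comp_intro)
    show "computable (\<lambda>p. step (fst p) (snd p))"
      unfolding step_def by (intro comp_intro)
    show "computable (\<lambda>x :: 'p list list \<times> nat \<times> 'p ltl. enc (snd (snd x)))"
      by (intro comp_intro)
    show "enc (snd (snd y)) < enc (snd (snd x))" if "y \<in> set (deps x)" for x y
      using that unfolding deps_def
      by (cases "snd (snd x)") (auto simp: prod_encode_less)
    show "?f x = step x (map ?f (deps x))" for x
    proof (cases "snd (snd x)")
      case (Until \<phi> \<psi>)
      let ?n = "length (fst x)"
      let ?a = "map (\<lambda>d. ltl_eval (fst x) (fst (snd x) + d) \<phi>) [0..<?n]"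
        and ?b = "map (\<lambda>d. ltl_eval (fst x) (fst (snd x) + d) \<psi>) [0..<?n]"
      have vs: "map ?f (deps x) = ?a @ ?b"
        by (simp add: deps_def Until comp_def)
      have "nth_default False (?a @ ?b) k = ltl_eval (fst x) (fst (snd x) + k) \<phi>" if "k < ?n" for k
        using that nth_default_append(1)[of k ?a False ?b] by (simp add: nth_default_map)
      moreover have "nth_default False (?a @ ?b) (?n + k) = ltl_eval (fst x) (fst (snd x) + k) \<psi>" if "k < ?n" for k
        using that nth_default_append(2)[of False ?a ?b k] by (simp add: nth_default_map)
      ultimately show ?thesis
        unfolding vs by (auto simp: step_def Until)
    next
      case (Prop a)
      then show ?thesis by (simp add: step_def deps_def)
    next
      case (Neg \<phi>)
      then show ?thesis by (simp add: step_def deps_def nth_default_def)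
    next
      case (Conj \<phi> \<psi>)
      then show ?thesis by (simp add: step_def deps_def nth_default_def)
    next
      case (Next \<phi>)
      then show ?thesis by (simp add: step_def deps_def nth_default_def)
    qed
  qed
qed

lemma computable_list_update_prop [comp_intro]:
  assumes "computable F" "computable l" "computable q" "computable x"
  shows "computable (\<lambda>z. list_update_prop (F z) (l z) (q z) (x z))"
  unfolding list_update_prop_def
  by (intro comp_intro computable_comp[OF assms(1)] computable_comp[OF assms(2)]
      computable_comp[OF assms(3)] computable_comp[OF assms(4)])

lemma computable_qptl_eval:
  "computable (\<lambda>x :: nat \<times> 'p::enc list list \<times> 'p qptl. qptl_eval (fst x) (fst (snd x)) (snd (snd x)))"
proof -
  let ?f = "\<lambda>x :: nat \<times> 'p list list \<times> 'p qptl. qptl_eval (fst x) (fst (snd x)) (snd (snd x))"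
  define deps where "deps x = (case snd (snd x) of
      Matrix \<phi> \<Rightarrow> []
    | Exists q \<psi> \<Rightarrow> map (\<lambda>y. (fst x, list_update_prop (fst x) (fst (snd x)) q y, \<psi>))
        (List.n_lists (length (fst (snd x)) * fst x) [False, True])
    | Forall q \<psi> \<Rightarrow> map (\<lambda>y. (fst x, list_update_prop (fst x) (fst (snd x)) q y, \<psi>))
        (List.n_lists (length (fst (snd x)) * fst x) [False, True]))"
    for x :: "nat \<times> 'p list list \<times> 'p qptl"
  define step where "step x vs = (case snd (snd x) of
      Matrix \<phi> \<Rightarrow> ltl_eval (fst (snd x)) 0 \<phi>
    | Exists q \<psi> \<Rightarrow> \<exists>v\<in>set vs. v
    | Forall q \<psi> \<Rightarrow> \<forall>v\<in>set vs. v)"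
    for x :: "nat \<times> 'p list list \<times> 'p qptl" and vs
  have ev: "computable (\<lambda>x. ltl_eval (l x) (i x) (\<phi> x))"
    if "computable l" "computable i" "computable \<phi>" for l i and \<phi> :: "'z::enc \<Rightarrow> 'p ltl"
    using computable_comp[OF computable_ltl_eval, of "\<lambda>x. (l x, i x, \<phi> x)"]
      computable_Pair[OF that(1) computable_Pair[OF that(2,3)]] by simp
  show ?thesis
  proof (rule computable_recursion[of deps step "\<lambda>x. enc (snd (snd x))"])
    show "computable deps"
      unfolding deps_def by (intro comp_intro)
    show "computable (\<lambda>p. step (fst p) (snd p))"
      unfolding step_def by (intro comp_intro ev)
    show "computable (\<lambda>x :: nat \<times> 'p list list \<times> 'p qptl. enc (snd (snd x)))"
      by (intro comp_intro)
    show "enc (snd (snd y)) < enc (snd (snd x))" if "y \<in> set (deps x)" for x y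
      using that unfolding deps_def
      by (cases "snd (snd x)") (auto simp: prod_encode_less)
    show "?f x = step x (map ?f (deps x))" for x
      by (cases "snd (snd x)") (auto simp: step_def deps_def)
  qed
qed

lemma computable_env_update [comp_intro]:
  assumes "computable d" "computable env" "computable k" "computable x"
  shows "computable (\<lambda>z. env_update (d z) (env z) (k z) (x z))"
  unfolding env_update_def
  by (intro comp_intro computable_comp[OF assms(1)] computable_comp[OF assms(2)]
      computable_comp[OF assms(3)] computable_comp[OF assms(4)])

lemma computable_merge_letters [comp_intro]:
  assumes "computable a" "computable b" "computable c"
  shows "computable (\<lambda>z. merge_letters (a z) (b z) (c z))"
  unfolding merge_letters_def by (intro comp_intro assms)

lemma computable_fo_eval:
  "computable (\<lambda>x :: nat \<times> nat list list \<times> nat \<times> nat list list list \<times> fo.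
     fo_eval (fst x) (fst (snd x)) (fst (snd (snd x))) (fst (snd (snd (snd x)))) (snd (snd (snd (snd x)))))"
proof -
  let ?F = "\<lambda>x :: nat \<times> nat list list \<times> nat \<times> nat list list list \<times> fo. fst x"
    and ?A = "\<lambda>x :: nat \<times> nat list list \<times> nat \<times> nat list list list \<times> fo. fst (snd x)"
    and ?L = "\<lambda>x :: nat \<times> nat list list \<times> nat \<times> nat list list list \<times> fo. fst (snd (snd x))"
    and ?E = "\<lambda>x :: nat \<times> nat list list \<times> nat \<times> nat list list list \<times> fo. fst (snd (snd (snd x)))"
    and ?G = "\<lambda>x :: nat \<times> nat list list \<times> nat \<times> nat list list list \<times> fo. snd (snd (snd (snd x)))"
  let ?f = "\<lambda>x. fo_eval (?F x) (?A x) (?L x) (?E x) (?G x)"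
  define deps where "deps x = (case ?G x of
      FQ \<phi> i \<Rightarrow> [] | FR \<phi> i j k \<Rightarrow> [] | FE i j \<Rightarrow> []
    | FNot f \<Rightarrow> [(?F x, ?A x, ?L x, ?E x, f)]
    | FAnd f g \<Rightarrow> [(?F x, ?A x, ?L x, ?E x, f), (?F x, ?A x, ?L x, ?E x, g)]
    | FEx k f \<Rightarrow> map (\<lambda>w. (?F x, ?A x, ?L x * ?F x, env_update [] (?E x) k w, f))
        (List.n_lists (2 * (?L x * ?F x)) (?A x)))" for x
  define step where "step x vs = (case ?G x of
      FQ \<phi> i \<Rightarrow> qptl_eval (?F x) (map (\<lambda>n. env_letter (?E x) i n) [0..<2 * ?L x]) \<phi>
    | FR \<phi> i j k \<Rightarrow> qptl_eval (?F x) (map (\<lambda>n. merge_letters (env_letter (?E x) i n)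
        (env_letter (?E x) j n) (env_letter (?E x) k n)) [0..<2 * ?L x]) \<phi>
    | FE i j \<Rightarrow> \<forall>n\<in>set [0..<2 * ?L x].
        (\<forall>a\<in>set (env_letter (?E x) i n). \<exists>b\<in>set (env_letter (?E x) j n). b = a) \<and>
        (\<forall>a\<in>set (env_letter (?E x) j n). \<exists>b\<in>set (env_letter (?E x) i n). b = a)
    | FNot f \<Rightarrow> \<not> nth_default False vs 0
    | FAnd f g \<Rightarrow> nth_default False vs 0 \<and> nth_default False vs 1
    | FEx k f \<Rightarrow> \<exists>v\<in>set vs. v)" for x vs
  have ev1: "computable (\<lambda>x. qptl_eval (F x) (l x) (\<phi> x))"
    if "computable F" "computable l" "computable \<phi>" for F l and \<phi> :: "'z::enc \<Rightarrow> nat qptl"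
    using computable_comp[OF computable_qptl_eval, of "\<lambda>x. (F x, l x, \<phi> x)"]
      computable_Pair[OF that(1) computable_Pair[OF that(2,3)]] by simp
  have ev2: "computable (\<lambda>x. qptl_eval (F x) (l x) (\<phi> x))"
    if "computable F" "computable l" "computable \<phi>" for F l and \<phi> :: "'z::enc \<Rightarrow> (nat \<times> nat) qptl"
    using computable_comp[OF computable_qptl_eval, of "\<lambda>x. (F x, l x, \<phi> x)"]
      computable_Pair[OF that(1) computable_Pair[OF that(2,3)]] by simp
  show ?thesis
  proof (rule computable_recursion[of deps step "\<lambda>x. enc (?G x)"])
    show "computable deps"
      unfolding deps_def by (intro comp_intro)
    show "computable (\<lambda>p. step (fst p) (snd p))"
      unfolding step_def by (intro comp_intro ev1 ev2)
    show "computable (\<lambda>x. enc (?G x))"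
      by (intro comp_intro)
    show "enc (?G y) < enc (?G x)" if "y \<in> set (deps x)" for x y
      using that unfolding deps_def
      by (cases "?G x") (auto simp: prod_encode_less)
    show "?f x = step x (map ?f (deps x))" for x
      by (cases "?G x") (auto simp: step_def deps_def nth_default_def)
  qed
qed

lemma computable_fo_derived [comp_intro]:
  "computable f \<Longrightarrow> computable g \<Longrightarrow> computable (\<lambda>x. FOr (f x) (g x))"
  "computable f \<Longrightarrow> computable g \<Longrightarrow> computable (\<lambda>x. FImp (f x) (g x))"
  "computable \<phi>U \<Longrightarrow> computable k \<Longrightarrow> computable f \<Longrightarrow> computable (\<lambda>x. FExU (\<phi>U x) (k x) (f x))"
  "computable \<phi>U \<Longrightarrow> computable k \<Longrightarrow> computable f \<Longrightarrow> computable (\<lambda>x. FAllU (\<phi>U x) (k x) (f x))"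
  unfolding FAllU_def FExU_def FImp_def FOr_def by (intro comp_intro; assumption)+

lemma computable_antecedent [comp_intro]:
  assumes "computable \<phi>" "computable e" "computable i"
  shows "computable (\<lambda>x. antecedent (\<phi> x) (e x) (i x))"
  unfolding antecedent_def by (intro comp_intro assms)

lemma computable_cf_formula [comp_intro]:
  assumes "computable \<phi>U" "computable \<phi>R" "computable c" "computable \<phi>" "computable e" "computable \<psi>"
  shows "computable (\<lambda>x. cf_formula (\<phi>U x) (\<phi>R x) (c x) (\<phi> x) (e x) (\<psi> x))"
  unfolding cf_formula_def by (intro comp_intro assms)

lemma computable_cf_fo:
  "computable (\<lambda>x :: nat qptl \<times> (nat \<times> nat) qptl \<times> nat qptl_cf. cf_fo (fst x) (fst (snd x)) (snd (snd x)))"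
proof -
  let ?f = "\<lambda>x :: nat qptl \<times> (nat \<times> nat) qptl \<times> nat qptl_cf. cf_fo (fst x) (fst (snd x)) (snd (snd x))"
  define deps where "deps x = (case snd (snd x) of
      CF c \<phi> \<psi> \<Rightarrow> [] | CFmin c \<phi> \<psi> \<Rightarrow> []
    | CConj \<xi> \<zeta> \<Rightarrow> [(fst x, fst (snd x), \<xi>), (fst x, fst (snd x), \<zeta>)]
    | CNeg \<xi> \<Rightarrow> [(fst x, fst (snd x), \<xi>)]
    | Qptl \<psi> \<Rightarrow> [])" for x :: "nat qptl \<times> (nat \<times> nat) qptl \<times> nat qptl_cf"
  \<comment> \<open>The formula \<open>FE 0 0\<close> is only a default for
    \<open>nth_default\<close>: in the recursion the value list has one entry for each call in
    \<open>deps\<close>.\<close>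
  define step where "step x vs = (case snd (snd x) of
      CF c \<phi> \<psi> \<Rightarrow> cf_formula (fst x) (fst (snd x)) c \<phi> False \<psi>
    | CFmin c \<phi> \<psi> \<Rightarrow> FAnd (cf_formula (fst x) (fst (snd x)) c \<phi> False \<psi>)
        (FNot (FExU (fst x) 1 (FAnd (FNot (FQ \<phi> 1)) (cf_formula (fst x) (fst (snd x)) c \<phi> True \<psi>))))
    | CConj \<xi> \<zeta> \<Rightarrow> FAnd (nth_default (FE 0 0) vs 0) (nth_default (FE 0 0) vs 1)
    | CNeg \<xi> \<Rightarrow> FNot (nth_default (FE 0 0) vs 0)
    | Qptl \<psi> \<Rightarrow> FQ \<psi> 0)" for x :: "nat qptl \<times> (nat \<times> nat) qptl \<times> nat qptl_cf" and vs
  show ?thesis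
  proof (rule computable_recursion[of deps step "\<lambda>x. enc (snd (snd x))"])
    show "computable deps"
      unfolding deps_def by (intro comp_intro)
    show "computable (\<lambda>p. step (fst p) (snd p))"
      unfolding step_def by (intro comp_intro)
    show "computable (\<lambda>x :: nat qptl \<times> (nat \<times> nat) qptl \<times> nat qptl_cf. enc (snd (snd x)))"
      by (intro comp_intro)
    show "enc (snd (snd y)) < enc (snd (snd x))" if "y \<in> set (deps x)" for x y
      using that unfolding deps_def
      by (cases "snd (snd x)") (auto simp: prod_encode_less)
    show "?f x = step x (map ?f (deps x))" for x
      by (cases "snd (snd x)") (auto simp: step_def deps_def nth_default_def)
  qed
qed

lemma computable_tower [comp_intro]:
  assumes "computable n"
  shows "computable (\<lambda>x. tower (n x))"
proof -
  have eq: "((\<lambda>r. (2 :: nat) ^ r) ^^ k) (1 :: nat) = tower k" for k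
    by (induction k) auto
  have "computable (\<lambda>x. ((\<lambda>r. (2 :: nat) ^ r) ^^ n x) (1 :: nat))"
    by (intro comp_intro assms)
  then show ?thesis unfolding eq .
qed

section \<open>The decision procedure\<close>

definition powerset_list :: "'a list \<Rightarrow> 'a list list" where
  "powerset_list xs = foldl (\<lambda>acc a. acc @ map (\<lambda>c. a # c) acc) [[]] xs"

lemma set_powerset_list: "set ` set (powerset_list xs) = Pow (set xs)"
proof (induction xs rule: rev_induct)
  case (snoc x xs)
  have "powerset_list (xs @ [x]) = powerset_list xs @ map (\<lambda>c. x # c) (powerset_list xs)"
    by (simp add: powerset_list_def)
  then have "set ` set (powerset_list (xs @ [x])) =
      set ` set (powerset_list xs) \<union> insert x ` set ` set (powerset_list xs)"
    by (simp add: image_Un image_image)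
  then show ?case using snoc by (simp add: Pow_insert)
qed (simp add: powerset_list_def)

text \<open>A set is encoded by the binary digits of a number. Indices below \<open>n\<close>
  suffice, since a nonzero digit \<open>i\<close> forces \<open>2 ^ i \<le> n\<close>.\<close>

definition members :: "nat \<Rightarrow> nat list" where
  "members n = filter (\<lambda>i. n div 2 ^ i mod 2 = 1) [0..<n]"

lemma set_members: "set (members n) = set_decode n"
proof -
  have "i < n" if "odd (n div 2 ^ i)" for i
  proof -
    have "n div 2 ^ i \<noteq> 0" using that by (metis even_zero)
    then have "2 ^ i \<le> n" by (simp add: div_eq_0_iff not_less)
    then show ?thesis using less_exp[of i] by linarith
  qed
  then show ?thesis
    unfolding members_def set_decode_def odd_iff_mod_2_eq_one[symmetric] by auto
qed

text \<open>The search starts with \<open>L = 1\<close> and no assigned slot, so every slot denotes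
  the constantly empty trace; \<open>satisfiable_iff_fo_sat\<close> allows any initial assignment.
  The tower height comes from \<open>fo_rank_le_enc\<close>.\<close>

definition decide :: "nat \<times> nat qptl \<times> (nat \<times> nat) qptl \<times> nat qptl_cf \<Rightarrow> bool" where
  "decide x = (let f = FEx 0 (cf_fo (fst (snd x)) (fst (snd (snd x))) (snd (snd (snd x)))) in
     fo_eval (fact (tower (enc f + 1))) (powerset_list (members (fst x))) 1 [] f)"

lemma computable_decide: "computable decide"
proof -
  have ev: "computable (\<lambda>x. fo_eval (F x) (A x) (L x) (E x) (G x))"
    if "computable F" "computable A" "computable L" "computable E" "computable G"
    for F A L E and G :: "'z::enc \<Rightarrow> fo"
    using computable_comp[OF computable_fo_eval, of "\<lambda>x. (F x, A x, L x, E x, G x)"]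
      computable_Pair[OF that(1) computable_Pair[OF that(2) computable_Pair[OF that(3) computable_Pair[OF that(4,5)]]]]
    by simp
  have cf: "computable (\<lambda>x. cf_fo (F x) (A x) (L x))"
    if "computable F" "computable A" "computable L" for F A and L :: "'z::enc \<Rightarrow> nat qptl_cf"
    using computable_comp[OF computable_cf_fo, of "\<lambda>x. (F x, A x, L x)"]
      computable_Pair[OF that(1) computable_Pair[OF that(2,3)]] by simp
  show ?thesis
    unfolding decide_def Let_def powerset_list_def members_def
    by (intro ev cf comp_intro)
qed

lemma decide_correct:
  assumes "finite A" "defines_similarity A \<phi>R R" "similarity A (qptl_lang A \<phi>U) R"
  shows "decide (set_encode A, \<phi>U, \<phi>R, \<xi>) \<longleftrightarrow> qptl_cf_satisfiable A (qptl_lang A \<phi>U) R \<xi>"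
proof -
  let ?f = "FEx 0 (cf_fo \<phi>U \<phi>R \<xi>)"
  have "fo_eval (fact (tower (enc ?f + 1))) (powerset_list (members (set_encode A))) 1 [] ?f \<longleftrightarrow>
      fo_sat A (\<lambda>i. word (nth_default [] [] i)) ?f"
  proof (rule fo_eval_correct)
    show "tower (fo_rank ?f) \<le> tower (enc ?f + 1)"
      by (rule tower_mono[OF fo_rank_le_enc])
    show "lasso 1 (unroll [] (nth_default [] [] i))" for i
      by (simp add: lasso_def nth_default_def)
    show "Pow A = set ` set (powerset_list (members (set_encode A)))"
      using assms(1) by (simp add: set_powerset_list set_members)
  qed simp
  then show ?thesis
    using satisfiable_iff_fo_sat[OF assms(2,3)] by (simp add: decide_def Let_def)
qed

theorem theorem15:
  shows "\<exists>d. recursive 4 d \<and>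
    (\<forall>(AP :: nat set) \<phi>U \<phi>R R \<xi>.
       finite AP \<longrightarrow>
       qptl_over AP \<phi>U \<longrightarrow>
       defines_similarity AP \<phi>R R \<longrightarrow>
       similarity AP (qptl_lang AP \<phi>U) R \<longrightarrow>
       qptl_cf_over AP \<xi> \<longrightarrow>
       d [set_encode AP, qptl_code id \<phi>U, qptl_code prod_encode \<phi>R, qptl_cf_code id \<xi>] =
         (if qptl_cf_satisfiable AP (qptl_lang AP \<phi>U) R \<xi> then 1 else 0))"
proof -
  obtain g where g: "rec1 g" "\<And>x. g (enc x) = enc (decide x)"
    using computable_decide by (meson computableE)
  \<comment> \<open>The pairing nests to the right, as \<open>enc\<close> does on
    quadruples.\<close>
  let ?d = "\<lambda>xs. g (prod_encode (xs ! 0, prod_encode (xs ! 1, prod_encode (xs ! 2, xs ! 3))))"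
  have "recursive 4 ?d"
    by (rule recursive_comp1[OF g(1)[unfolded rec1_def]], intro recursive_prod_encode proj) simp_all
  moreover have "?d [set_encode AP, qptl_code id \<phi>U, qptl_code prod_encode \<phi>R, qptl_cf_code id \<xi>] =
      (if qptl_cf_satisfiable AP (qptl_lang AP \<phi>U) R \<xi> then 1 else 0)"
    if "finite AP" "defines_similarity AP \<phi>R R" "similarity AP (qptl_lang AP \<phi>U) R"
    for AP \<phi>U \<phi>R R and \<xi> :: "nat qptl_cf"
  proof -
    have id: "(id :: nat \<Rightarrow> nat) = enc" and pair: "prod_encode = enc"
      by (auto simp: fun_eq_iff)
    have "qptl_code id \<phi>U = enc \<phi>U" "qptl_code prod_encode \<phi>R = enc \<phi>R" "qptl_cf_code id \<xi> = enc \<xi>"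
      by (simp_all only: enc_qptl_def enc_qptl_cf_def id pair)
    then have "?d [set_encode AP, qptl_code id \<phi>U, qptl_code prod_encode \<phi>R, qptl_cf_code id \<xi>]
        = g (enc (set_encode AP, \<phi>U, \<phi>R, \<xi>))"
      by simp
    also have "\<dots> = (if qptl_cf_satisfiable AP (qptl_lang AP \<phi>U) R \<xi> then 1 else 0)"
      using g(2)[of "(set_encode AP, \<phi>U, \<phi>R, \<xi>)"] decide_correct[OF that] by simp
    finally show ?thesis .
  qed
  ultimately show ?thesis by blast
qed

end
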